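(* There exists a unique sequence $(\underline{\rho}_{\mathcal D}^n)_{n\ge 1}$ in $\underline V_{\mathcal D}^k$ which solves the exponential fitting scheme, i.e. such that, for all $n\in\mathbb N$ (including $n=0$), $$\sum_{K\in\mathcal M}\int_K\frac{\mathfrak u_K^{\omega,n+1}-\mathfrak u_K^{\omega,n}}{\Delta t}\,v_K+a_{\mathcal D}^\omega(\underline\rho_{\mathcal D}^{n+1},\underline v_{\mathcal D})=0\qquad\forall\,\underline v_{\mathcal D}\in\underline V_{\mathcal D}^k,$$ where $\mathfrak u_K^{\omega,n+1}=\omega_{|K}\,\rho_K^{n+1}$ and $\mathfrak u_K^{\omega,0}=u^0_{|K}$ for all $K\in\mathcal M$. Moreover, the corresponding discrete densities have mass $M$: for all $n\ge 1$, $$\int_\Omega \mathfrak u_{\mathcal M}^{\omega,n}=\int_\Omega u^0=M,$$ where $\mathfrak u^{\omega,n}_{\mathcal M}:\Omega\to\mathbb R$ is given by $(\mathfrak u^{\omega,n}_{\mathcal M})_{|K}=\mathfrak u_K^{\omega,n}=\omega_{|K}\rho_K^n$ for all $K\in\mathcal M$.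
   Context: **Data.** $\Omega\subset\mathbb R^d$, $d\in\{2,3\}$, is an open, bounded, connected polytopal set with Lipschitz boundary. $\Lambda\in L^\infty(\Omega)^{d\times d}$ is uniformly elliptic: there is $\lambda_\flat>0$ with $\Lambda(x)\xi\cdot\xi\ge\lambda_\flat|\xi|^2$ for a.e. $x\in\Omega$ and all $\xi\in\mathbb R^d$. $\phi\in W^{1,\infty}(\Omega)$, and $\omega=e^{-\phi}$. $u^0\in L^1(\Omega)$ is non-negative with $\int_\Omega u^0\log(u^0)<\infty$ and $M=\int_\Omega u^0>0$. $\Delta t>0$ is the time step, $k\ge 0$ is an integer. **Mesh.** A discretisation is a couple $\mathcal D=(\mathcal M,\mathcal E)$. $\mathcal M$ is a finite collection of disjoint, open, Lipschitz polytopes $K\subset\Omega$ (cells) of positive measure with $\overline\Omega=\bigcup_{K\in\mathcal M}\overline K$. $\mathcal E$ is a finite collection of disjoint, connected, relatively open subsets $\sigma$ of $\overline\Omega$ (faces), with positive $(d-1)$-dimensional measure, each a Lipschitz polytopal subset of an affine hyperplane, with $\partial\mathcal M:=\bigcup_{K\in\mathcal M}\partial K=\bigcup_{\sigma\in\mathcal E}\overline\sigma$; for each $K$ there is $\mathcal E_K\subset\mathcal E$ with $\partial K=\bigcup_{\sigma\in\mathcal E_K}\overline\sigma$. $n_{K,\sigma}$ is the unit normal to $\sigma\in\mathcal E_K$ pointing out of $K$; $h_X$ is the diameter of $X$. It is assumed that $\Lambda_{|K}\in W^{1,\infty}(K)^{d\times d}$ for all $K\in\mathcal M$. **Discrete space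 and operators.** $\mathbb P^q(X)$ denotes polynomial functions on $X$ of total degree at most $q$, and $\Pi_X^q$ the $L^2(X)$-orthogonal projector onto it. $\underline V_{\mathcal D}^k$ is the space of $\underline v_{\mathcal D}=((v_K)_{K\in\mathcal M},(v_\sigma)_{\sigma\in\mathcal E})$ with $v_K\in\mathbb P^{k+1}(K)$ and $v_\sigma\in\mathbb P^k(\sigma)$; the restriction of $\underline v_{\mathcal D}$ to $K$ is $\underline v_K=(v_K,(v_\sigma)_{\sigma\in\mathcal E_K})$. The discrete gradient $G_K(\underline v_K)\in\mathbb P^k(K)^d$ is defined by $$\int_K G_K(\underline v_K)\cdot\tau=-\int_K v_K\,\nabla\cdot\tau+\sum_{\sigma\in\mathcal E_K}\int_\sigma v_\sigma\,\tau\cdot n_{K,\sigma}\qquad\forall\tau\in\mathbb P^k(K)^d,$$ and the jump by $J_{K,\sigma}(\underline v_K)=\Pi_\sigma^k(v_{K|\sigma})-v_\sigma$. The bilinear form $a^\omega_{\mathcal D}$ on $\underline V_{\mathcal D}^k\times\underline V_{\mathcal D}^k$ is $$a^\omega_{\mathcal D}(\underline\rho_{\mathcal D},\underline v_{\mathcal D})=\sum_{K\in\mathcal M}\Big(\int_K\omega\Lambda G_K(\underline\rho_K)\cdot G_K(\underline v_K)+\sum_{\sigma\in\mathcal E_K}\frac{\Lambda^\omega_{K,\sigma}}{h_\sigma}\int_\sigma J_{K,\sigma}(\underline\rho_K)J_{K,\sigma}(\underline v_K)\Big),$$ with $\Lambda^\omega_{K,\sigma}=\|\omega\,\Lambda_{|K}n_{K,\sigma}\cdot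 n_{K,\sigma}\|_{L^\infty(\sigma)}$. *)

theory Defs
  imports "HOL-Probability.Essential_Supremum"
begin

section \<open>Polytopal sets, Lipschitz boundaries and surface measure\<close>

definition polytopal :: "'a::euclidean_space set \<Rightarrow> bool" where
  "polytopal S \<longleftrightarrow> (\<exists>P. finite P \<and> (\<forall>p\<in>P. polytope p) \<and> closure S = \<Union>P)"

text \<open>Near each point of its (relative) boundary, the set is the strict subgraph, in some
  direction \<open>e\<close>, of a Lipschitz function of the component orthogonal to \<open>e\<close>.  Everything is
  relative to the affine hull: this is the whole space for a non-empty open set, and the supporting
  hyperplane for a face.\<close>

definition lipschitz_boundary :: "'a::euclidean_space set \<Rightarrow> bool" where
  "lipschitz_boundary S \<longleftrightarrow>
     (\<forall>x\<in>rel_frontier S. \<exists>U e g L. open U \<and> x \<in> U \<and> norm e = 1 \<and> x + e \<in> affine hull S \<and>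
        L-lipschitz_on UNIV (g :: 'a \<Rightarrow> real) \<and>
        S \<inter> U = {y \<in> affine hull S \<inter> U. y \<bullet> e < g (y - (y \<bullet> e) *\<^sub>R e)})"

definition hyperplane :: "'a::euclidean_space set \<Rightarrow> bool" where
  "hyperplane H \<longleftrightarrow> (\<exists>a b. a \<noteq> 0 \<and> H = {x. a \<bullet> x = b})"

text \<open>Lebesgue measure of codimension one on a hyperplane \<open>H\<close>, as a Borel measure on the ambient
  space: the slab of thickness 1 around \<open>H\<close>, with the ambient Lebesgue measure, is projected
  orthogonally onto \<open>H\<close>.  By Fubini, a subset of \<open>H\<close> has the same measure as the
  right prism of height 1 over it.\<close>

definition hyperplane_measure :: "'a::euclidean_space set \<Rightarrow> 'a measure" where
  "hyperplane_measure H =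
     distr (restrict_space lborel {x. infdist x H \<le> 1/2}) borel (closest_point H)"

definition face_measure :: "'a::euclidean_space set \<Rightarrow> 'a measure" where
  "face_measure \<sigma> = restrict_space (hyperplane_measure (affine hull \<sigma>)) \<sigma>"


section \<open>The spaces L-infinity and W-1-infinity, and traces\<close>

definition Linf :: "'a::euclidean_space set \<Rightarrow> ('a \<Rightarrow> real) \<Rightarrow> bool" where
  "Linf S f \<longleftrightarrow> f \<in> borel_measurable (lebesgue_on S) \<and> (\<exists>C. AE x in lebesgue_on S. \<bar>f x\<bar> \<le> C)"

definition Linf_norm :: "'a measure \<Rightarrow> ('a \<Rightarrow> real) \<Rightarrow> real" where
  "Linf_norm M f = real_of_ereal (esssup M (\<lambda>x. ereal \<bar>f x\<bar>))"

definition partial :: "'d \<Rightarrow> (real^'d \<Rightarrow> 'b::real_normed_vector) \<Rightarrow> real^'d \<Rightarrow> 'b" where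
  "partial i f x = frechet_derivative f (at x) (axis i 1)"

definition divergence :: "(real^'d \<Rightarrow> real^'d) \<Rightarrow> real^'d \<Rightarrow> real" where
  "divergence \<tau> x = (\<Sum>i\<in>UNIV. partial i \<tau> x $ i)"

definition test_function :: "(real^'d) set \<Rightarrow> (real^'d \<Rightarrow> real) \<Rightarrow> bool" where
  "test_function S \<psi> \<longleftrightarrow>
     (\<exists>C. compact C \<and> C \<subseteq> S \<and> (\<forall>x. x \<notin> C \<longrightarrow> \<psi> x = 0)) \<and>
     (\<forall>x. \<psi> differentiable (at x)) \<and> (\<forall>i. continuous_on UNIV (partial i \<psi>))"

definition weak_partial ::
  "(real^'d) set \<Rightarrow> 'd \<Rightarrow> (real^'d \<Rightarrow> real) \<Rightarrow> (real^'d \<Rightarrow> real) \<Rightarrow> bool" where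
  "weak_partial S i f g \<longleftrightarrow>
     (\<forall>\<psi>. test_function S \<psi> \<longrightarrow>
        (LINT x|lebesgue_on S. f x * partial i \<psi> x) = - (LINT x|lebesgue_on S. g x * \<psi> x))"

definition W1inf :: "(real^'d) set \<Rightarrow> (real^'d \<Rightarrow> real) \<Rightarrow> bool" where
  "W1inf S f \<longleftrightarrow> Linf S f \<and> (\<forall>i. \<exists>g. Linf S g \<and> weak_partial S i f g)"

text \<open>The trace from inside \<open>K\<close> at a boundary point \<open>x\<close> is the essential limit at \<open>x\<close>.  For
  \<open>f\<close> in W-1-infinity of a Lipschitz polytope it is the value at \<open>x\<close> of the extension to the
  closure of \<open>K\<close> of the continuous representative of \<open>f\<close>; it only depends on the almost everywhere
  class of \<open>f\<close>.\<close>

definition trace_from :: "'a::euclidean_space set \<Rightarrow> ('a \<Rightarrow> real) \<Rightarrow> 'a \<Rightarrow> real" where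
  "trace_from K f x =
     (THE l. \<forall>\<epsilon>>0. \<exists>\<delta>>0. AE y in lebesgue_on (K \<inter> ball x \<delta>). \<bar>f y - l\<bar> < \<epsilon>)"


section \<open>Meshes\<close>

definition mesh_face :: "'a::euclidean_space set \<Rightarrow> bool" where
  "mesh_face \<sigma> \<longleftrightarrow>
     (\<exists>H. hyperplane H \<and> openin (top_of_set H) \<sigma>) \<and> connected \<sigma> \<and>
     polytopal \<sigma> \<and> lipschitz_boundary \<sigma> \<and> 0 < emeasure (face_measure \<sigma>) \<sigma>"

definition mesh_cell :: "'a::euclidean_space set \<Rightarrow> bool" where
  "mesh_cell K \<longleftrightarrow> open K \<and> polytopal K \<and> lipschitz_boundary K \<and> 0 < emeasure lebesgue K"

definition discretisation ::
  "'a::euclidean_space set \<Rightarrow> 'a set set \<Rightarrow> 'a set set \<Rightarrow> ('a set \<Rightarrow> 'a set set) \<Rightarrow> bool" where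
  "discretisation \<Omega> \<M> \<E> \<E>K \<longleftrightarrow>
     finite \<M> \<and> disjoint \<M> \<and> (\<forall>K\<in>\<M>. mesh_cell K \<and> K \<subseteq> \<Omega>) \<and>
     closure \<Omega> = (\<Union>K\<in>\<M>. closure K) \<and>
     finite \<E> \<and> disjoint \<E> \<and> (\<forall>\<sigma>\<in>\<E>. mesh_face \<sigma> \<and> \<sigma> \<subseteq> closure \<Omega>) \<and>
     (\<Union>K\<in>\<M>. frontier K) = (\<Union>\<sigma>\<in>\<E>. closure \<sigma>) \<and>
     (\<forall>K\<in>\<M>. \<E>K K \<subseteq> \<E> \<and> frontier K = (\<Union>\<sigma>\<in>\<E>K K. closure \<sigma>))"

definition outward_normal :: "'a::euclidean_space set \<Rightarrow> 'a set \<Rightarrow> 'a" where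
  "outward_normal K \<sigma> =
     (THE n. norm n = 1 \<and> (\<forall>x\<in>\<sigma>. \<forall>y\<in>\<sigma>. n \<bullet> (x - y) = 0) \<and>
        (\<forall>x\<in>\<sigma>. \<forall>\<^sub>F t in at_right 0. x - t *\<^sub>R n \<in> K \<and> x + t *\<^sub>R n \<notin> K))"


section \<open>Discrete unknowns\<close>

definition polys :: "nat \<Rightarrow> (real^'d \<Rightarrow> real) set" where
  "polys q = {p. \<exists>c. p = (\<lambda>x. \<Sum>\<alpha> | sum \<alpha> UNIV \<le> q. c \<alpha> * (\<Prod>i\<in>UNIV. (x $ i) ^ \<alpha> i))}"

definition vec_polys :: "nat \<Rightarrow> (real^'d \<Rightarrow> real^'d) set" where
  "vec_polys q = {\<tau>. \<forall>i. (\<lambda>x. \<tau> x $ i) \<in> polys q}"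

definition polys_on :: "nat \<Rightarrow> (real^'d) set \<Rightarrow> (real^'d \<Rightarrow> real) set" where
  "polys_on q X = (\<lambda>p. restrict p X) ` polys q"

text \<open>A polynomial on a cell (a set with non-empty interior) is represented by its unique polynomial
  extension to the whole space, which also provides its values on the faces of the cell.  Polynomials
  on a face have many such extensions; they are genuine functions on the face, made extensional.\<close>

type_synonym 'd hybrid = "((real^'d) set \<Rightarrow> real^'d \<Rightarrow> real) \<times> ((real^'d) set \<Rightarrow> real^'d \<Rightarrow> real)"

definition hybrid_space :: "(real^'d) set set \<Rightarrow> (real^'d) set set \<Rightarrow> nat \<Rightarrow> 'd hybrid set" where
  "hybrid_space \<M> \<E> k = (\<M> \<rightarrow>\<^sub>E polys (k + 1)) \<times> (\<Pi>\<^sub>E \<sigma>\<in>\<E>. polys_on k \<sigma>)"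

definition face_projection :: "nat \<Rightarrow> (real^'d) set \<Rightarrow> (real^'d \<Rightarrow> real) \<Rightarrow> real^'d \<Rightarrow> real" where
  "face_projection k \<sigma> f =
     (THE p. p \<in> polys_on k \<sigma> \<and>
        (\<forall>q\<in>polys_on k \<sigma>. (LINT x|face_measure \<sigma>. (f x - p x) * q x) = 0))"

definition discrete_gradient ::
  "((real^'d) set \<Rightarrow> (real^'d) set set) \<Rightarrow> nat \<Rightarrow> (real^'d) set \<Rightarrow> 'd hybrid \<Rightarrow> real^'d \<Rightarrow> real^'d" where
  "discrete_gradient \<E>K k K v =
     (THE G. G \<in> vec_polys k \<and>
        (\<forall>\<tau>\<in>vec_polys k.
           (LINT x|lebesgue_on K. G x \<bullet> \<tau> x) =
             - (LINT x|lebesgue_on K. fst v K x * divergence \<tau> x) +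
             (\<Sum>\<sigma>\<in>\<E>K K. LINT x|face_measure \<sigma>. snd v \<sigma> x * (\<tau> x \<bullet> outward_normal K \<sigma>))))"

definition face_jump ::
  "nat \<Rightarrow> (real^'d) set \<Rightarrow> (real^'d) set \<Rightarrow> 'd hybrid \<Rightarrow> real^'d \<Rightarrow> real" where
  "face_jump k K \<sigma> v x = face_projection k \<sigma> (fst v K) x - snd v \<sigma> x"


section \<open>The exponential fitting scheme\<close>

definition face_weight ::
  "(real^'d \<Rightarrow> real) \<Rightarrow> (real^'d \<Rightarrow> real^'d^'d) \<Rightarrow> (real^'d) set \<Rightarrow> (real^'d) set \<Rightarrow> real" where
  "face_weight \<omega> \<Lambda> K \<sigma> =
     (let n = outward_normal K \<sigma>
      in Linf_norm (face_measure \<sigma>) (trace_from K (\<lambda>x. \<omega> x * ((\<Lambda> x *v n) \<bullet> n))))"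

definition diffusion_form ::
  "(real^'d) set set \<Rightarrow> ((real^'d) set \<Rightarrow> (real^'d) set set) \<Rightarrow> nat \<Rightarrow>
   (real^'d \<Rightarrow> real) \<Rightarrow> (real^'d \<Rightarrow> real^'d^'d) \<Rightarrow> 'd hybrid \<Rightarrow> 'd hybrid \<Rightarrow> real" where
  "diffusion_form \<M> \<E>K k \<omega> \<Lambda> \<rho> v =
     (\<Sum>K\<in>\<M>.
        (LINT x|lebesgue_on K.
           \<omega> x * ((\<Lambda> x *v discrete_gradient \<E>K k K \<rho> x) \<bullet> discrete_gradient \<E>K k K v x)) +
        (\<Sum>\<sigma>\<in>\<E>K K. face_weight \<omega> \<Lambda> K \<sigma> / diameter \<sigma> *
           (LINT x|face_measure \<sigma>. face_jump k K \<sigma> \<rho> x * face_jump k K \<sigma> v x)))"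

definition cell_density ::
  "(real^'d \<Rightarrow> real) \<Rightarrow> (real^'d \<Rightarrow> real) \<Rightarrow> (nat \<Rightarrow> 'd hybrid) \<Rightarrow> nat \<Rightarrow>
   (real^'d) set \<Rightarrow> real^'d \<Rightarrow> real" where
  "cell_density \<omega> u0 \<rho> n K x = (if n = 0 then u0 x else \<omega> x * fst (\<rho> n) K x)"

text \<open>The cells are pairwise disjoint, so at most one term of the sum is non-zero; the value on the
  mesh skeleton, a null set, is set to 0.\<close>

definition global_density ::
  "(real^'d) set set \<Rightarrow> (real^'d \<Rightarrow> real) \<Rightarrow> (real^'d \<Rightarrow> real) \<Rightarrow> (nat \<Rightarrow> 'd hybrid) \<Rightarrow> nat \<Rightarrow>
   real^'d \<Rightarrow> real" where
  "global_density \<M> \<omega> u0 \<rho> n x = (\<Sum>K\<in>\<M>. if x \<in> K then cell_density \<omega> u0 \<rho> n K x else 0)"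

text \<open>Sequences indexed from 1: they are extensional on \<open>{1..}\<close>, so that equality of two solutions
  as functions means equality of all terms of index at least 1.\<close>

definition solves_scheme ::
  "(real^'d) set set \<Rightarrow> (real^'d) set set \<Rightarrow> ((real^'d) set \<Rightarrow> (real^'d) set set) \<Rightarrow> nat \<Rightarrow>
   (real^'d \<Rightarrow> real) \<Rightarrow> (real^'d \<Rightarrow> real^'d^'d) \<Rightarrow> (real^'d \<Rightarrow> real) \<Rightarrow> real \<Rightarrow>
   (nat \<Rightarrow> 'd hybrid) \<Rightarrow> bool" where
  "solves_scheme \<M> \<E> \<E>K k \<omega> \<Lambda> u0 \<Delta>t \<rho> \<longleftrightarrow>
     \<rho> \<in> {1..} \<rightarrow>\<^sub>E hybrid_space \<M> \<E> k \<and>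
     (\<forall>n. \<forall>v\<in>hybrid_space \<M> \<E> k.
        (\<Sum>K\<in>\<M>. LINT x|lebesgue_on K.
            (cell_density \<omega> u0 \<rho> (Suc n) K x - cell_density \<omega> u0 \<rho> n K x) / \<Delta>t * fst v K x) +
        diffusion_form \<M> \<E>K k \<omega> \<Lambda> (\<rho> (Suc n)) v = 0)"

end

theory Submission
  imports Defs "HOL-Library.Function_Algebras"
begin

text \<open>Each time step is a square linear system whose bilinear form, mass over time step plus diffusion,
  is positive definite: the mass term controls the cell unknowns, the jump term the face unknowns,
  provided that every face belongs to a cell and the face weights are positive and finite.  The latter
  holds because, near a face, a cell is a half-ball, on which a function in W-1-infinity is Lipschitz
  almost everywhere and so has essential limits on the face.  Mass is conserved because the constant
  hybrid function 1 has zero jumps and, by the divergence theorem on the cells, zero discrete gradient.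

  The divergence theorem is obtained by differentiating the integral of \<open>p (z + t e)\<close> over the cell:
  along almost every line parallel to \<open>e\<close>, the translated cell differs from the cell by signed prisms
  over the faces, and the volume of a prism only depends on its base and its height.\<close>

section \<open>Finite-dimensional variational problems\<close>

text \<open>Three mismatches between the definitions and linear algebra shape the argument. Members
  of \<open>hybrid_space\<close> are extensional, hence not closed under pointwise operations, and a
  polynomial on a face has many extensions. The linear problem is therefore posed on a larger space
  of globally defined functions, where the form is only semidefinite, its null vectors being those
  invisible on the mesh; this is why the elimination has to tolerate null directions. Next, a mesh
  only equates unions of closures, so that each face lies on some cell, without which its unknown
  would be undetermined, must be derived from disjointness and relative openness. Finally, gradient,
  face projection, normal and trace are definite descriptions, and \<open>Linf_norm\<close> of an
  essentially unbounded function is 0, so existence, uniqueness or finiteness must be settled before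
  such a value means anything. Polynomials and hybrid families are handled as vectors for the
  pointwise operations, which are set up here.\<close>

instantiation "fun" :: (type, real_vector) real_vector
begin

definition scaleR_fun_def: "r *\<^sub>R f = (\<lambda>x. r *\<^sub>R f x)"

instance
  by standard (auto simp: scaleR_fun_def fun_eq_iff algebra_simps)

end

lemma scaleR_fun_apply [simp]: "(r *\<^sub>R f) x = r *\<^sub>R f x"
  by (simp add: scaleR_fun_def)

lemma sum_fun_apply: "(\<Sum>i\<in>A. f i) x = (\<Sum>i\<in>A. f i x)"
  for f :: "'i \<Rightarrow> 'x \<Rightarrow> 'b::real_vector"
  by (induction A rule: infinite_finite_induct) auto

text \<open>Elimination of one generator at a time.  The generator \<open>a\<close> is replaced by \<open>a - w\<close>, which
  \<open>B\<close> makes orthogonal to the previous ones; it may be null if \<open>B\<close> is only semidefinite.\<close>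

lemma galerkin_solvable:
  fixes B :: "'v::real_vector \<Rightarrow> 'v \<Rightarrow> real" and L :: "'v \<Rightarrow> real"
  assumes "finite F" "F \<subseteq> V" "subspace V"
    and Bl: "\<And>u v w c. \<lbrakk>u \<in> V; v \<in> V; w \<in> V\<rbrakk> \<Longrightarrow> B (u + c *\<^sub>R v) w = B u w + c * B v w"
    and Br: "\<And>u v w c. \<lbrakk>u \<in> V; v \<in> V; w \<in> V\<rbrakk> \<Longrightarrow> B w (u + c *\<^sub>R v) = B w u + c * B w v"
    and Ll: "\<And>u v c. \<lbrakk>u \<in> V; v \<in> V\<rbrakk> \<Longrightarrow> L (u + c *\<^sub>R v) = L u + c * L v"
    and null: "\<And>v w. \<lbrakk>v \<in> V; w \<in> V; B v v = 0\<rbrakk> \<Longrightarrow> B w v = 0 \<and> L v = 0"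
  shows "\<exists>u\<in>span F. \<forall>v\<in>span F. B u v = L v"
  using assms(1,2) Ll null
proof (induction F arbitrary: L rule: finite_induct)
  case empty
  have "B 0 0 = 0"
    using Bl[of 0 0 0 1] subspace_0[OF \<open>subspace V\<close>] by simp
  then have "L 0 = 0" "B 0 0 = 0"
    using empty.prems(3)[of 0 0] subspace_0[OF \<open>subspace V\<close>] by auto
  then show ?case by auto
next
  case (insert a F)
  have sp: "span (insert a F) \<subseteq> V" "span F \<subseteq> V"
    using insert.prems(1) \<open>subspace V\<close> by (simp_all add: span_minimal)
  have aV: "a \<in> V" using insert.prems by auto
  obtain u0 where u0: "u0 \<in> span F" "\<And>v. v \<in> span F \<Longrightarrow> B u0 v = L v"
    using insert.IH[of L, OF _ insert.prems(2,3)] insert.prems(1) by blast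
  \<comment> \<open>The induction hypothesis is used a second time, with the functional
    \<open>B a\<close> in place of \<open>L\<close>: \<open>w\<close> acts on the earlier generators
    as \<open>a\<close> does.\<close>
  have "\<exists>w\<in>span F. \<forall>v\<in>span F. B w v = B a v"
  proof (rule insert.IH)
    show "F \<subseteq> V" using insert.prems by auto
    show "B a (u + c *\<^sub>R v) = B a u + c * B a v" if "u \<in> V" "v \<in> V" for u v c
      using Br that aV by blast
    show "B w v = 0 \<and> B a v = 0" if "v \<in> V" "w \<in> V" "B v v = 0" for v w
      using insert.prems(3) that aV by blast
  qed
  then obtain w where w: "w \<in> span F" "\<And>v. v \<in> span F \<Longrightarrow> B w v = B a v"
    by blast
  define a' where "a' = a + (-1) *\<^sub>R w"
  have wV: "w \<in> V" and u0V: "u0 \<in> V" using w u0 sp by auto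
  have a'V: "a' \<in> V"
    unfolding a'_def using aV wV \<open>subspace V\<close> by (intro subspace_add subspace_scale)
  have a'v: "B a' v = 0" if "v \<in> span F" for v
    using Bl[of a w v "-1"] aV wV that sp w(2)[OF that] by (auto simp: a'_def)
  have a's: "a' \<in> span (insert a F)"
    unfolding a'_def using w(1) span_mono[of F "insert a F"]
    by (intro span_add span_scale) (auto simp: span_base)
  \<comment> \<open>If \<open>B a' a' = 0\<close>, division by zero gives \<open>t = 0\<close>; the
    hypothesis \<open>null\<close> then makes \<open>L a'\<close> and \<open>B u0 a'\<close> vanish,
    so \<open>tB\<close> holds in both cases.\<close>
  define t where "t = (L a' - B u0 a') / B a' a'"
  have tB: "B u0 a' + t * B a' a' = L a'"
    using insert.prems(3)[OF a'V u0V] by (cases "B a' a' = 0") (auto simp: t_def)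
  show ?case
  proof (intro bexI ballI)
    show "u0 + t *\<^sub>R a' \<in> span (insert a F)"
      using u0(1) span_mono[of F "insert a F"] a's by (intro span_add span_scale) auto
    fix v assume "v \<in> span (insert a F)"
    then obtain k where k: "v - k *\<^sub>R a \<in> span F"
      by (auto simp: span_insert)
    define v0 where "v0 = v - k *\<^sub>R a + k *\<^sub>R w"
    have v0: "v0 \<in> span F"
      unfolding v0_def using k w(1) by (intro span_add span_scale)
    then have v0V: "v0 \<in> V" using sp by auto
    have v: "v = v0 + k *\<^sub>R a'"
      by (simp add: v0_def a'_def algebra_simps)
    have "B (u0 + t *\<^sub>R a') v = B u0 v0 + k * B u0 a' + t * (B a' v0 + k * B a' a')"
      unfolding v using u0V a'V v0V \<open>subspace V\<close>
      by (simp add: Bl Br subspace_add subspace_scale) (simp add: algebra_simps)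
    also have "\<dots> = L v0 + k * (B u0 a' + t * B a' a')"
      using u0(2)[OF v0] a'v[OF v0] by (simp add: algebra_simps)
    also have "\<dots> = L v"
      using insert.prems(2)[OF v0V a'V] by (simp add: tB v)
    finally show "B (u0 + t *\<^sub>R a') v = L v" .
  qed
qed

section \<open>Polynomials and continuously differentiable functions\<close>

text \<open>Continuity is asked of directional derivatives in fixed directions; in finite dimension
  this is the usual class C1. \<open>C1_fun_iff_partial\<close> identifies it with the smoothness in
  \<open>test_function\<close>.\<close>

definition C1_fun :: "('a::real_normed_vector \<Rightarrow> real) \<Rightarrow> bool" where
  "C1_fun f \<longleftrightarrow> (\<exists>f'. \<forall>x. (f has_derivative f' x) (at x) \<and> (\<forall>v. continuous_on UNIV (\<lambda>x. f' x v)))"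

lemma C1_funI:
  assumes "\<And>x. (f has_derivative f' x) (at x)" "\<And>v. continuous_on UNIV (\<lambda>x. f' x v)"
  shows "C1_fun f"
  using assms unfolding C1_fun_def by blast

lemma C1_funE:
  assumes "C1_fun f"
  obtains f' where "\<And>x. (f has_derivative f' x) (at x)" "\<And>v. continuous_on UNIV (\<lambda>x. f' x v)"
  using assms unfolding C1_fun_def by blast

lemma C1_fun_continuous: "C1_fun f \<Longrightarrow> continuous_on S f"
  by (metis C1_fun_def UNIV_I continuous_at_imp_continuous_on has_derivative_continuous)

lemma C1_fun_const: "C1_fun (\<lambda>x. c)"
  by (rule C1_funI[of _ "\<lambda>x h. 0"]) auto

lemma C1_fun_inner: "C1_fun (\<lambda>x. x \<bullet> (b::'a::real_inner))"
  by (rule C1_funI[of _ "\<lambda>x h. h \<bullet> b"]) (auto intro!: derivative_eq_intros)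

lemma C1_fun_add:
  assumes "C1_fun f" "C1_fun g" shows "C1_fun (\<lambda>x. f x + g x)"
proof -
  obtain f' where f': "\<And>x. (f has_derivative f' x) (at x)" "\<And>v. continuous_on UNIV (\<lambda>x. f' x v)"
    by (rule C1_funE[OF assms(1)]) (rule that)
  obtain g' where g': "\<And>x. (g has_derivative g' x) (at x)" "\<And>v. continuous_on UNIV (\<lambda>x. g' x v)"
    by (rule C1_funE[OF assms(2)]) (rule that)
  show ?thesis
    by (rule C1_funI[OF has_derivative_add[OF f'(1) g'(1)]]) (intro continuous_on_add f' g')
qed

lemma C1_fun_mult:
  assumes "C1_fun f" "C1_fun g" shows "C1_fun (\<lambda>x. f x * g x)"
proof -
  obtain f' where f': "\<And>x. (f has_derivative f' x) (at x)" "\<And>v. continuous_on UNIV (\<lambda>x. f' x v)"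
    by (rule C1_funE[OF assms(1)]) (rule that)
  obtain g' where g': "\<And>x. (g has_derivative g' x) (at x)" "\<And>v. continuous_on UNIV (\<lambda>x. g' x v)"
    by (rule C1_funE[OF assms(2)]) (rule that)
  show ?thesis
    by (rule C1_funI[OF has_derivative_mult[OF f'(1) g'(1)]])
      (intro continuous_on_add continuous_on_mult C1_fun_continuous assms f' g')
qed

lemma C1_fun_sum: "(\<And>i. i \<in> A \<Longrightarrow> C1_fun (f i)) \<Longrightarrow> C1_fun (\<lambda>x. \<Sum>i\<in>A. f i x)"
  by (induction A rule: infinite_finite_induct) (auto intro: C1_fun_add C1_fun_const)

lemma C1_fun_prod: "(\<And>i. i \<in> A \<Longrightarrow> C1_fun (f i)) \<Longrightarrow> C1_fun (\<lambda>x. \<Prod>i\<in>A. f i x)"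
  by (induction A rule: infinite_finite_induct) (auto intro: C1_fun_mult C1_fun_const)

lemma C1_fun_power: "C1_fun f \<Longrightarrow> C1_fun (\<lambda>x. f x ^ n)"
  by (induction n) (auto intro: C1_fun_mult C1_fun_const)

text \<open>Continuity of \<open>h'\<close> is demanded on the range of \<open>f\<close> only,
  because the outer function used for cut-offs has a pole elsewhere.\<close>

lemma C1_fun_compose:
  assumes "C1_fun f" "\<And>x. (h has_real_derivative h' (f x)) (at (f x))" "continuous_on (range f) h'"
  shows "C1_fun (\<lambda>x. h (f x))"
proof -
  obtain f' where f': "\<And>x. (f has_derivative f' x) (at x)" "\<And>v. continuous_on UNIV (\<lambda>x. f' x v)"
    by (rule C1_funE[OF assms(1)]) (rule that)
  show ?thesis
  proof (rule C1_funI)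
    show "((\<lambda>x. h (f x)) has_derivative (\<lambda>v. h' (f x) * f' x v)) (at x)" for x
      using has_derivative_compose[OF f'(1) has_field_derivative_imp_has_derivative[OF assms(2)]]
      by simp
    show "continuous_on UNIV (\<lambda>x. h' (f x) * f' x v)" for v
      by (intro continuous_on_mult f' continuous_on_compose2[OF assms(3) C1_fun_continuous[OF assms(1)]])
        auto
  qed
qed

lemma C1_fun_translate:
  assumes "C1_fun f" shows "C1_fun (\<lambda>x. f (x + a))"
proof -
  obtain f' where f': "\<And>x. (f has_derivative f' x) (at x)" "\<And>v. continuous_on UNIV (\<lambda>x. f' x v)"
    by (rule C1_funE[OF assms(1)]) (rule that)
  show ?thesis
  proof (rule C1_funI)
    have "((\<lambda>x. x + a) has_derivative (\<lambda>x. x)) (at x)" for x :: 'a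
      by (auto intro!: derivative_eq_intros)
    then show "((\<lambda>x. f (x + a)) has_derivative f' (x + a)) (at x)" for x
      using has_derivative_compose[OF _ f'(1)] by blast
    show "continuous_on UNIV (\<lambda>x. f' (x + a) v)" for v
      by (rule continuous_on_compose2[OF f'(2)]) (auto intro!: continuous_intros)
  qed
qed

lemma C1_fun_derivative:
  assumes "C1_fun f"
  shows "(f has_derivative frechet_derivative f (at x)) (at x)"
    and "continuous_on UNIV (\<lambda>x. frechet_derivative f (at x) v)"
proof -
  obtain f' where f': "\<And>x. (f has_derivative f' x) (at x)" "\<And>v. continuous_on UNIV (\<lambda>x. f' x v)"
    by (rule C1_funE[OF assms(1)]) (rule that)
  have "frechet_derivative f (at x) = f' x" for x
    using frechet_derivative_at[OF f'(1)] by simp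
  then show "(f has_derivative frechet_derivative f (at x)) (at x)"
    "continuous_on UNIV (\<lambda>x. frechet_derivative f (at x) v)"
    using f' by auto
qed

lemma linear_eq_sum_axis:
  fixes f :: "real^'d \<Rightarrow> 'b::real_vector"
  assumes "linear f"
  shows "f v = (\<Sum>i\<in>UNIV. (v $ i) *\<^sub>R f (axis i 1))"
proof -
  have "f v = f (\<Sum>i\<in>UNIV. (v $ i) *\<^sub>R axis i 1)"
    using basis_expansion[of v] by (simp add: scalar_mult_eq_scaleR)
  then show ?thesis
    by (simp add: linear_sum[OF assms] linear_scale[OF assms])
qed

lemma C1_fun_partial:
  fixes f :: "real^'d \<Rightarrow> real"
  assumes "C1_fun f"
  shows "continuous_on UNIV (partial i f)"
    and "frechet_derivative f (at x) v = (\<Sum>i\<in>UNIV. (v $ i) * partial i f x)"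
proof -
  show "continuous_on UNIV (partial i f)"
    using C1_fun_derivative(2)[OF assms] by (simp add: partial_def[abs_def])
  show "frechet_derivative f (at x) v = (\<Sum>i\<in>UNIV. (v $ i) * partial i f x)"
    using linear_eq_sum_axis[of "frechet_derivative f (at x)" v]
      has_derivative_linear[OF C1_fun_derivative(1)[OF assms]]
    by (simp add: partial_def)
qed

lemma C1_fun_iff_partial:
  fixes f :: "real^'d \<Rightarrow> real"
  shows "C1_fun f \<longleftrightarrow> (\<forall>x. f differentiable (at x)) \<and> (\<forall>i. continuous_on UNIV (partial i f))"
proof (intro iffI conjI allI)
  assume f: "(\<forall>x. f differentiable (at x)) \<and> (\<forall>i. continuous_on UNIV (partial i f))"
  then have der: "(f has_derivative frechet_derivative f (at x)) (at x)" for x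
    by (simp add: frechet_derivative_works)
  have "frechet_derivative f (at x) v = (\<Sum>i\<in>UNIV. (v $ i) * partial i f x)" for x v
    using linear_eq_sum_axis[of "frechet_derivative f (at x)" v] has_derivative_linear[OF der]
    by (simp add: partial_def)
  then show "C1_fun f"
    using f der by (intro C1_funI[of f "\<lambda>x. frechet_derivative f (at x)"])
      (auto intro!: continuous_intros)
next
  show "f differentiable (at x)" if "C1_fun f" for x
    using C1_fun_derivative(1)[OF that] unfolding differentiable_def by blast
qed (rule C1_fun_partial)

section \<open>Multivariate polynomials\<close>

definition monomial :: "('d \<Rightarrow> nat) \<Rightarrow> real^'d \<Rightarrow> real" where
  "monomial \<alpha> x = (\<Prod>i\<in>UNIV. (x $ i) ^ \<alpha> i)"

lemma finite_multi_indices: "finite {\<alpha>::'d::finite \<Rightarrow> nat. sum \<alpha> UNIV \<le> q}"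
proof (rule finite_subset)
  show "{\<alpha>::'d \<Rightarrow> nat. sum \<alpha> UNIV \<le> q} \<subseteq> Pi\<^sub>E UNIV (\<lambda>_. {..q})"
    by (auto intro: order_trans[OF member_le_sum[of _ UNIV]])
qed (auto intro: finite_PiE)

lemma polys_eq: "polys q = range (\<lambda>c. \<Sum>\<alpha> | sum \<alpha> UNIV \<le> q. c \<alpha> *\<^sub>R monomial \<alpha>)"
  unfolding polys_def monomial_def[abs_def] by (auto simp: fun_eq_iff sum_fun_apply)

text \<open>Presenting polynomials as the span of a finite set is what lets
  \<open>galerkin_solvable\<close> act on them.\<close>

lemma polys_eq_span:
  "polys q = span (monomial ` {\<alpha>::'d::finite \<Rightarrow> nat. sum \<alpha> UNIV \<le> q})" (is "_ = span (monomial ` ?A)")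
proof
  show "polys q \<subseteq> span (monomial ` ?A)"
    by (auto simp: polys_eq intro!: span_sum span_scale intro: span_base)
  show "span (monomial ` ?A) \<subseteq> polys q"
  proof
    fix p assume "p \<in> span (monomial ` ?A)"
    then show "p \<in> polys q"
    proof (induction rule: span_induct_alt)
      case base
      show ?case unfolding polys_eq by (rule range_eqI[of _ _ "\<lambda>_. 0"]) (simp add: fun_eq_iff sum_fun_apply)
    next
      case (step r x p)
      then obtain \<beta> c where "\<beta> \<in> ?A" "x = monomial \<beta>" "p = (\<Sum>\<alpha>\<in>?A. c \<alpha> *\<^sub>R monomial \<alpha>)"
        unfolding polys_eq by auto
      then have "r *\<^sub>R x + p = (\<Sum>\<alpha>\<in>?A. (c \<alpha> + (if \<alpha> = \<beta> then r else 0)) *\<^sub>R monomial \<alpha>)"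
        by (simp add: scaleR_left_distrib sum.distrib if_distrib[of "\<lambda>a. a *\<^sub>R _"] sum.delta
            finite_multi_indices cong: if_cong)
      then show ?case unfolding polys_eq by (intro range_eqI)
    qed
  qed
qed

lemma subspace_polys: "subspace (polys q)"
  unfolding polys_eq_span by simp

lemma const_in_polys: "(\<lambda>x. c) \<in> polys q"
proof -
  have "(\<lambda>x. c) = c *\<^sub>R monomial (\<lambda>_. 0)"
    by (simp add: fun_eq_iff monomial_def)
  moreover have "monomial (\<lambda>_. 0) \<in> polys q"
    unfolding polys_eq_span by (intro span_base) auto
  ultimately show ?thesis
    using subspace_scale[OF subspace_polys] by metis
qed

lemma C1_fun_monomial: "C1_fun (monomial \<alpha>)"
proof -
  have "C1_fun (\<lambda>x::real^'a. x $ i)" for i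
    using C1_fun_inner[of "axis i (1::real)"] by (simp add: inner_axis)
  then show ?thesis
    unfolding monomial_def[abs_def] by (intro C1_fun_prod C1_fun_power)
qed

lemma C1_fun_polys:
  assumes "p \<in> polys q" shows "C1_fun p"
proof -
  obtain c where "p = (\<lambda>x. \<Sum>\<alpha> | sum \<alpha> UNIV \<le> q. c \<alpha> * monomial \<alpha> x)"
    using assms unfolding polys_def monomial_def by auto
  then show ?thesis
    by (simp add: C1_fun_sum C1_fun_mult C1_fun_const C1_fun_monomial)
qed

lemma continuous_on_polys: "p \<in> polys q \<Longrightarrow> continuous_on S p"
  by (simp add: C1_fun_continuous C1_fun_polys)

lemma polys_on_line:
  assumes "p \<in> polys q" shows "\<exists>P. \<forall>t. p (x + t *\<^sub>R v) = poly P t"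
proof -
  obtain c where p: "p = (\<lambda>x. \<Sum>\<alpha> | sum \<alpha> UNIV \<le> q. c \<alpha> * (\<Prod>i\<in>UNIV. (x $ i) ^ \<alpha> i))"
    using assms unfolding polys_def by auto
  show ?thesis
    by (rule exI[of _ "\<Sum>\<alpha> | sum \<alpha> UNIV \<le> q. Polynomial.smult (c \<alpha>) (\<Prod>i\<in>UNIV. [:x $ i, v $ i:] ^ \<alpha> i)"])
      (simp add: p poly_sum poly_prod mult.commute)
qed

text \<open>Any point is joined by a line to a point of \<open>U\<close>; along it \<open>p\<close>
  is a univariate polynomial with infinitely many roots, hence zero.\<close>

lemma polys_eq_0:
  assumes p: "p \<in> polys q" and U: "open U" "U \<noteq> {}" and 0: "\<And>x. x \<in> U \<Longrightarrow> p x = 0"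
  shows "p = 0"
proof
  fix y
  obtain x where "x \<in> U" using U by auto
  then obtain r where x: "r > 0" "ball x r \<subseteq> U"
    using openE[OF U(1)] by metis
  obtain P where P: "\<And>t. p (x + t *\<^sub>R (y - x)) = poly P t"
    using polys_on_line[OF p] by blast
  \<comment> \<open>For \<open>0 < t < s\<close> the point of the line stays in
    \<open>ball x r\<close>; the \<open>1 +\<close> guards against \<open>y = x\<close>.\<close>
  define s where "s = r / (1 + norm (y - x))"
  have s: "s > 0" using x by (simp add: s_def add_pos_nonneg)
  have "{0<..<s} \<subseteq> {t. poly P t = 0}"
  proof clarify
    fix t assume t: "t \<in> {0<..<s}"
    have "t * norm (y - x) \<le> t * (1 + norm (y - x))"
      using t by (intro mult_left_mono) auto
    also have "\<dots> < r"
      using t by (simp add: s_def field_simps add_pos_nonneg)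
    finally have "x + t *\<^sub>R (y - x) \<in> ball x r"
      using t by (simp add: dist_norm)
    then show "poly P t = 0" using 0 x(2) P by (metis subsetD)
  qed
  then have "infinite {t. poly P t = 0}"
    using s infinite_Ioo infinite_super by blast
  then have "P = 0" using poly_roots_finite by blast
  then show "p y = 0 y" using P[of 1] by simp
qed

lemma vec_polys_eq_span:
  "vec_polys q = span ((\<lambda>(p, i) x. p x *\<^sub>R axis i 1) ` (monomial ` {\<alpha>::'d::finite \<Rightarrow> nat. sum \<alpha> UNIV \<le> q} \<times> UNIV))"
  (is "_ = span (?f ` (?A \<times> UNIV))")
proof
  have sub: "subspace (vec_polys q :: (real^'d \<Rightarrow> real^'d) set)"
  proof (rule subspaceI)
    show "0 \<in> vec_polys q"
      using const_in_polys[of 0] by (simp add: vec_polys_def)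
    show "\<sigma> + \<tau> \<in> vec_polys q" if "\<sigma> \<in> vec_polys q" "\<tau> \<in> vec_polys q" for \<sigma> \<tau>
      using that subspace_add[OF subspace_polys] by (fastforce simp: vec_polys_def plus_fun_def)
    show "c *\<^sub>R \<tau> \<in> vec_polys q" if "\<tau> \<in> vec_polys q" for c \<tau>
      using that subspace_scale[OF subspace_polys] by (fastforce simp: vec_polys_def scaleR_fun_def)
  qed
  have "?f (p, i) \<in> vec_polys q" if "p \<in> polys q" for p i
  proof -
    have "(\<lambda>x. (p x *\<^sub>R axis i 1 :: real^'d) $ j) = (if j = i then p else (\<lambda>_. 0))" for j
      by (auto simp: axis_def)
    then show ?thesis
      using that by (simp add: vec_polys_def const_in_polys)
  qed
  then show "span (?f ` (?A \<times> UNIV)) \<subseteq> vec_polys q"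
    using sub by (intro span_minimal) (auto simp: polys_eq_span intro: span_base)
  show "vec_polys q \<subseteq> span (?f ` (?A \<times> UNIV))"
  proof
    fix \<tau> :: "real^'d \<Rightarrow> real^'d" assume "\<tau> \<in> vec_polys q"
    then have "(\<lambda>x. \<tau> x $ i) \<in> span ?A" for i
      by (simp add: vec_polys_def polys_eq_span)
    moreover have "?f (p, i) \<in> span (?f ` (?A \<times> UNIV))" if "p \<in> span ?A" for p i
      using that
    proof (induction rule: span_induct_alt)
      case base
      have "?f (0, i) = 0" by auto
      then show ?case by (metis span_0)
    next
      case (step c x y)
      have "?f (c *\<^sub>R x + y, i) = c *\<^sub>R ?f (x, i) + ?f (y, i)"
        by (auto simp: scaleR_left_distrib)
      moreover have "?f (x, i) \<in> span (?f ` (?A \<times> UNIV))"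
        using step by (intro span_base) auto
      ultimately show ?case
        using step.IH by (metis (no_types, lifting) span_add span_scale)
    qed
    ultimately have "(\<Sum>i\<in>UNIV. ?f (\<lambda>x. \<tau> x $ i, i)) \<in> span (?f ` (?A \<times> UNIV))"
      by (intro span_sum) blast
    moreover have "(\<Sum>i\<in>UNIV. ?f (\<lambda>x. \<tau> x $ i, i)) = \<tau>"
      using basis_expansion[of "\<tau> _"] by (auto simp: sum_fun_apply scalar_mult_eq_scaleR)
    ultimately show "\<tau> \<in> span (?f ` (?A \<times> UNIV))" by simp
  qed
qed

lemma subspace_vec_polys: "subspace (vec_polys q)"
  unfolding vec_polys_eq_span by simp

lemma vec_polys_component: "\<tau> \<in> vec_polys q \<Longrightarrow> (\<lambda>x. \<tau> x $ i) \<in> polys q"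
  by (simp add: vec_polys_def)

lemma continuous_on_vec_polys:
  assumes "\<tau> \<in> vec_polys q" shows "continuous_on S \<tau>"
  using continuous_on_vec_lambda[of S "\<lambda>i x. \<tau> x $ i", OF continuous_on_polys[OF vec_polys_component[OF assms]]] by simp

lemma vec_polys_has_derivative:
  assumes "\<tau> \<in> vec_polys q"
  shows "(\<tau> has_derivative (\<lambda>v. \<chi> i. frechet_derivative (\<lambda>x. \<tau> x $ i) (at x) v)) (at x)"
  using C1_fun_derivative(1)[OF C1_fun_polys[OF vec_polys_component[OF assms]]]
  by (subst has_derivative_componentwise_within) (auto simp: Basis_vec_def inner_axis)

lemma divergence_vec_polys:
  assumes "\<tau> \<in> vec_polys q"
  shows "divergence \<tau> x = (\<Sum>i\<in>UNIV. partial i (\<lambda>x. \<tau> x $ i) x)"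
  using frechet_derivative_at[OF vec_polys_has_derivative[OF assms], of x, symmetric]
  by (simp add: divergence_def partial_def)

lemma continuous_on_divergence_vec_polys:
  assumes "\<tau> \<in> vec_polys q" shows "continuous_on S (divergence \<tau>)"
proof -
  have "continuous_on UNIV (\<lambda>x. \<Sum>i\<in>UNIV. partial i (\<lambda>x. \<tau> x $ i) x)"
    by (intro continuous_on_sum C1_fun_partial C1_fun_polys[OF vec_polys_component[OF assms]])
  then show ?thesis
    using divergence_vec_polys[OF assms] continuous_on_subset by fastforce
qed

lemma divergence_linear:
  assumes "\<sigma> \<in> vec_polys q" "\<tau> \<in> vec_polys q"
  shows "divergence (\<sigma> + c *\<^sub>R \<tau>) x = divergence \<sigma> x + c * divergence \<tau> x"
proof -
  have "(\<sigma> + c *\<^sub>R \<tau> has_derivative (\<lambda>v. frechet_derivative \<sigma> (at x) v + c *\<^sub>R frechet_derivative \<tau> (at x) v)) (at x)"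
    unfolding plus_fun_def scaleR_fun_def
    using assms[THEN vec_polys_has_derivative, of x]
    by (intro has_derivative_add has_derivative_scaleR_right)
      (auto simp: frechet_derivative_works[symmetric] differentiable_def)
  from frechet_derivative_at[OF this, symmetric] show ?thesis
    by (simp only: divergence_def partial_def) (simp add: sum.distrib sum_distrib_left)
qed

text \<open>The set where \<open>f\<close> differs from 0 is open, and an open null set is
  empty.\<close>

lemma continuous_AE_eq_0:
  fixes f :: "'a::euclidean_space \<Rightarrow> real"
  assumes "open U" "continuous_on U f" "AE x in lebesgue_on U. f x = 0" "x \<in> U"
  shows "f x = 0"
proof (rule ccontr)
  assume "f x \<noteq> 0"
  let ?N = "U \<inter> f -` (- {0})"
  have N: "open ?N"
    using assms(1,2) by (auto intro!: continuous_open_preimage)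
  have "AE x in lebesgue. x \<notin> ?N"
    using assms(3) by (simp add: AE_restrict_space_iff \<open>open U\<close>)
  then have "negligible ?N"
    using N by (simp add: negligible_iff_null_sets AE_iff_null_sets)
  with N show False
    using \<open>f x \<noteq> 0\<close> \<open>x \<in> U\<close> open_not_negligible by blast
qed

section \<open>Differentiation under the integral sign and test functions\<close>

text \<open>On the bounded support of \<open>f\<close> the continuous factor is bounded, whatever
  its growth elsewhere.\<close>

lemma integrable_mult_continuous:
  fixes f g :: "'a::euclidean_space \<Rightarrow> real"
  assumes f: "integrable lborel f" "bounded {x. f x \<noteq> 0}" and g: "continuous_on UNIV g"
  shows "integrable lborel (\<lambda>x. f x * g x)"
proof -
  have "compact (closure {x. f x \<noteq> 0})"
    using f(2) by (simp add: compact_closure)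
  then have "bounded (g ` closure {x. f x \<noteq> 0})"
    using g by (intro compact_imp_bounded compact_continuous_image) (auto intro: continuous_on_subset)
  then obtain B where B: "\<And>x. x \<in> closure {x. f x \<noteq> 0} \<Longrightarrow> norm (g x) \<le> B"
    by (auto simp: bounded_iff)
  have [measurable]: "f \<in> borel_measurable borel" "g \<in> borel_measurable borel"
    using f(1) borel_measurable_continuous_onI[OF g] by auto
  show ?thesis
  proof (rule Bochner_Integration.integrable_bound)
    show "integrable lborel (\<lambda>x. B * f x)" using f by simp
    have "norm (f x * g x) \<le> norm (B * f x)" for x
    proof (cases "f x = 0")
      case False
      then have "\<bar>g x\<bar> \<le> \<bar>B\<bar>"
        using B[of x] closure_subset[of "{x. f x \<noteq> 0}"] by auto
      then show ?thesis
        using mult_right_mono[of "\<bar>g x\<bar>" "\<bar>B\<bar>" "\<bar>f x\<bar>"] by (simp add: abs_mult mult.commute)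
    qed simp
    then show "AE x in lborel. norm (f x * g x) \<le> norm (B * f x)" by simp
  qed measurable
qed

lemma C1_fun_has_real_derivative_line:
  assumes "C1_fun p"
  shows "((\<lambda>s. p (z + s *\<^sub>R v)) has_real_derivative frechet_derivative p (at (z + s *\<^sub>R v)) v) (at s)"
proof -
  have "((\<lambda>s. z + s *\<^sub>R v) has_derivative (\<lambda>h. h *\<^sub>R v)) (at s)"
    by (auto intro!: derivative_eq_intros)
  from has_derivative_compose[OF this C1_fun_derivative(1)[OF assms]]
  have "((\<lambda>s. p (z + s *\<^sub>R v)) has_derivative
      (\<lambda>h. frechet_derivative p (at (z + s *\<^sub>R v)) (h *\<^sub>R v))) (at s)" .
  moreover have "frechet_derivative p (at (z + s *\<^sub>R v)) (h *\<^sub>R v)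
      = frechet_derivative p (at (z + s *\<^sub>R v)) v * h" for h
    using linear_scale[OF has_derivative_linear[OF C1_fun_derivative(1)[OF assms]]]
    by (simp add: mult.commute)
  ultimately show ?thesis
    by (simp add: has_field_derivative_def)
qed

text \<open>The shift is carried by the smooth factor, so \<open>f\<close> may be an indicator: the
  difference quotients converge pointwise and are dominated by a bound of the derivative near the
  support of \<open>f\<close>.\<close>

lemma has_real_derivative_integral_translate:
  fixes f p :: "'a::euclidean_space \<Rightarrow> real"
  assumes f: "integrable lborel f" "bounded {x. f x \<noteq> 0}" and p: "C1_fun p"
  shows "((\<lambda>t. LINT z|lborel. f z * p (z + t *\<^sub>R v)) has_real_derivative
      (LINT z|lborel. f z * frechet_derivative p (at (z + t *\<^sub>R v)) v)) (at t)"
proof -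
  let ?D = "\<lambda>y. frechet_derivative p (at y) v"
  have contD: "continuous_on S ?D" for S
    using C1_fun_derivative(2)[OF p] continuous_on_subset by blast
  have cont: "continuous_on UNIV (\<lambda>z. p (z + s *\<^sub>R v))" for s
    by (rule C1_fun_continuous[OF C1_fun_translate[OF p]])
  have int: "integrable lborel (\<lambda>z. f z * p (z + s *\<^sub>R v))" for s
    by (rule integrable_mult_continuous[OF f cont])
  have "((\<lambda>h. ((LINT z|lborel. f z * p (z + (t + h) *\<^sub>R v)) - (LINT z|lborel. f z * p (z + t *\<^sub>R v))) / h)
      \<longlongrightarrow> (LINT z|lborel. f z * ?D (z + t *\<^sub>R v))) (at 0)"
    \<comment> \<open>Dominated convergence concerns sequences, so the limit at 0 is tested along an
      arbitrary null sequence \<open>X\<close>.\<close>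
    unfolding tendsto_at_iff_sequentially
  proof (intro allI impI)
    fix X :: "nat \<Rightarrow> real" assume X0: "\<forall>i. X i \<in> UNIV - {0}" and X: "X \<longlonglongrightarrow> 0"
    obtain B where B: "\<And>i. \<bar>X i\<bar> \<le> B"
      using convergent_imp_Bseq[OF convergentI[OF X]] by (auto simp: Bseq_def)
    obtain R where R: "\<And>z. f z \<noteq> 0 \<Longrightarrow> norm z \<le> R"
      using f(2) by (auto simp: bounded_iff)
    \<comment> \<open>Radius of a ball that contains \<open>z + s v\<close> for all \<open>z\<close>
      in the support of \<open>f\<close> and all \<open>s\<close> between \<open>t\<close> and some
      \<open>t + X i\<close>.\<close>
    define R' where "R' = R + (\<bar>t\<bar> + B) * norm v"
    have "bounded (?D ` cball 0 R')"
      by (intro compact_imp_bounded compact_continuous_image contD) auto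
    then obtain M where "\<forall>y\<in>cball 0 R'. \<bar>?D y\<bar> \<le> M"
      by (auto simp: bounded_iff)
    then have M: "\<bar>?D y\<bar> \<le> M" if "norm y \<le> R'" for y
      using that by auto
    have near: "norm (z + s *\<^sub>R v) \<le> R'" if "f z \<noteq> 0" "\<bar>s - t\<bar> \<le> B" for z s
    proof -
      have "norm (z + s *\<^sub>R v) \<le> norm z + \<bar>s\<bar> * norm v"
        using norm_triangle_ineq[of z "s *\<^sub>R v"] by simp
      also have "\<dots> \<le> R + (\<bar>t\<bar> + B) * norm v"
        using R[OF that(1)] that(2) by (intro add_mono mult_right_mono) auto
      finally show ?thesis by (simp add: R'_def)
    qed
    define q where "q i z = f z * ((p (z + (t + X i) *\<^sub>R v) - p (z + t *\<^sub>R v)) / X i)" for i z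
    have [measurable]: "f \<in> borel_measurable borel"
      using f(1) by auto
    have [measurable]: "(\<lambda>z. p (z + s *\<^sub>R v)) \<in> borel_measurable borel" for s
      by (rule borel_measurable_continuous_onI[OF cont])
    have [measurable]: "(\<lambda>z. ?D (z + t *\<^sub>R v)) \<in> borel_measurable borel"
      by (rule borel_measurable_continuous_onI, rule continuous_on_compose2[OF contD])
        (auto intro!: continuous_intros)
    have "(\<lambda>i. LINT z|lborel. q i z) \<longlonglongrightarrow> (LINT z|lborel. f z * ?D (z + t *\<^sub>R v))"
    proof (rule integral_dominated_convergence[where w = "\<lambda>z. \<bar>M\<bar> * \<bar>f z\<bar>"])
      show "integrable lborel (\<lambda>z. \<bar>M\<bar> * \<bar>f z\<bar>)" using f by simp
      have "(\<lambda>i. q i z) \<longlonglongrightarrow> f z * ?D (z + t *\<^sub>R v)" for z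
      proof -
        have "((\<lambda>h. (p (z + (t + h) *\<^sub>R v) - p (z + t *\<^sub>R v)) / h) \<longlongrightarrow> ?D (z + t *\<^sub>R v)) (at 0)"
          using C1_fun_has_real_derivative_line[OF p, of z v t] by (simp add: DERIV_def)
        then have "(\<lambda>i. (p (z + (t + X i) *\<^sub>R v) - p (z + t *\<^sub>R v)) / X i) \<longlonglongrightarrow> ?D (z + t *\<^sub>R v)"
          unfolding tendsto_at_iff_sequentially using X0 X by (auto simp: comp_def)
        then show ?thesis
          unfolding q_def by (intro tendsto_mult tendsto_const)
      qed
      then show "AE z in lborel. (\<lambda>i. q i z) \<longlonglongrightarrow> f z * ?D (z + t *\<^sub>R v)" by simp
      have "norm (q i z) \<le> \<bar>M\<bar> * \<bar>f z\<bar>" for i z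
      proof (cases "f z = 0")
        case False
        let ?I = "{min t (t + X i)..max t (t + X i)}"
        have "norm (p (z + (t + X i) *\<^sub>R v) - p (z + t *\<^sub>R v)) \<le> \<bar>M\<bar> * norm (t + X i - t)"
        proof (rule field_differentiable_bound[where f' = "\<lambda>s. ?D (z + s *\<^sub>R v)" and S = ?I])
          show "((\<lambda>s. p (z + s *\<^sub>R v)) has_field_derivative ?D (z + s *\<^sub>R v)) (at s within ?I)" for s
            by (rule has_field_derivative_at_within[OF C1_fun_has_real_derivative_line[OF p]])
          show "norm (?D (z + s *\<^sub>R v)) \<le> \<bar>M\<bar>" if "s \<in> ?I" for s
          proof -
            have "\<bar>s - t\<bar> \<le> B" using that B[of i] by (auto simp: min_def max_def split: if_splits)
            then show ?thesis using M[OF near[OF False]] by fastforce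
          qed
        qed auto
        then have bd: "\<bar>(p (z + (t + X i) *\<^sub>R v) - p (z + t *\<^sub>R v)) / X i\<bar> \<le> \<bar>M\<bar>"
          using X0 by (simp add: abs_divide divide_le_eq)
        have "norm (q i z) = \<bar>f z\<bar> * \<bar>(p (z + (t + X i) *\<^sub>R v) - p (z + t *\<^sub>R v)) / X i\<bar>"
          unfolding q_def by (simp only: real_norm_def abs_mult)
        also have "\<dots> \<le> \<bar>f z\<bar> * \<bar>M\<bar>"
          by (rule mult_left_mono[OF bd abs_ge_zero])
        finally show ?thesis by (simp add: mult.commute)
      qed (simp add: q_def)
      then show "AE z in lborel. norm (q i z) \<le> \<bar>M\<bar> * \<bar>f z\<bar>" for i by simp
    qed (auto simp: q_def)
    moreover have "(LINT z|lborel. q i z) = ((LINT z|lborel. f z * p (z + (t + X i) *\<^sub>R v))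
        - (LINT z|lborel. f z * p (z + t *\<^sub>R v))) / X i" for i
      using int by (simp add: q_def right_diff_distrib diff_divide_distrib)
    ultimately show "((\<lambda>h. ((LINT z|lborel. f z * p (z + (t + h) *\<^sub>R v)) - (LINT z|lborel. f z * p (z + t *\<^sub>R v))) / h)
        \<circ> X) \<longlonglongrightarrow> (LINT z|lborel. f z * ?D (z + t *\<^sub>R v))"
      by (simp add: comp_def)
  qed
  then show ?thesis by (simp add: DERIV_def)
qed

section \<open>Cut-off functions and signs of integrable functions\<close>

definition box_bump :: "'a::euclidean_space \<Rightarrow> 'a \<Rightarrow> 'a \<Rightarrow> real" where
  "box_bump a b x = (\<Prod>i\<in>Basis. (max 0 (x \<bullet> i - a \<bullet> i))\<^sup>2 * (max 0 (b \<bullet> i - x \<bullet> i))\<^sup>2)"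

text \<open>Squaring removes the corner at 0, so that products of such terms are C1
  cut-offs.\<close>

lemma has_real_derivative_pos_part_square:
  "((\<lambda>s. (max 0 s)\<^sup>2) has_real_derivative 2 * max 0 s) (at s)"
proof (cases "s = 0")
  case True
  have "((\<lambda>h. (max 0 h)\<^sup>2 / h) \<longlongrightarrow> 0) (at (0::real))"
  proof (rule tendsto_0_le[where K = 1])
    show "((\<lambda>h::real. h) \<longlongrightarrow> 0) (at 0)" by (rule tendsto_ident_at)
    have "norm ((max 0 h)\<^sup>2 / h) \<le> norm h * 1" for h :: real
      by (cases "h \<le> 0") (auto simp: max_def power2_eq_square)
    then show "\<forall>\<^sub>F h::real in at 0. norm ((max 0 h)\<^sup>2 / h) \<le> norm h * 1" by simp
  qed
  then show ?thesis using True by (simp add: DERIV_def)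
next
  case False
  then consider "s < 0" | "s > 0" by linarith
  then show ?thesis
  proof cases
    case 1
    have "((\<lambda>s. 0) has_real_derivative 2 * max 0 s) (at s)" using 1 by (simp add: max_def)
    then show ?thesis
      by (rule has_field_derivative_transform_within_open[of _ _ _ "{..<0}"]) (use 1 in auto)
  next
    case 2
    have "((\<lambda>s. s\<^sup>2) has_real_derivative 2 * max 0 s) (at s)"
      using 2 by (auto intro!: derivative_eq_intros)
    then show ?thesis
      by (rule has_field_derivative_transform_within_open[of _ _ _ "{0<..}"]) (use 2 in auto)
  qed
qed

lemma C1_fun_box_bump: "C1_fun (box_bump a b)"
proof -
  have h: "C1_fun (\<lambda>x::'a. (max 0 (g x))\<^sup>2)" if "C1_fun g" for g
    by (rule C1_fun_compose[OF that has_real_derivative_pos_part_square]) (auto intro!: continuous_intros)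
  have "C1_fun (\<lambda>x::'a. x \<bullet> i - a \<bullet> i)" for i
    using C1_fun_add[OF C1_fun_inner C1_fun_const[of "- (a \<bullet> i)"], of i] by simp
  moreover have "C1_fun (\<lambda>x::'a. b \<bullet> i - x \<bullet> i)" for i
    using C1_fun_add[OF C1_fun_inner C1_fun_const[of "b \<bullet> i"], of "- i"] by (simp add: algebra_simps)
  ultimately show ?thesis
    unfolding box_bump_def[abs_def] by (intro C1_fun_prod C1_fun_mult h)
qed

lemma box_bump_nonneg: "0 \<le> box_bump a b x"
  unfolding box_bump_def by (intro prod_nonneg) auto

lemma box_bump_pos_iff: "0 < box_bump a b x \<longleftrightarrow> x \<in> box a b"
proof
  assume "x \<in> box a b" then show "0 < box_bump a b x"
    unfolding box_bump_def mem_box by (intro prod_pos) auto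
next
  assume "0 < box_bump a b x"
  then have "(max 0 (x \<bullet> i - a \<bullet> i))\<^sup>2 * (max 0 (b \<bullet> i - x \<bullet> i))\<^sup>2 \<noteq> 0" if "i \<in> Basis" for i
    using that unfolding box_bump_def by (metis (no_types, lifting) finite_Basis less_irrefl prod_zero)
  then show "x \<in> box a b"
    unfolding mem_box by (force simp: max_def split: if_splits)
qed

text \<open>If \<open>\<beta> \<ge> 0\<close> is continuously differentiable, then so is \<open>n \<beta> / (1 + n \<beta>)\<close>, which tends to
  the indicator of \<open>{\<beta> > 0}\<close>.  With sums of bumps for \<open>\<beta>\<close> this reaches all open sets.\<close>

lemma integral_open_nonpos_of_test_functions:
  fixes h :: "'a::euclidean_space \<Rightarrow> real"
  assumes h: "integrable lborel h" and U: "open U" "U \<subseteq> V"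
    and test: "\<And>\<psi> D. \<lbrakk>C1_fun \<psi>; \<And>x. 0 \<le> \<psi> x; compact D; D \<subseteq> V; \<And>x. x \<notin> D \<Longrightarrow> \<psi> x = 0\<rbrakk>
      \<Longrightarrow> (LINT z|lborel. h z * \<psi> z) \<le> 0"
  shows "(LINT z|lborel. h z * indicator U z) \<le> 0"
proof (cases "U = {}")
  case False
  obtain \<D> where \<D>: "countable \<D>" "\<D> \<subseteq> Pow U" "\<And>X. X \<in> \<D> \<Longrightarrow> \<exists>a b. X = cbox a b" "\<Union>\<D> = U"
    using open_countable_Union_open_cbox[OF U(1)] by metis
  have "\<D> \<noteq> {}" using \<D>(4) False by auto
  have "\<exists>a b. from_nat_into \<D> n = cbox a b" for n
    using \<D>(3) from_nat_into[OF \<open>\<D> \<noteq> {}\<close>] by blast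
  then obtain a b where ab: "\<And>n. from_nat_into \<D> n = cbox (a n) (b n)"
    by metis
  have U_eq: "U = (\<Union>n. cbox (a n) (b n))"
    using range_from_nat_into[OF \<open>\<D> \<noteq> {}\<close> \<D>(1)] \<D>(4) by (simp add: ab[symmetric])
  define \<beta> where "\<beta> n x = (\<Sum>k<n. box_bump (a k) (b k) x)" for n x
  define \<psi> where "\<psi> n x = real n * \<beta> n x / (1 + real n * \<beta> n x)" for n x
  \<comment> \<open>The bumps are positive on open boxes only; the union of these misses at most the
    boundaries of countably many boxes, a null part of \<open>U\<close>.\<close>
  let ?W = "\<Union>n. box (a n) (b n)"
  have \<beta>0: "0 \<le> \<beta> n x" for n x
    unfolding \<beta>_def by (intro sum_nonneg box_bump_nonneg)
  have C1\<beta>: "C1_fun (\<beta> n)" for n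
    unfolding \<beta>_def[abs_def] by (intro C1_fun_sum C1_fun_box_bump)
  have C1\<psi>: "C1_fun (\<psi> n)" for n
    unfolding \<psi>_def[abs_def]
  proof (rule C1_fun_compose[OF C1\<beta>, where h = "\<lambda>s. real n * s / (1 + real n * s)"
        and h' = "\<lambda>s. real n / (1 + real n * s)\<^sup>2"])
    have pos: "0 < 1 + real n * \<beta> n x" for x
      using \<beta>0[of n x] by (simp add: add_pos_nonneg)
    show "((\<lambda>s. real n * s / (1 + real n * s)) has_real_derivative real n / (1 + real n * \<beta> n x)\<^sup>2) (at (\<beta> n x))" for x
      using pos[of x] by (auto intro!: derivative_eq_intros simp: power2_eq_square field_simps)
    show "continuous_on (range (\<beta> n)) (\<lambda>s. real n / (1 + real n * s)\<^sup>2)"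
      using pos by (intro continuous_intros) (metis image_iff less_irrefl power_eq_0_iff)
  qed
  have \<psi>01: "0 \<le> \<psi> n x" "\<psi> n x \<le> 1" for n x
    using \<beta>0[of n x] by (auto simp: \<psi>_def add_nonneg_nonneg add_pos_nonneg divide_le_eq)
  have nonpos: "(LINT z|lborel. h z * \<psi> n z) \<le> 0" for n
  proof (rule test[where D = "\<Union>k<n. cbox (a k) (b k)", OF C1\<psi> \<psi>01(1)])
    show "compact (\<Union>k<n. cbox (a k) (b k))" by (intro compact_UN) auto
    show "(\<Union>k<n. cbox (a k) (b k)) \<subseteq> V" using U_eq U(2) by blast
    show "\<psi> n x = 0" if "x \<notin> (\<Union>k<n. cbox (a k) (b k))" for x
    proof -
      have "box_bump (a k) (b k) x = 0" if "k < n" for k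
        using \<open>x \<notin> _\<close> that box_subset_cbox[of "a k" "b k"] box_bump_pos_iff[of "a k" "b k" x]
          box_bump_nonneg[of "a k" "b k" x] by (auto simp: less_le)
      then show ?thesis by (simp add: \<psi>_def \<beta>_def)
    qed
  qed
  have lim: "(\<lambda>n. \<psi> n x) \<longlonglongrightarrow> indicator ?W x" for x
  proof (cases "x \<in> ?W")
    case True
    then obtain k where k: "x \<in> box (a k) (b k)" by auto
    define c where "c = box_bump (a k) (b k) x"
    have c: "c > 0" using k by (simp add: c_def box_bump_pos_iff)
    have "c \<le> \<beta> n x" if "n > k" for n
      unfolding \<beta>_def c_def using that by (intro member_le_sum box_bump_nonneg) auto
    then have "1 / (1 + real n * \<beta> n x) \<le> 1 / (1 + real n * c)" if "n > k" for n
      using that c by (intro frac_le) (auto intro!: add_pos_nonneg mult_left_mono)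
    moreover have "\<psi> n x = 1 - 1 / (1 + real n * \<beta> n x)" for n
      using \<beta>0[of n x] by (simp add: \<psi>_def field_simps add_pos_nonneg add_nonneg_eq_0_iff)
    ultimately have "1 - 1 / (1 + real n * c) \<le> \<psi> n x" if "n > k" for n
      using that by simp
    moreover have "(\<lambda>n. 1 - 1 / (1 + real n * c)) \<longlonglongrightarrow> 1 - 0"
      using c by (intro tendsto_intros tendsto_divide_0[OF tendsto_const] filterlim_at_top_imp_at_infinity
          filterlim_tendsto_add_at_top[OF tendsto_const] filterlim_at_top_mult_tendsto_pos[OF tendsto_const _ filterlim_real_sequentially])
    ultimately have low: "\<And>n. n > k \<Longrightarrow> 1 - 1 / (1 + real n * c) \<le> \<psi> n x"
      and lim1: "(\<lambda>n. 1 - 1 / (1 + real n * c)) \<longlonglongrightarrow> 1" by simp_all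
    have "(\<lambda>n. \<psi> n x) \<longlonglongrightarrow> 1"
    proof (rule tendsto_sandwich[OF _ _ lim1 tendsto_const])
      show "\<forall>\<^sub>F n in sequentially. 1 - 1 / (1 + real n * c) \<le> \<psi> n x"
        using eventually_gt_at_top[of k] by eventually_elim (rule low)
    qed (simp add: \<psi>01)
    then show ?thesis using True by simp
  next
    case False
    then have "box_bump (a k) (b k) x = 0" for k
      using box_bump_pos_iff[of "a k" "b k" x] box_bump_nonneg[of "a k" "b k" x] by (auto simp: less_le)
    then show ?thesis using False by (simp add: \<psi>_def \<beta>_def)
  qed
  have [measurable]: "h \<in> borel_measurable borel" using h by auto
  have [measurable]: "\<psi> n \<in> borel_measurable borel" for n
    by (rule borel_measurable_continuous_onI[OF C1_fun_continuous[OF C1\<psi>]])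
  have "(\<lambda>n. LINT z|lborel. h z * \<psi> n z) \<longlonglongrightarrow> (LINT z|lborel. h z * indicator ?W z)"
  proof (rule integral_dominated_convergence[where w = "\<lambda>z. \<bar>h z\<bar>"])
    show "AE z in lborel. (\<lambda>n. h z * \<psi> n z) \<longlonglongrightarrow> h z * indicator ?W z"
      by (intro AE_I2 tendsto_mult tendsto_const lim)
    show "AE z in lborel. norm (h z * \<psi> n z) \<le> \<bar>h z\<bar>" for n
      using \<psi>01 by (intro AE_I2) (simp add: abs_mult mult_left_le)
  qed (use h in auto)
  then have "(LINT z|lborel. h z * indicator ?W z) \<le> 0"
    by (rule LIMSEQ_le_const2) (use nonpos in auto)
  also have "(LINT z|lborel. h z * indicator ?W z) = (LINT z|lborel. h z * indicator U z)"
  proof (rule integral_cong_AE)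
    have "(\<Union>n. cbox (a n) (b n) - box (a n) (b n)) \<in> null_sets lborel"
      using null_sets_cbox_Diff_box by (intro null_sets_UN) auto
    then have "AE z in lborel. z \<notin> (\<Union>n. cbox (a n) (b n) - box (a n) (b n))"
      by (rule AE_not_in)
    then show "AE z in lborel. h z * indicator ?W z = h z * indicator U z"
      by eventually_elim (auto simp: U_eq indicator_def dest: subsetD[OF box_subset_cbox])
  qed (use U in auto)
  finally show ?thesis .
qed simp

text \<open>The inequality passes from test functions to open subsets of \<open>V\<close>, and by
  outer regularity to the Borel set \<open>A\<close> where \<open>h > 0\<close>: since
  \<open>h\<close> is bounded, the integral over the excess \<open>U - A\<close> is as small as
  desired.\<close>

lemma AE_nonpos_of_test_functions:
  fixes h :: "'a::euclidean_space \<Rightarrow> real"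
  assumes h: "integrable lborel h" "\<And>x. \<bar>h x\<bar> \<le> B" and V: "open V"
    and test: "\<And>\<psi> D. \<lbrakk>C1_fun \<psi>; \<And>x. 0 \<le> \<psi> x; compact D; D \<subseteq> V; \<And>x. x \<notin> D \<Longrightarrow> \<psi> x = 0\<rbrakk>
      \<Longrightarrow> (LINT z|lborel. h z * \<psi> z) \<le> 0"
  shows "AE z in lborel. z \<in> V \<longrightarrow> h z \<le> 0"
proof -
  have [measurable]: "h \<in> borel_measurable borel" using h by auto
  have [measurable]: "V \<in> sets borel" using V by auto
  define A where "A = {z \<in> V. h z > 0}"
  have A[measurable]: "A \<in> sets borel" unfolding A_def by measurable
  have B0: "0 \<le> B" using h(2)[of 0] by linarith
  have intA: "integrable lborel (\<lambda>z. h z * indicator S z)" if "S \<in> sets borel" for S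
    using integrable_mult_indicator[of S lborel h] that h by (simp add: mult.commute)
  have "(LINT z|lborel. h z * indicator A z) \<le> 0"
  proof (rule field_le_epsilon)
    fix e :: real assume "e > 0"
    \<comment> \<open>\<open>B\<close> bounds \<open>h\<close>, so an excess of measure below
      \<open>d\<close> costs at most \<open>e\<close>; the \<open>+ 1\<close> allows
      \<open>B = 0\<close>.\<close>
    define d where "d = e / (B + 1)"
    have d: "d > 0" using \<open>e > 0\<close> B0 by (simp add: d_def)
    obtain U0 where U0: "open U0" "A \<subseteq> U0" "emeasure lborel (U0 - A) < d"
      using outer_regular_lborel[OF A d] by metis
    define U where "U = U0 \<inter> V"
    have U: "open U" "A \<subseteq> U" "U \<subseteq> V"
      using U0 V by (auto simp: U_def A_def)
    have [measurable]: "U \<in> sets borel" using U by auto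
    have fin: "emeasure lborel (U - A) < d"
      using U0 by (intro le_less_trans[OF emeasure_mono U0(3)]) (auto simp: U_def)
    then have intUA: "integrable lborel (\<lambda>z. B * indicator (U - A) z)"
      using less_trans[OF fin ennreal_less_top]
      by (intro integrable_mult_right integrable_real_indicator) auto
    have "(LINT z|lborel. h z * indicator A z) = (LINT z|lborel. h z * indicator U z + - (h z * indicator (U - A) z))"
      using U(2) by (intro Bochner_Integration.integral_cong) (auto simp: indicator_def)
    also have "\<dots> = (LINT z|lborel. h z * indicator U z) + (LINT z|lborel. - (h z * indicator (U - A) z))"
      by (intro Bochner_Integration.integral_add Bochner_Integration.integrable_minus intA) measurable
    also have "\<dots> \<le> 0 + (LINT z|lborel. B * indicator (U - A) z)"
    proof (rule add_mono)
      show "(LINT z|lborel. h z * indicator U z) \<le> 0"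
        using h(1) U(1,3) test by (rule integral_open_nonpos_of_test_functions)
      show "(LINT z|lborel. - (h z * indicator (U - A) z)) \<le> (LINT z|lborel. B * indicator (U - A) z)"
        using intA[of "U - A"] intUA h(2) by (intro integral_mono) (auto simp: indicator_def abs_le_iff)
    qed
    also have "\<dots> = B * measure lborel (U - A)" by simp
    also have "\<dots> \<le> B * d"
      using fin B0 d by (intro mult_left_mono) (auto simp: measure_def enn2real_leI less_imp_le)
    also have "\<dots> \<le> e"
      using B0 \<open>e > 0\<close> by (simp add: d_def field_simps)
    finally show "(LINT z|lborel. h z * indicator A z) \<le> 0 + e" by simp
  qed
  moreover have nn: "0 \<le> h z * indicator A z" for z
    by (auto simp: A_def indicator_def)
  ultimately have "(LINT z|lborel. h z * indicator A z) = 0"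
    by (intro antisym integral_nonneg_AE) auto
  then have "AE z in lborel. h z * indicator A z = 0"
    using integral_nonneg_eq_0_iff_AE[OF intA[OF A]] nn by auto
  then show ?thesis
    by eventually_elim (auto simp: A_def indicator_def split: if_splits)
qed

section \<open>Essential limits of functions in W-1-infinity\<close>

lemma AE_lborel_translate:
  fixes a :: "'a::euclidean_space"
  assumes "AE v in lborel. P (a + v)" shows "AE y in lborel. P y"
proof -
  obtain N where N: "{v. \<not> P (a + v)} \<subseteq> N" "N \<in> null_sets lborel"
    using assms by (auto simp: eventually_ae_filter)
  have "{y. \<not> P y} \<subseteq> {y. y - a \<in> N}"
    using N(1) by (auto simp: subset_iff)
  then show ?thesis
    using null_sets_translation[OF N(2), of a] by (auto simp: eventually_ae_filter)
qed

lemma integral_lborel_translate: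
  fixes f :: "'a::euclidean_space \<Rightarrow> real"
  assumes [measurable]: "f \<in> borel_measurable borel"
  shows "(LINT z|lborel. f (z + v)) = (LINT z|lborel. f z)"
  by (subst (2) lborel_distr_plus[of v, symmetric], subst integral_distr) (auto simp: add.commute)

lemma integrable_lborel_translate:
  fixes f :: "'a::euclidean_space \<Rightarrow> real"
  assumes "integrable lborel f"
  shows "integrable lborel (\<lambda>z. f (z + v))"
proof -
  have "integrable (distr lborel borel ((+) v)) f"
    using assms by (simp add: lborel_distr_plus)
  then show ?thesis
    by (subst (asm) integrable_distr_eq) (use assms in \<open>auto simp: add.commute\<close>)
qed

text \<open>A representative that is Borel, bounded at every point and zero off \<open>C\<close>:
  this is the form in which Fubini and translations can act on it.\<close>

lemma Linf_bounded_borel: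
  fixes f :: "'a::euclidean_space \<Rightarrow> real"
  assumes f: "Linf S f" and S: "open S" and C: "open C" "C \<subseteq> S"
  shows "\<exists>F B. F \<in> borel_measurable borel \<and> (AE x in lebesgue. x \<in> C \<longrightarrow> f x = F x) \<and>
    (\<forall>x. x \<notin> C \<longrightarrow> F x = 0) \<and> (\<forall>x. \<bar>F x\<bar> \<le> B)"
proof -
  obtain B where B: "AE x in lebesgue_on S. \<bar>f x\<bar> \<le> B" and m: "f \<in> borel_measurable (lebesgue_on S)"
    using f by (auto simp: Linf_def)
  have B': "AE x in lebesgue. x \<in> S \<longrightarrow> \<bar>f x\<bar> \<le> B"
    using B S by (simp add: AE_restrict_space_iff)
  have "(\<lambda>x. indicator S x *\<^sub>R f x) \<in> borel_measurable lebesgue"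
    using m S by (subst (asm) borel_measurable_restrict_space_iff) auto
  then obtain f' where f': "f' \<in> borel_measurable lborel" "AE x in lborel. indicator S x *\<^sub>R f x = f' x"
    using completion_ex_borel_measurable_real by blast
  have [measurable]: "f' \<in> borel_measurable borel" "C \<in> sets borel"
    using f'(1) C by auto
  show ?thesis
  \<comment> \<open>Truncating at the essential bound changes the representative only on a null
    set.\<close>
  proof (intro exI[of _ "\<lambda>x. if x \<in> C then max (- \<bar>B\<bar>) (min \<bar>B\<bar> (f' x)) else 0"] exI[of _ "\<bar>B\<bar>"] conjI)
    show "AE x in lebesgue. x \<in> C \<longrightarrow> f x = (if x \<in> C then max (- \<bar>B\<bar>) (min \<bar>B\<bar> (f' x)) else 0)"
      using AE_completion[OF f'(2)] B'
    proof eventually_elim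
      case (elim x)
      then show ?case using C(2) by (cases "x \<in> C") (auto simp: indicator_def)
    qed
  qed auto
qed

lemma frechet_derivative_eq_0:
  assumes "open U" "x \<in> U" "\<And>y. y \<in> U \<Longrightarrow> f y = 0"
  shows "frechet_derivative f (at x) = (\<lambda>h. 0)"
proof -
  have "(f has_derivative (\<lambda>h. 0)) (at x)"
    using has_derivative_const assms(1,2) by (rule has_derivative_transform_within_open) (simp add: assms(3))
  from frechet_derivative_at[OF this] show ?thesis by simp
qed

lemma integral_lebesgue_on_eq_lborel:
  fixes f g :: "'a::euclidean_space \<Rightarrow> real"
  assumes S: "open S" and g: "g \<in> borel_measurable borel"
    and eq: "AE x in lebesgue. x \<in> S \<longrightarrow> f x = g x" and 0: "\<And>x. x \<notin> S \<Longrightarrow> g x = 0"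
    and m: "f \<in> borel_measurable (lebesgue_on S)"
  shows "(LINT x|lebesgue_on S. f x) = (LINT x|lborel. g x)"
proof -
  have "(LINT x|lebesgue_on S. f x) = (LINT x|lebesgue. indicator S x *\<^sub>R f x)"
    using S by (intro integral_restrict_space) auto
  also have "\<dots> = (LINT x|lebesgue. g x)"
  proof (rule integral_cong_AE)
    show "(\<lambda>x. indicator S x *\<^sub>R f x) \<in> borel_measurable lebesgue"
      using m S by (subst (asm) borel_measurable_restrict_space_iff) auto
    show "g \<in> borel_measurable lebesgue"
      using g by (intro measurable_completion) simp
    show "AE x in lebesgue. indicator S x *\<^sub>R f x = g x"
      using eq by eventually_elim (auto simp: indicator_def 0)
  qed
  also have "\<dots> = (LINT x|lborel. g x)"
    using g by (intro integral_completion) simp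
  finally show ?thesis .
qed

text \<open>Moving a test function \<open>\<psi>\<close> by \<open>t v\<close> changes the integral of \<open>f\<close> against it at the rate given
  by the weak derivative, hence by at most \<open>L |v|\<close> times the integral of \<open>\<psi>\<close>.\<close>

lemma weak_partial_translate_bound:
  fixes F :: "real^'d \<Rightarrow> real" and G :: "'d \<Rightarrow> real^'d \<Rightarrow> real"
  assumes F: "integrable lborel F" "bounded {x. F x \<noteq> 0}"
    and G: "\<And>i. integrable lborel (G i)" "\<And>i. bounded {x. G i x \<noteq> 0}" "\<And>i x. \<bar>G i x\<bar> \<le> B"
    and weak: "\<And>i \<psi>. test_function C \<psi> \<Longrightarrow>
      (LINT x|lborel. F x * partial i \<psi> x) = - (LINT x|lborel. G i x * \<psi> x)"
    and C: "convex C"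
    and \<psi>: "C1_fun \<psi>" "\<And>x. 0 \<le> \<psi> x" "compact D" "D \<subseteq> C" "\<And>x. x \<in> D \<Longrightarrow> x + v \<in> C"
      "\<And>x. x \<notin> D \<Longrightarrow> \<psi> x = 0"
  shows "\<bar>(LINT z|lborel. F (z + v) * \<psi> z) - (LINT z|lborel. F z * \<psi> z)\<bar>
      \<le> real CARD('d) * B * norm v * (LINT z|lborel. \<psi> z)"
proof -
  define \<psi>t where "\<psi>t t z = \<psi> (z + t *\<^sub>R (- v))" for t z
  have C1t: "C1_fun (\<psi>t t)" for t
    unfolding \<psi>t_def[abs_def] by (rule C1_fun_translate[OF \<psi>(1)])
  have test: "test_function C (\<psi>t t)" if "t \<in> {0..1}" for t
    unfolding test_function_def
  proof (intro conjI exI)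
    show "compact ((\<lambda>x. t *\<^sub>R v + x) ` D)"
      using \<psi>(3) by (rule compact_translation)
    \<comment> \<open>The support moves along the segments from \<open>x\<close> to
      \<open>x + v\<close>, which convexity keeps inside \<open>C\<close>; this makes every
      \<open>\<psi>t t\<close> a test function.\<close>
    show "(\<lambda>x. t *\<^sub>R v + x) ` D \<subseteq> C"
    proof (clarify)
      fix x assume "x \<in> D"
      then have "(1 - t) *\<^sub>R x + t *\<^sub>R (x + v) \<in> C"
        using C \<psi>(4,5) that by (intro convexD) auto
      then show "t *\<^sub>R v + x \<in> C" by (simp add: algebra_simps)
    qed
    show "\<forall>x. x \<notin> (\<lambda>x. t *\<^sub>R v + x) ` D \<longrightarrow> \<psi>t t x = 0"
    proof (intro allI impI)
      fix x assume "x \<notin> (\<lambda>x. t *\<^sub>R v + x) ` D"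
      then have "x + t *\<^sub>R (- v) \<notin> D"
        by (metis (no_types, lifting) add.commute diff_add_cancel image_eqI scaleR_minus_right
            uminus_add_conv_diff)
      then show "\<psi>t t x = 0" by (simp add: \<psi>t_def \<psi>(6))
    qed
  qed (use C1t[of t] C1_fun_iff_partial in blast)+
  have m\<psi>[measurable]: "\<psi> \<in> borel_measurable borel"
    by (rule borel_measurable_continuous_onI[OF C1_fun_continuous[OF \<psi>(1)]])
  have mF[measurable]: "F \<in> borel_measurable borel" using F by auto
  have int\<psi>: "integrable lborel \<psi>"
  proof -
    have "integrable lborel (\<lambda>x. indicator D x * \<psi> x)"
    proof (rule integrable_mult_continuous)
      show "integrable lborel (indicat_real D)"
        using \<psi>(3) emeasure_bounded_finite[of D] by (intro integrable_real_indicator)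
          (auto simp: compact_imp_bounded compact_imp_closed less_top)
      show "bounded {x. indicat_real D x \<noteq> 0}"
        by (rule bounded_subset[OF compact_imp_bounded[OF \<psi>(3)]]) (auto simp: indicator_def)
    qed (rule C1_fun_continuous[OF \<psi>(1)])
    moreover have "indicator D x * \<psi> x = \<psi> x" for x
      using \<psi>(6)[of x] by (auto simp: indicator_def)
    ultimately show ?thesis by simp
  qed
  have B0: "0 \<le> B" using G(3)[of undefined 0] by linarith
  define \<Phi> where "\<Phi> t = (LINT z|lborel. F z * \<psi>t t z)" for t
  define \<Phi>' where "\<Phi>' t = (LINT z|lborel. F z * frechet_derivative \<psi> (at (z + t *\<^sub>R (- v))) (- v))" for t
  have der: "(\<Phi> has_real_derivative \<Phi>' t) (at t)" for t
    unfolding \<Phi>_def \<psi>t_def \<Phi>'_def by (rule has_real_derivative_integral_translate[OF F \<psi>(1)])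
  have bd: "\<bar>\<Phi>' t\<bar> \<le> real CARD('d) * B * norm v * (LINT z|lborel. \<psi> z)" if t: "t \<in> {0..1}" for t
  proof -
    have "frechet_derivative \<psi> (at (z + t *\<^sub>R (- v))) = frechet_derivative (\<psi>t t) (at z)" for z
    proof -
      have "((\<lambda>z. z + t *\<^sub>R (- v)) has_derivative (\<lambda>h. h)) (at z)"
        by (auto intro!: derivative_eq_intros)
      from has_derivative_compose[OF this C1_fun_derivative(1)[OF \<psi>(1)]]
      show ?thesis
        unfolding \<psi>t_def[abs_def] by (rule frechet_derivative_at)
    qed
    then have "\<Phi>' t = (LINT z|lborel. (\<Sum>i\<in>UNIV. (- v $ i) * (F z * partial i (\<psi>t t) z)))"
      unfolding \<Phi>'_def by (simp add: C1_fun_partial(2)[OF C1t] sum_distrib_left mult_ac)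
    also have "\<dots> = (\<Sum>i\<in>UNIV. (- v $ i) * (LINT z|lborel. F z * partial i (\<psi>t t) z))"
      using integrable_mult_continuous[OF F C1_fun_partial(1)[OF C1t]] by simp
    \<comment> \<open>Two minus signs cancel, one from the direction \<open>- v\<close> and one from
      the weak derivative.\<close>
    also have "\<dots> = (\<Sum>i\<in>UNIV. (v $ i) * (LINT z|lborel. G i z * \<psi>t t z))"
      using weak[OF test[OF t]] by simp
    finally have eq: "\<Phi>' t = (\<Sum>i\<in>UNIV. (v $ i) * (LINT z|lborel. G i z * \<psi>t t z))" .
    have int\<psi>t: "integrable lborel (\<psi>t t)"
      unfolding \<psi>t_def[abs_def] by (rule integrable_lborel_translate[OF int\<psi>])
    have "\<bar>(v $ i) * (LINT z|lborel. G i z * \<psi>t t z)\<bar> \<le> norm v * (B * (LINT z|lborel. \<psi> z))" for i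
    proof -
      have "\<bar>LINT z|lborel. G i z * \<psi>t t z\<bar> \<le> (LINT z|lborel. B * \<psi>t t z)"
      proof (rule Bochner_Integration.integral_norm_bound_integral[of lborel "\<lambda>z. G i z * \<psi>t t z", unfolded real_norm_def])
        show "integrable lborel (\<lambda>z. G i z * \<psi>t t z)"
          by (rule integrable_mult_continuous[OF G(1,2) C1_fun_continuous[OF C1t]])
        show "integrable lborel (\<lambda>z. B * \<psi>t t z)" using int\<psi>t by simp
        show "\<bar>G i z * \<psi>t t z\<bar> \<le> B * \<psi>t t z" for z
          using G(3)[of i z] \<psi>(2) by (simp add: abs_mult mult_right_mono \<psi>t_def)
      qed
      also have "\<dots> = B * (LINT z|lborel. \<psi> z)"
        using integral_lborel_translate[OF m\<psi>, of "t *\<^sub>R (- v)"] by (simp add: \<psi>t_def)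
      finally show ?thesis
        unfolding abs_mult by (intro mult_mono component_le_norm_cart) auto
    qed
    then have "\<bar>\<Phi>' t\<bar> \<le> (\<Sum>i\<in>(UNIV::'d set). norm v * (B * (LINT z|lborel. \<psi> z)))"
      unfolding eq by (intro order_trans[OF sum_abs] sum_mono)
    then show ?thesis by (simp add: mult_ac)
  qed
  have "norm (\<Phi> 1 - \<Phi> 0) \<le> real CARD('d) * B * norm v * (LINT z|lborel. \<psi> z) * norm (1 - 0::real)"
    by (rule field_differentiable_bound[where S = "{0..1}" and f' = \<Phi>'])
      (use der bd in \<open>auto intro: has_field_derivative_at_within\<close>)
  moreover have "\<Phi> 0 = (LINT z|lborel. F z * \<psi> z)"
    by (simp add: \<Phi>_def \<psi>t_def)
  \<comment> \<open>A change of variable moves the shift from the test function back onto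
    \<open>F\<close>.\<close>
  moreover have "\<Phi> 1 = (LINT z|lborel. F (z + v) * \<psi> z)"
    using integral_lborel_translate[of "\<lambda>z. F z * \<psi>t 1 z" v] by (simp add: \<Phi>_def \<psi>t_def)
  ultimately show ?thesis by simp
qed

text \<open>For each shift \<open>v\<close>, testing shows that \<open>F (z + v) - F z\<close> is
  bounded by \<open>L * norm v\<close> for almost every \<open>z\<close>; Fubini turns this into an
  estimate between almost every \<open>z\<close> and almost every \<open>y\<close>. Convexity enters
  through the segments along which test functions are moved.\<close>

lemma W1inf_lipschitz_AE:
  fixes f :: "real^'d \<Rightarrow> real"
  assumes f: "W1inf S f" and S: "open S" and C: "open C" "convex C" "bounded C" "C \<subseteq> S"
  obtains L where "0 \<le> L"
    "AE z in lebesgue. z \<in> C \<longrightarrow> (AE y in lebesgue. y \<in> C \<longrightarrow> \<bar>f y - f z\<bar> \<le> L * norm (y - z))"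
proof -
  have CS[measurable]: "C \<in> sets borel" using C by auto
  have fS: "Linf S f" using f by (simp add: W1inf_def)
  obtain F BF where F: "F \<in> borel_measurable borel" "AE x in lebesgue. x \<in> C \<longrightarrow> f x = F x"
    "\<And>x. x \<notin> C \<Longrightarrow> F x = 0" "\<And>x. \<bar>F x\<bar> \<le> BF"
    using Linf_bounded_borel[OF fS S C(1,4)] by blast
  obtain g where g: "\<And>i. Linf S (g i)" "\<And>i. weak_partial S i f (g i)"
    using f unfolding W1inf_def by metis
  define P where "P i H K \<longleftrightarrow> H \<in> borel_measurable borel \<and> (AE x in lebesgue. x \<in> C \<longrightarrow> g i x = H x) \<and>
      (\<forall>x. x \<notin> C \<longrightarrow> H x = 0) \<and> (\<forall>x. \<bar>H x\<bar> \<le> K)" for i H and K :: real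
  have "\<exists>H K. P i H K" for i
    unfolding P_def by (rule Linf_bounded_borel[OF g(1) S C(1,4)])
  then obtain G BG where "\<And>i. P i (G i) (BG i)"
    by metis
  then have G: "\<And>i. G i \<in> borel_measurable borel"
    "\<And>i. AE x in lebesgue. x \<in> C \<longrightarrow> g i x = G i x"
    "\<And>i x. x \<notin> C \<Longrightarrow> G i x = 0" "\<And>i x. \<bar>G i x\<bar> \<le> BG i"
    by (simp_all add: P_def)
  \<comment> \<open>One bound for all weak partial derivatives. Each component of \<open>v\<close>
    is estimated by \<open>norm v\<close>, whence the factor \<open>CARD('d)\<close> in
    \<open>L\<close>.\<close>
  define B where "B = (\<Sum>i\<in>UNIV. BG i)"
  have BG0: "0 \<le> BG i" for i using G(4)[of i 0] by linarith
  have GB: "\<bar>G i x\<bar> \<le> B" for i x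
    using G(4)[of i x] member_le_sum[of i UNIV BG] BG0 by (force simp: B_def)
  have B0: "0 \<le> B" unfolding B_def using BG0 by (intro sum_nonneg)
  have emC: "emeasure lborel C < \<infinity>"
    using emeasure_bounded_finite[OF C(3)] by (simp add: less_top)
  have int_bd: "integrable lborel H" if "H \<in> borel_measurable borel" "\<And>x. x \<notin> C \<Longrightarrow> H x = 0" "\<And>x. \<bar>H x\<bar> \<le> K"
    for H :: "real^'d \<Rightarrow> real" and K
  proof (rule Bochner_Integration.integrable_bound)
    show "integrable lborel (\<lambda>x. K * indicator C x)"
      using emC by (intro integrable_mult_right integrable_real_indicator) auto
    show "AE x in lborel. norm (H x) \<le> norm (K * indicator C x)"
      using that(2,3) by (intro AE_I2) (auto simp: indicator_def intro: order_trans[OF that(3) abs_ge_self])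
  qed (use that(1) in simp)
  have bdd: "bounded {x. H x \<noteq> 0}" if "\<And>x. x \<notin> C \<Longrightarrow> H x = 0" for H :: "real^'d \<Rightarrow> real"
    using that by (intro bounded_subset[OF C(3)]) auto
  have intF: "integrable lborel F" and intG: "integrable lborel (G i)" for i
    using int_bd[OF F(1,3,4)] int_bd[OF G(1) G(3) G(4)] by auto
  have weak: "(LINT x|lborel. F x * partial i \<psi> x) = - (LINT x|lborel. G i x * \<psi> x)"
    if \<psi>: "test_function C \<psi>" for i \<psi>
  proof -
    have \<psi>S: "test_function S \<psi>"
      using \<psi> C(4) unfolding test_function_def by (meson order_trans)
    have C1: "C1_fun \<psi>"
      using \<psi> unfolding test_function_def C1_fun_iff_partial by blast
    obtain D where D: "compact D" "D \<subseteq> C" "\<And>x. x \<notin> D \<Longrightarrow> \<psi> x = 0"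
      using \<psi> unfolding test_function_def by blast
    have \<psi>C: "\<psi> x = 0" if "x \<notin> C" for x using D that by blast
    have p\<psi>C: "partial i \<psi> x = 0" if "x \<notin> C" for x
    proof -
      have "x \<notin> D" using D(2) that by blast
      then show ?thesis
        using frechet_derivative_eq_0[of "- D" x \<psi>] D
        by (simp add: partial_def compact_imp_closed open_Compl)
    qed
    have m: "partial i \<psi> \<in> borel_measurable borel" "\<psi> \<in> borel_measurable borel"
      using C1_fun_partial(1)[OF C1] C1_fun_continuous[OF C1] by (auto intro: borel_measurable_continuous_onI)
    have mS: "h \<in> borel_measurable (lebesgue_on S)" if "h \<in> borel_measurable borel" for h :: "real^'d \<Rightarrow> real"
      using that by (intro measurable_restrict_space1 measurable_completion) simp
    have "(LINT x|lebesgue_on S. f x * partial i \<psi> x) = (LINT x|lborel. F x * partial i \<psi> x)"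
    proof (rule integral_lebesgue_on_eq_lborel[OF S])
      show "AE x in lebesgue. x \<in> S \<longrightarrow> f x * partial i \<psi> x = F x * partial i \<psi> x"
        using F(2) by eventually_elim (use p\<psi>C in fastforce)
      show "(\<lambda>x. f x * partial i \<psi> x) \<in> borel_measurable (lebesgue_on S)"
        using fS mS[OF m(1)] by (auto simp: Linf_def)
    qed (use F(1,3) m C(4) in auto)
    moreover have "(LINT x|lebesgue_on S. g i x * \<psi> x) = (LINT x|lborel. G i x * \<psi> x)"
    proof (rule integral_lebesgue_on_eq_lborel[OF S])
      show "AE x in lebesgue. x \<in> S \<longrightarrow> g i x * \<psi> x = G i x * \<psi> x"
        using G(2)[of i] by eventually_elim (use \<psi>C in fastforce)
      show "(\<lambda>x. g i x * \<psi> x) \<in> borel_measurable (lebesgue_on S)"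
        using g(1)[of i] mS[OF m(2)] by (auto simp: Linf_def)
    qed (use G(1,3) m C(4) in auto)
    ultimately show ?thesis
      using g(2)[of i] \<psi>S unfolding weak_partial_def by metis
  qed
  define L where "L = real CARD('d) * B"
  have L0: "0 \<le> L" by (simp add: L_def B0)
  have [measurable]: "F \<in> borel_measurable borel" by (rule F(1))
  \<comment> \<open>The sign \<open>r\<close> yields the two halves of the absolute value.\<close>
  have one: "AE z in lborel. z \<in> C \<and> z + v \<in> C \<longrightarrow> r * (F (z + v) - F z) \<le> L * norm v"
    if r: "r = 1 \<or> r = -1" for r v
  proof -
    let ?V = "C \<inter> (\<lambda>z. z + v) -` C"
    have V: "open ?V"
      using C(1) by (intro open_Int open_vimage continuous_intros)
    have [measurable]: "?V \<in> sets borel" using V by auto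
    define h where "h z = indicator ?V z * (r * (F (z + v) - F z) - L * norm v)" for z
    have hm: "h \<in> borel_measurable borel"
      unfolding h_def by measurable
    have hb: "\<bar>h z\<bar> \<le> 2 * BF + L * norm v" for z
    proof -
      have "\<bar>r * (F (z + v) - F z) - L * norm v\<bar> \<le> \<bar>F (z + v)\<bar> + \<bar>F z\<bar> + L * norm v"
        using r mult_nonneg_nonneg[OF L0 norm_ge_zero[of v]] by (auto simp: abs_if)
      also have "\<dots> \<le> 2 * BF + L * norm v" using F(4)[of "z + v"] F(4)[of z] by simp
      finally have "\<bar>r * (F (z + v) - F z) - L * norm v\<bar> \<le> 2 * BF + L * norm v" .
      moreover have "0 \<le> 2 * BF + L * norm v" using F(4)[of 0] L0 by simp
      ultimately show ?thesis by (auto simp: h_def indicator_def)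
    qed
    have "AE z in lborel. z \<in> ?V \<longrightarrow> h z \<le> 0"
    proof (rule AE_nonpos_of_test_functions[OF int_bd[OF hm _ hb] hb V])
      show "h x = 0" if "x \<notin> C" for x using that by (simp add: h_def)
      fix \<psi> :: "real^'d \<Rightarrow> real" and D
      assume \<psi>: "C1_fun \<psi>" "\<And>x. 0 \<le> \<psi> x" "compact D" "D \<subseteq> ?V" "\<And>x. x \<notin> D \<Longrightarrow> \<psi> x = 0"
      have cont: "continuous_on UNIV \<psi>" by (rule C1_fun_continuous[OF \<psi>(1)])
      have iF: "integrable lborel (\<lambda>z. F z * \<psi> z)"
        by (rule integrable_mult_continuous[OF intF bdd[OF F(3)] cont])
      have "integrable lborel (\<lambda>z. F z * \<psi> (z - v))"
        using integrable_mult_continuous[OF intF bdd[OF F(3)] C1_fun_continuous[OF C1_fun_translate[OF \<psi>(1), of "- v"]]]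
        by simp
      from integrable_lborel_translate[OF this, of v]
      have iFv: "integrable lborel (\<lambda>z. F (z + v) * \<psi> z)" by simp
      have "integrable lborel (\<lambda>z. indicator C z * \<psi> z)"
        using emC by (intro integrable_mult_continuous cont integrable_real_indicator bdd) auto
      moreover have "indicator C z * \<psi> z = \<psi> z" for z
        using \<psi>(4) \<psi>(5)[of z] by (cases "z \<in> D") (auto simp: indicator_def)
      ultimately have i\<psi>: "integrable lborel \<psi>" by simp
      have "(LINT z|lborel. h z * \<psi> z) = (LINT z|lborel. r * (F (z + v) * \<psi> z - F z * \<psi> z) - L * norm v * \<psi> z)"
        using \<psi>(4,5) by (intro Bochner_Integration.integral_cong refl)
          (force simp: h_def indicator_def algebra_simps)
      also have "\<dots> = r * ((LINT z|lborel. F (z + v) * \<psi> z) - (LINT z|lborel. F z * \<psi> z)) - L * norm v * (LINT z|lborel. \<psi> z)"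
        using iF iFv i\<psi> by simp
      also have "\<dots> \<le> \<bar>(LINT z|lborel. F (z + v) * \<psi> z) - (LINT z|lborel. F z * \<psi> z)\<bar> - L * norm v * (LINT z|lborel. \<psi> z)"
        using r by auto
      also have "\<dots> \<le> 0"
        using weak_partial_translate_bound[OF intF bdd[OF F(3)] intG bdd[OF G(3)] GB weak C(2) \<psi>(1,2,3) _ _ \<psi>(5), of v] \<psi>(4)
        by (auto simp: L_def)
      finally show "(LINT z|lborel. h z * \<psi> z) \<le> 0" .
    qed
    then show ?thesis
      by eventually_elim (auto simp: h_def)
  qed
  let ?P = "\<lambda>z y. z \<in> C \<and> y \<in> C \<longrightarrow> \<bar>F y - F z\<bar> \<le> L * norm (y - z)"
  have "AE z in lborel. ?P z (z + v)" for v
    using one[of 1 v] one[of "-1" v] by (auto elim!: eventually_elim2 simp: abs_le_iff)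
  then have "AE v in lborel. AE z in lborel. ?P z (z + v)" by simp
  \<comment> \<open>Joint measurability, required to exchange the two quantifiers, is where the
    Borel representative \<open>F\<close> pays off.\<close>
  moreover have "{x \<in> space (lborel \<Otimes>\<^sub>M lborel). ?P (fst x) (fst x + snd x)} \<in> sets (lborel \<Otimes>\<^sub>M lborel)"
    by measurable
  ultimately have "AE z in lborel. AE v in lborel. ?P z (z + v)"
    by (subst lborel_pair.AE_commute)
  then have "AE z in lborel. AE y in lborel. ?P z y"
    by eventually_elim (rule AE_lborel_translate)
  then have "AE z in lebesgue. AE y in lebesgue. ?P z y"
    by (intro AE_completion) (auto elim: eventually_mono intro: AE_completion)
  then have "AE z in lebesgue. z \<in> C \<longrightarrow> (AE y in lebesgue. y \<in> C \<longrightarrow> \<bar>f y - f z\<bar> \<le> L * norm (y - z))"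
    using F(2)
  proof eventually_elim
    case (elim z)
    show ?case
    proof
      assume "z \<in> C"
      show "AE y in lebesgue. y \<in> C \<longrightarrow> \<bar>f y - f z\<bar> \<le> L * norm (y - z)"
        using elim(1) F(2) by eventually_elim (use elim(2) \<open>z \<in> C\<close> in auto)
    qed
  qed
  with L0 show ?thesis by (rule that)
qed

section \<open>Essential limits\<close>

definition ess_limit :: "'a::euclidean_space set \<Rightarrow> ('a \<Rightarrow> real) \<Rightarrow> 'a \<Rightarrow> real \<Rightarrow> bool" where
  "ess_limit K f x l \<longleftrightarrow> (\<forall>\<epsilon>>0. \<exists>\<delta>>0. AE y in lebesgue_on (K \<inter> ball x \<delta>). \<bar>f y - l\<bar> < \<epsilon>)"

lemma AE_lebesgue_exists:
  fixes U :: "'a::euclidean_space set"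
  assumes "AE y in lebesgue. P y" "open U" "U \<noteq> {}"
  shows "\<exists>y\<in>U. P y"
proof (rule ccontr)
  assume "\<not> ?thesis"
  then have "AE y in lebesgue. y \<notin> U"
    using assms(1) by (auto elim: eventually_mono)
  then have "negligible U"
    using assms(2) by (simp add: negligible_iff_null_sets AE_iff_null_sets)
  then show False using assms(2,3) open_not_negligible by blast
qed

text \<open>The Lipschitz estimate is available at generic points only, so \<open>x\<close> is
  approached by generic \<open>z n\<close>. Two of them are compared through a third point that is
  generic for both, which makes the values \<open>f (z n)\<close> a Cauchy sequence; its limit is
  the essential limit.\<close>

lemma ess_limit_W1inf:
  fixes f :: "real^'d \<Rightarrow> real"
  assumes f: "W1inf S f" and S: "open S" and C: "open C" "convex C" "bounded C" "C \<subseteq> S"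
    and x: "x \<in> closure C"
  shows "\<exists>l. ess_limit C f x l"
proof -
  obtain L where L: "0 \<le> L"
    and lip: "AE z in lebesgue. z \<in> C \<longrightarrow> (AE y in lebesgue. y \<in> C \<longrightarrow> \<bar>f y - f z\<bar> \<le> L * norm (y - z))"
    using W1inf_lipschitz_AE[OF f S C] .
  have ne: "C \<inter> ball x r \<noteq> {}" "open (C \<inter> ball x r)" if "r > 0" for r
  proof -
    obtain y where "y \<in> C" "dist y x < r"
      using x \<open>r > 0\<close> unfolding closure_approachable by blast
    then have "y \<in> C \<inter> ball x r" by (simp add: dist_commute)
    then show "C \<inter> ball x r \<noteq> {}" by blast
  qed (use C(1) in auto)
  have "\<exists>z\<in>C \<inter> ball x (1 / real (Suc n)). z \<in> C \<longrightarrow>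
      (AE y in lebesgue. y \<in> C \<longrightarrow> \<bar>f y - f z\<bar> \<le> L * norm (y - z))" for n
    by (rule AE_lebesgue_exists[OF lip ne(2,1)]) auto
  then have "\<forall>n. \<exists>z. z \<in> C \<and> dist x z < 1 / real (Suc n) \<and>
      (AE y in lebesgue. y \<in> C \<longrightarrow> \<bar>f y - f z\<bar> \<le> L * norm (y - z))"
    unfolding Bex_def by (auto simp del: of_nat_Suc)
  from choice[OF this] obtain z where z: "\<And>n. z n \<in> C" "\<And>n. dist x (z n) < 1 / real (Suc n)"
    and zl: "\<And>n. AE y in lebesgue. y \<in> C \<longrightarrow> \<bar>f y - f (z n)\<bar> \<le> L * norm (y - z n)"
    by blast
  \<comment> \<open>The constant 4 comes from two uses of the Lipschitz estimate, each over a
    distance of at most \<open>2 / real (Suc N)\<close>.\<close>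
  have close: "\<bar>f (z n) - f (z m)\<bar> \<le> 4 * L / real (Suc N)" if "N \<le> n" "N \<le> m" for n m N
  proof -
    have "AE y in lebesgue. y \<in> C \<longrightarrow> \<bar>f y - f (z n)\<bar> \<le> L * norm (y - z n) \<and> \<bar>f y - f (z m)\<bar> \<le> L * norm (y - z m)"
      using zl[of n] zl[of m] by eventually_elim auto
    from AE_lebesgue_exists[OF this ne(2,1)[of "1 / real (Suc N)"]]
    obtain y where y: "y \<in> C" "dist x y < 1 / real (Suc N)" "\<bar>f y - f (z n)\<bar> \<le> L * norm (y - z n)"
      "\<bar>f y - f (z m)\<bar> \<le> L * norm (y - z m)"
      by auto
    have "norm (y - z k) \<le> 2 / real (Suc N)" if "N \<le> k" for k
    proof -
      have "norm (y - z k) \<le> dist x y + dist x (z k)"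
        using dist_triangle3[of y "z k" x] by (simp add: dist_norm)
      also have "\<dots> \<le> 1 / real (Suc N) + 1 / real (Suc N)"
        using y(2) z(2)[of k] frac_le[of 1 1 "real (Suc N)" "real (Suc k)"] that by linarith
      finally show ?thesis by simp
    qed
    note near = this[OF that(1)] this[OF that(2)]
    have "L * norm (y - z n) \<le> L * (2 / real (Suc N))" "L * norm (y - z m) \<le> L * (2 / real (Suc N))"
      by (rule mult_left_mono[OF near(1) L], rule mult_left_mono[OF near(2) L])
    then have "\<bar>f (z n) - f (z m)\<bar> \<le> L * (2 / real (Suc N)) + L * (2 / real (Suc N))"
      using y(3,4) by linarith
    then show ?thesis by simp
  qed
  have small: "\<exists>N. K / real (Suc N) < e" if "e > 0" for e K :: real
  proof -
    have "(\<lambda>N. K / real (Suc N)) \<longlonglongrightarrow> 0"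
      by (rule LIMSEQ_Suc[OF lim_const_over_n])
    then have "\<forall>\<^sub>F N in sequentially. K / real (Suc N) < e"
      using that by (rule order_tendstoD)
    then show ?thesis by (auto simp: eventually_sequentially)
  qed
  have "Cauchy (\<lambda>n. f (z n))"
  proof (rule metric_CauchyI)
    fix e :: real assume "e > 0"
    then obtain N where "4 * L / real (Suc N) < e" using small by blast
    then have "dist (f (z m)) (f (z n)) < e" if "m \<ge> N" "n \<ge> N" for m n
      using close[OF that] by (simp add: dist_real_def)
    then show "\<exists>N. \<forall>m\<ge>N. \<forall>n\<ge>N. dist (f (z m)) (f (z n)) < e" by blast
  qed
  then obtain l where l: "(\<lambda>n. f (z n)) \<longlonglongrightarrow> l"
    using Cauchy_convergent by (auto simp: convergent_def)
  have lz: "\<bar>f (z N) - l\<bar> \<le> 4 * L / real (Suc N)" for N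
  proof (rule LIMSEQ_le_const2)
    show "(\<lambda>n. \<bar>f (z N) - f (z n)\<bar>) \<longlonglongrightarrow> \<bar>f (z N) - l\<bar>"
      by (intro tendsto_intros l)
    show "\<exists>M. \<forall>n\<ge>M. \<bar>f (z N) - f (z n)\<bar> \<le> 4 * L / real (Suc N)"
      using close[of N N] by blast
  qed
  have "ess_limit C f x l"
    unfolding ess_limit_def
  proof (intro allI impI)
    fix e :: real assume "e > 0"
    \<comment> \<open>Of the 6 units, 4 lead from \<open>l\<close> to \<open>f (z N)\<close> and 2
      from there to \<open>f y\<close>.\<close>
    then obtain N where N: "6 * L / real (Suc N) < e" using small by blast
    have "AE y in lebesgue. y \<in> C \<inter> ball x (1 / real (Suc N)) \<longrightarrow> \<bar>f y - l\<bar> < e"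
      using zl[of N]
    proof eventually_elim
      case (elim y)
      show ?case
      proof
        assume y: "y \<in> C \<inter> ball x (1 / real (Suc N))"
        have "norm (y - z N) \<le> 2 / real (Suc N)"
          using dist_triangle3[of y "z N" x] y z(2)[of N] by (simp add: dist_norm)
        then have "L * norm (y - z N) \<le> L * (2 / real (Suc N))"
          using L by (intro mult_left_mono)
        moreover have "\<bar>f y - f (z N)\<bar> \<le> L * norm (y - z N)" using elim y by simp
        moreover have "4 * L / real (Suc N) + L * (2 / real (Suc N)) = 6 * L / real (Suc N)"
          by (simp add: add_divide_distrib[symmetric])
        ultimately show "\<bar>f y - l\<bar> < e" using lz[of N] N by linarith
      qed
    qed
    then show "\<exists>\<delta>>0. AE y in lebesgue_on (C \<inter> ball x \<delta>). \<bar>f y - l\<bar> < e"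
      using ne(2) by (intro exI[of _ "1 / real (Suc N)"]) (simp add: AE_restrict_space_iff)
  qed
  then show ?thesis ..
qed

text \<open>Existence is obtained on a convex piece \<open>C\<close>, but the trace is taken from
  the whole cell \<open>K\<close>, which near \<open>x\<close> has no points outside
  \<open>C\<close>.\<close>

lemma ess_limit_localize:
  assumes "ess_limit C f x l" "open C" "open K" "r > 0" "K \<inter> ball x r \<subseteq> C"
  shows "ess_limit K f x l"
  unfolding ess_limit_def
proof (intro allI impI)
  fix e :: real assume "e > 0"
  then obtain \<delta> where \<delta>: "\<delta> > 0" "AE y in lebesgue_on (C \<inter> ball x \<delta>). \<bar>f y - l\<bar> < e"
    using assms(1) unfolding ess_limit_def by blast
  have "AE y in lebesgue. y \<in> C \<inter> ball x \<delta> \<longrightarrow> \<bar>f y - l\<bar> < e"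
    using \<delta>(2) assms(2) by (subst (asm) AE_restrict_space_iff) auto
  then have "AE y in lebesgue. y \<in> K \<inter> ball x (min \<delta> r) \<longrightarrow> \<bar>f y - l\<bar> < e"
    by eventually_elim (use assms(5) in auto)
  then have "AE y in lebesgue_on (K \<inter> ball x (min \<delta> r)). \<bar>f y - l\<bar> < e"
    using assms(3) by (subst AE_restrict_space_iff) auto
  then show "\<exists>\<delta>>0. AE y in lebesgue_on (K \<inter> ball x \<delta>). \<bar>f y - l\<bar> < e"
    using \<delta>(1) assms(4) by (intro exI[of _ "min \<delta> r"]) auto
qed

section \<open>Surface measure on faces\<close>

lemma nn_integral_lborel_translate:
  fixes g :: "'a::euclidean_space \<Rightarrow> ennreal"
  assumes [measurable]: "g \<in> borel_measurable borel"
  shows "(\<integral>\<^sup>+z. g (z + a) \<partial>lborel) = (\<integral>\<^sup>+z. g z \<partial>lborel)"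
  by (subst (2) lborel_distr_plus[of a, symmetric], subst nn_integral_distr) (auto simp: add.commute)

text \<open>Invariance under shears by averaging translations: averaging over \<open>t w\<close> with \<open>t\<close> in
  \<open>[0, 1]\<close> and moving the shift \<open>s z\<close> into the variable \<open>t\<close> makes the shear disappear.\<close>

lemma nn_integral_lborel_shear:
  fixes Q :: "'a::euclidean_space \<Rightarrow> ennreal" and s :: "'a \<Rightarrow> real"
  assumes [measurable]: "Q \<in> borel_measurable borel" "s \<in> borel_measurable borel"
    and inv: "\<And>z t. s (z + t *\<^sub>R w) = s z"
  shows "(\<integral>\<^sup>+z. Q (z + s z *\<^sub>R w) \<partial>lborel) = (\<integral>\<^sup>+z. Q z \<partial>lborel)"
proof -
  define k :: "real \<Rightarrow> ennreal" where "k = indicator {0..1}"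
  have [measurable]: "k \<in> borel_measurable borel" by (simp add: k_def)
  have k1: "(\<integral>\<^sup>+t. k (t + a) \<partial>lborel) = 1" for a
    by (subst nn_integral_lborel_translate) (simp_all add: k_def)
  have "(\<integral>\<^sup>+z. Q (z + s z *\<^sub>R w) \<partial>lborel) = (\<integral>\<^sup>+t. k t * (\<integral>\<^sup>+z. Q (z + s z *\<^sub>R w) \<partial>lborel) \<partial>lborel)"
    using k1[of 0] by (simp add: nn_integral_multc)
  also have "\<dots> = (\<integral>\<^sup>+t. k t * (\<integral>\<^sup>+z. Q (z + t *\<^sub>R w + s (z + t *\<^sub>R w) *\<^sub>R w) \<partial>lborel) \<partial>lborel)"
    by (subst nn_integral_lborel_translate) simp_all
  also have "\<dots> = (\<integral>\<^sup>+t. (\<integral>\<^sup>+z. k t * Q (z + (t + s z) *\<^sub>R w) \<partial>lborel) \<partial>lborel)"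
    by (simp add: nn_integral_cmult inv scaleR_left_distrib add.assoc)
  also have "\<dots> = (\<integral>\<^sup>+z. (\<integral>\<^sup>+t. k t * Q (z + (t + s z) *\<^sub>R w) \<partial>lborel) \<partial>lborel)"
    by (rule lborel_pair.Fubini') measurable
  also have "\<dots> = (\<integral>\<^sup>+z. (\<integral>\<^sup>+t. k (t - s z) * Q (z + t *\<^sub>R w) \<partial>lborel) \<partial>lborel)"
  proof (rule nn_integral_cong)
    fix z
    show "(\<integral>\<^sup>+t. k t * Q (z + (t + s z) *\<^sub>R w) \<partial>lborel) = (\<integral>\<^sup>+t. k (t - s z) * Q (z + t *\<^sub>R w) \<partial>lborel)"
      using nn_integral_lborel_translate[of "\<lambda>t. k (t - s z) * Q (z + t *\<^sub>R w)" "s z"] by simp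
  qed
  also have "\<dots> = (\<integral>\<^sup>+t. (\<integral>\<^sup>+z. k (t - s z) * Q (z + t *\<^sub>R w) \<partial>lborel) \<partial>lborel)"
    by (rule lborel_pair.Fubini') measurable
  also have "\<dots> = (\<integral>\<^sup>+t. (\<integral>\<^sup>+z. k (t - s z) * Q z \<partial>lborel) \<partial>lborel)"
  proof (rule nn_integral_cong)
    fix t
    show "(\<integral>\<^sup>+z. k (t - s z) * Q (z + t *\<^sub>R w) \<partial>lborel) = (\<integral>\<^sup>+z. k (t - s z) * Q z \<partial>lborel)"
      using nn_integral_lborel_translate[of "\<lambda>z. k (t - s z) * Q z" "t *\<^sub>R w"] by (simp add: inv)
  qed
  also have "\<dots> = (\<integral>\<^sup>+z. (\<integral>\<^sup>+t. k (t - s z) * Q z \<partial>lborel) \<partial>lborel)"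
    by (rule lborel_pair.Fubini') measurable
  also have "\<dots> = (\<integral>\<^sup>+z. Q z \<partial>lborel)"
    using k1[of "- s _"] by (simp add: nn_integral_multc)
  finally show ?thesis .
qed

text \<open>Projection onto the plane \<open>n \<bullet> x = c\<close> along \<open>e\<close>, the
  orthogonal one if \<open>e = n\<close> is a unit vector. Membership in a prism with slanted edges
  becomes a condition on the height and one on the foot.\<close>

definition slant_proj :: "'a::euclidean_space \<Rightarrow> real \<Rightarrow> 'a \<Rightarrow> 'a \<Rightarrow> 'a" where
  "slant_proj n c e z = z - ((n \<bullet> z - c) / (n \<bullet> e)) *\<^sub>R e"

lemma slant_proj_in: "n \<bullet> e \<noteq> 0 \<Longrightarrow> n \<bullet> slant_proj n c e z = c"
  by (simp add: slant_proj_def inner_diff_right)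

lemma slant_proj_add:
  "n \<bullet> e \<noteq> 0 \<Longrightarrow> n \<bullet> y = c \<Longrightarrow> slant_proj n c e (y + s *\<^sub>R e) = y"
  by (simp add: slant_proj_def inner_add_right)

lemma continuous_on_slant_proj: "continuous_on S (slant_proj n c e)"
  unfolding slant_proj_def divide_inverse by (intro continuous_intros)

lemma measurable_slant_proj [measurable]: "slant_proj n c e \<in> borel_measurable borel"
  by (rule borel_measurable_continuous_onI[OF continuous_on_slant_proj])

text \<open>Lebesgue measure splits into height times cross-section, proved by averaging
  translations along \<open>n\<close> instead of choosing coordinates. The cross-section may be
  measured by any symmetric weight \<open>k\<close> of mass 1; the indicator of the slab of
  thickness 1 is the choice made in \<open>hyperplane_measure\<close>.\<close>

lemma nn_integral_slab:
  fixes Q :: "'a::euclidean_space \<Rightarrow> ennreal" and h k :: "real \<Rightarrow> ennreal"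
  assumes [measurable]: "Q \<in> borel_measurable borel" "h \<in> borel_measurable borel" "k \<in> borel_measurable borel"
    and n: "n \<bullet> n = 1" and k: "\<And>r. k (- r) = k r" "(\<integral>\<^sup>+r. k r \<partial>lborel) = 1"
  shows "(\<integral>\<^sup>+z. h (n \<bullet> z - c) * Q (slant_proj n c n z) \<partial>lborel)
    = (\<integral>\<^sup>+r. h r \<partial>lborel) * (\<integral>\<^sup>+z. k (n \<bullet> z - c) * Q (slant_proj n c n z) \<partial>lborel)"
proof -
  have p: "slant_proj n c n (z + s *\<^sub>R n) = slant_proj n c n z" for s z
    by (simp add: slant_proj_def n inner_add_right algebra_simps)
  have tr: "(\<integral>\<^sup>+z. g (n \<bullet> z - c) * Q (slant_proj n c n z) \<partial>lborel)
      = (\<integral>\<^sup>+z. g (n \<bullet> z - c + s) * Q (slant_proj n c n z) \<partial>lborel)"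
    if [measurable]: "g \<in> borel_measurable borel" for g s
    using nn_integral_lborel_translate[of "\<lambda>z. g (n \<bullet> z - c) * Q (slant_proj n c n z)" "s *\<^sub>R n"]
    by (simp add: p inner_add_right n algebra_simps)
  have "(\<integral>\<^sup>+z. h (n \<bullet> z - c) * Q (slant_proj n c n z) \<partial>lborel)
      = (\<integral>\<^sup>+s. k s * (\<integral>\<^sup>+z. h (n \<bullet> z - c) * Q (slant_proj n c n z) \<partial>lborel) \<partial>lborel)"
    by (simp add: nn_integral_multc k)
  also have "\<dots> = (\<integral>\<^sup>+s. k s * (\<integral>\<^sup>+z. h (n \<bullet> z - c + s) * Q (slant_proj n c n z) \<partial>lborel) \<partial>lborel)"
    by (intro nn_integral_cong arg_cong2[where f = "(*)"] refl tr) measurable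
  also have "\<dots> = (\<integral>\<^sup>+s. (\<integral>\<^sup>+z. k s * (h (n \<bullet> z - c + s) * Q (slant_proj n c n z)) \<partial>lborel) \<partial>lborel)"
    by (simp add: nn_integral_cmult)
  also have "\<dots> = (\<integral>\<^sup>+z. (\<integral>\<^sup>+s. k s * (h (n \<bullet> z - c + s) * Q (slant_proj n c n z)) \<partial>lborel) \<partial>lborel)"
    by (rule lborel_pair.Fubini') measurable
  \<comment> \<open>This substitution moves the height of \<open>z\<close> from \<open>h\<close> to
    \<open>k\<close> and so decouples \<open>h\<close> from \<open>z\<close>.\<close>
  also have "\<dots> = (\<integral>\<^sup>+z. (\<integral>\<^sup>+s. k (s - (n \<bullet> z - c)) * (h s * Q (slant_proj n c n z)) \<partial>lborel) \<partial>lborel)"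
  proof (rule nn_integral_cong)
    fix z
    show "(\<integral>\<^sup>+s. k s * (h (n \<bullet> z - c + s) * Q (slant_proj n c n z)) \<partial>lborel)
        = (\<integral>\<^sup>+s. k (s - (n \<bullet> z - c)) * (h s * Q (slant_proj n c n z)) \<partial>lborel)"
      using nn_integral_lborel_translate[of "\<lambda>s. k (s - (n \<bullet> z - c)) * (h s * Q (slant_proj n c n z))" "n \<bullet> z - c"]
      by (simp add: add.commute)
  qed
  also have "\<dots> = (\<integral>\<^sup>+s. (\<integral>\<^sup>+z. k (s - (n \<bullet> z - c)) * (h s * Q (slant_proj n c n z)) \<partial>lborel) \<partial>lborel)"
    by (rule lborel_pair.Fubini') measurable
  also have "\<dots> = (\<integral>\<^sup>+s. h s * (\<integral>\<^sup>+z. k (s - (n \<bullet> z - c)) * Q (slant_proj n c n z) \<partial>lborel) \<partial>lborel)"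
    by (simp add: nn_integral_cmult[symmetric] mult.left_commute)
  also have "\<dots> = (\<integral>\<^sup>+s. h s * (\<integral>\<^sup>+z. k (n \<bullet> z - c) * Q (slant_proj n c n z) \<partial>lborel) \<partial>lborel)"
  proof (rule nn_integral_cong)
    fix s
    \<comment> \<open>Shifting by \<open>s\<close> leaves \<open>k\<close> at the negative of the
      height, which is where its symmetry is used.\<close>
    have "k (c - n \<bullet> z) = k (n \<bullet> z - c)" for z
      using k(1)[of "n \<bullet> z - c"] by simp
    then have "(\<integral>\<^sup>+z. k (s - (n \<bullet> z - c)) * Q (slant_proj n c n z) \<partial>lborel)
        = (\<integral>\<^sup>+z. k (n \<bullet> z - c) * Q (slant_proj n c n z) \<partial>lborel)"
      using tr[of "\<lambda>r. k (s - r)" s] by simp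
    then show "h s * (\<integral>\<^sup>+z. k (s - (n \<bullet> z - c)) * Q (slant_proj n c n z) \<partial>lborel)
        = h s * (\<integral>\<^sup>+z. k (n \<bullet> z - c) * Q (slant_proj n c n z) \<partial>lborel)"
      by simp
  qed
  also have "\<dots> = (\<integral>\<^sup>+r. h r \<partial>lborel) * (\<integral>\<^sup>+z. k (n \<bullet> z - c) * Q (slant_proj n c n z) \<partial>lborel)"
    by (simp add: nn_integral_multc)
  finally show ?thesis .
qed

lemma closest_point_unit_hyperplane:
  fixes n :: "'a::euclidean_space"
  assumes "norm n = 1"
  shows "closest_point {x. n \<bullet> x = c} z = slant_proj n c n z"
    and "infdist z {x. n \<bullet> x = c} = \<bar>n \<bullet> z - c\<bar>"
proof -
  let ?H = "{x. n \<bullet> x = c}"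
  have nn: "n \<bullet> n = 1" using assms by (simp add: dot_square_norm)
  have inH: "slant_proj n c n z \<in> ?H" using nn by (simp add: slant_proj_in)
  have d: "dist z (slant_proj n c n z) = \<bar>n \<bullet> z - c\<bar>"
    using assms nn by (simp add: slant_proj_def dist_norm)
  have le: "\<bar>n \<bullet> z - c\<bar> \<le> dist z y" if "y \<in> ?H" for y
    using Cauchy_Schwarz_ineq2[of n "z - y"] that assms by (simp add: dist_norm inner_diff_right)
  show "closest_point ?H z = slant_proj n c n z"
    using closest_point_unique[of ?H "slant_proj n c n z" z] inH d le
    by (simp add: convex_hyperplane closed_hyperplane)
  show "infdist z ?H = \<bar>n \<bullet> z - c\<bar>"
  proof (rule antisym)
    show "infdist z ?H \<le> \<bar>n \<bullet> z - c\<bar>" using infdist_le[OF inH, of z] d by simp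
    show "\<bar>n \<bullet> z - c\<bar> \<le> infdist z ?H"
      unfolding infdist_notempty[OF ex_in_conv[THEN iffD1, OF exI, OF inH]]
      using inH le by (intro cINF_greatest) auto
  qed
qed

lemma hyperplane_measure_eq:
  fixes n :: "'a::euclidean_space"
  assumes "norm n = 1"
  shows "hyperplane_measure {x. n \<bullet> x = c}
    = distr (restrict_space lborel {z. n \<bullet> z - c \<in> {-1/2..1/2}}) borel (slant_proj n c n)"
proof -
  have "closest_point {x. n \<bullet> x = c} = slant_proj n c n"
    by (rule ext) (rule closest_point_unit_hyperplane(1)[OF assms])
  moreover have "{z. infdist z {x. n \<bullet> x = c} \<le> 1/2} = {z. n \<bullet> z - c \<in> {-1/2..1/2}}"
    unfolding closest_point_unit_hyperplane(2)[OF assms] by (auto simp only: mem_Collect_eq atLeastAtMost_iff abs_le_iff)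
  ultimately show ?thesis
    by (simp only: hyperplane_measure_def)
qed

lemma sets_hyperplane_measure [simp, measurable_cong]: "sets (hyperplane_measure H) = sets borel"
  by (simp add: hyperplane_measure_def)

lemma space_hyperplane_measure [simp]: "space (hyperplane_measure H) = UNIV"
  by (simp add: hyperplane_measure_def)

lemma emeasure_hyperplane_measure:
  fixes n :: "'a::euclidean_space"
  assumes n: "norm n = 1" and A[measurable]: "A \<in> sets borel"
  shows "emeasure (hyperplane_measure {x. n \<bullet> x = c}) A
    = (\<integral>\<^sup>+z. indicator {-1/2..1/2} (n \<bullet> z - c) * indicator A (slant_proj n c n z) \<partial>lborel)"
proof -
  let ?S = "{z. n \<bullet> z - c \<in> {-1/2..1/2}}"
  have [measurable]: "?S \<in> sets borel" by measurable
  have "emeasure (hyperplane_measure {x. n \<bullet> x = c}) A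
      = emeasure (restrict_space lborel ?S) (slant_proj n c n -` A \<inter> ?S)"
    unfolding hyperplane_measure_eq[OF n]
    by (subst emeasure_distr) (auto simp: space_restrict_space intro: measurable_restrict_space1)
  also have "\<dots> = emeasure lborel (slant_proj n c n -` A \<inter> ?S)"
    by (intro emeasure_restrict_space) auto
  also have "\<dots> = (\<integral>\<^sup>+z. indicator (slant_proj n c n -` A \<inter> ?S) z \<partial>lborel)"
    by (subst nn_integral_indicator) (auto intro!: sets.Int measurable_sets_borel[OF measurable_slant_proj])
  also have "\<dots> = (\<integral>\<^sup>+z. indicator {-1/2..1/2} (n \<bullet> z - c) * indicator A (slant_proj n c n z) \<partial>lborel)"
    by (intro nn_integral_cong) (auto simp: indicator_def)
  finally show ?thesis .
qed

text \<open>A shear parallel to the plane preserves volume and straightens the slanted prism into a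
  right one of height \<open>t * \<bar>n \<bullet> e\<bar>\<close>.\<close>

lemma emeasure_prism:
  fixes n :: "'a::euclidean_space"
  assumes n: "norm n = 1" and e: "n \<bullet> e \<noteq> 0" and t: "0 \<le> t" and A[measurable]: "A \<in> sets borel"
  shows "emeasure lborel {z. (n \<bullet> z - c) / (n \<bullet> e) \<in> {0..t} \<and> slant_proj n c e z \<in> A}
    = ennreal (t * \<bar>n \<bullet> e\<bar>) * emeasure (hyperplane_measure {x. n \<bullet> x = c}) A"
proof -
  \<comment> \<open>The interval of heights covered by the prism, for either sign of
    \<open>n \<bullet> e\<close>.\<close>
  let ?h = "indicator {min 0 (t * (n \<bullet> e))..max 0 (t * (n \<bullet> e))} :: real \<Rightarrow> ennreal"
  let ?S = "{z. (n \<bullet> z - c) / (n \<bullet> e) \<in> {0..t} \<and> slant_proj n c e z \<in> A}"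
  \<comment> \<open>\<open>w\<close> is parallel to the plane, and shearing by the height times
    \<open>w\<close> turns the orthogonal foot into the slanted one, as \<open>sh\<close>
    records.\<close>
  define w where "w = (1 / (n \<bullet> e)) *\<^sub>R e - n"
  have nn: "n \<bullet> n = 1" using n by (simp add: dot_square_norm)
  have nw: "n \<bullet> w = 0" using e nn by (simp add: w_def inner_diff_right)
  have [measurable]: "?S \<in> sets borel" by measurable
  have mem: "r / (n \<bullet> e) \<in> {0..t} \<longleftrightarrow> r \<in> {min 0 (t * (n \<bullet> e))..max 0 (t * (n \<bullet> e))}" for r
    using e t mult_nonneg_nonneg[of t "n \<bullet> e"] mult_nonneg_nonpos[of t "n \<bullet> e"]
    by (cases "n \<bullet> e > 0") (auto simp: divide_le_eq zero_le_divide_iff min_def max_def not_less)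
  have sh: "slant_proj n c e (z + (n \<bullet> z - c) *\<^sub>R w) = slant_proj n c n z" for z
  proof -
    have "n \<bullet> (z + (n \<bullet> z - c) *\<^sub>R w) = n \<bullet> z" by (simp add: inner_add_right nw)
    then show ?thesis
      unfolding slant_proj_def by (simp add: w_def nn scaleR_diff_right)
  qed
  have "emeasure lborel ?S = (\<integral>\<^sup>+z. indicator ?S z \<partial>lborel)"
    by (subst nn_integral_indicator) auto
  also have "\<dots> = (\<integral>\<^sup>+z. ?h (n \<bullet> z - c) * indicator A (slant_proj n c e z) \<partial>lborel)"
    using mem by (intro nn_integral_cong) (auto simp: indicator_def)
  also have "\<dots> = (\<integral>\<^sup>+z. ?h (n \<bullet> (z + (n \<bullet> z - c) *\<^sub>R w) - c) * indicator A (slant_proj n c e (z + (n \<bullet> z - c) *\<^sub>R w)) \<partial>lborel)"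
    by (rule nn_integral_lborel_shear[symmetric]) (auto simp: inner_add_right nw)
  also have "\<dots> = (\<integral>\<^sup>+z. ?h (n \<bullet> z - c) * indicator A (slant_proj n c n z) \<partial>lborel)"
    by (simp only: sh) (simp add: inner_add_right nw)
  also have "\<dots> = (\<integral>\<^sup>+r. ?h r \<partial>lborel) * (\<integral>\<^sup>+z. indicator {-1/2..1/2} (n \<bullet> z - c) * indicator A (slant_proj n c n z) \<partial>lborel)"
  proof (rule nn_integral_slab)
    show "(\<integral>\<^sup>+r. indicator {-1/2..1/2::real} r \<partial>lborel) = 1"
      by (subst nn_integral_indicator) auto
  qed (auto simp: nn indicator_def)
  also have "(\<integral>\<^sup>+r. ?h r \<partial>lborel) = ennreal (t * \<bar>n \<bullet> e\<bar>)"
    using t by (simp add: abs_if min_def max_def zero_le_mult_iff mult_le_0_iff not_le)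
  finally show ?thesis
    by (simp add: emeasure_hyperplane_measure[OF n])
qed

text \<open>The passage from sets to functions is made once, as an equality of measures: projecting
  the slab along \<open>e\<close> gives a constant multiple of the surface measure.\<close>

lemma integral_prism:
  fixes n :: "'a::euclidean_space" and g :: "'a \<Rightarrow> real"
  assumes n: "norm n = 1" and e: "n \<bullet> e \<noteq> 0" and t: "0 \<le> t" and g[measurable]: "g \<in> borel_measurable borel"
  shows "(LINT z|lborel. indicator {z. (n \<bullet> z - c) / (n \<bullet> e) \<in> {0..t}} z * g (slant_proj n c e z))
    = t * \<bar>n \<bullet> e\<bar> * (LINT x|hyperplane_measure {x. n \<bullet> x = c}. g x)"
proof -
  let ?T = "{z. (n \<bullet> z - c) / (n \<bullet> e) \<in> {0..t}}"
  have [measurable]: "?T \<in> sets borel" by measurable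
  have "distr (restrict_space lborel ?T) borel (slant_proj n c e)
      = density (hyperplane_measure {x. n \<bullet> x = c}) (\<lambda>_. ennreal (t * \<bar>n \<bullet> e\<bar>))"
  proof (rule measure_eqI)
    fix A assume "A \<in> sets (distr (restrict_space lborel ?T) borel (slant_proj n c e))"
    then have A[measurable]: "A \<in> sets borel" by simp
    have "emeasure (distr (restrict_space lborel ?T) borel (slant_proj n c e)) A
        = emeasure (restrict_space lborel ?T) (slant_proj n c e -` A \<inter> ?T)"
      by (subst emeasure_distr) (auto simp: space_restrict_space intro: measurable_restrict_space1)
    also have "\<dots> = emeasure lborel (slant_proj n c e -` A \<inter> ?T)"
      by (intro emeasure_restrict_space) auto
    also have "slant_proj n c e -` A \<inter> ?T = {z. (n \<bullet> z - c) / (n \<bullet> e) \<in> {0..t} \<and> slant_proj n c e z \<in> A}"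
      by auto
    also note emeasure_prism[OF n e t A]
    also have "ennreal (t * \<bar>n \<bullet> e\<bar>) * emeasure (hyperplane_measure {x. n \<bullet> x = c}) A
        = emeasure (density (hyperplane_measure {x. n \<bullet> x = c}) (\<lambda>_. ennreal (t * \<bar>n \<bullet> e\<bar>))) A"
      by (subst emeasure_density_const) auto
    finally show "emeasure (distr (restrict_space lborel ?T) borel (slant_proj n c e)) A
        = emeasure (density (hyperplane_measure {x. n \<bullet> x = c}) (\<lambda>_. ennreal (t * \<bar>n \<bullet> e\<bar>))) A" .
  qed simp
  then have "(LINT x|distr (restrict_space lborel ?T) borel (slant_proj n c e). g x)
      = (LINT x|density (hyperplane_measure {x. n \<bullet> x = c}) (\<lambda>_. ennreal (t * \<bar>n \<bullet> e\<bar>)). g x)"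
    by simp
  moreover have "(LINT x|distr (restrict_space lborel ?T) borel (slant_proj n c e). g x)
      = (LINT z|lborel. indicator ?T z * g (slant_proj n c e z))"
    by (subst integral_distr) (auto simp: integral_restrict_space intro: measurable_restrict_space1)
  moreover have "(LINT x|density (hyperplane_measure {x. n \<bullet> x = c}) (\<lambda>_. ennreal (t * \<bar>n \<bullet> e\<bar>)). g x)
      = t * \<bar>n \<bullet> e\<bar> * (LINT x|hyperplane_measure {x. n \<bullet> x = c}. g x)"
    using t by (subst integral_density) auto
  ultimately show ?thesis by simp
qed

text \<open>A face reduced to what surface measure and local geometry use. The sign of the normal is
  left open: \<open>flat_face_flip\<close> allows both, and each cell later picks the outward
  one.\<close>

locale flat_face =
  fixes \<sigma> :: "'a::euclidean_space set" and n :: 'a and c :: real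
  assumes norm_n: "norm n = 1" and opn: "openin (top_of_set {x. n \<bullet> x = c}) \<sigma>"
    and nonempty: "\<sigma> \<noteq> {}" and bnd: "bounded \<sigma>"
begin

lemma inner_n: "n \<bullet> n = 1"
  using norm_n by (simp add: dot_square_norm)

lemma on_plane: "x \<in> \<sigma> \<Longrightarrow> n \<bullet> x = c"
  using opn openin_imp_subset by fastforce

lemma affine_hull_eq_plane: "affine hull \<sigma> = {x. n \<bullet> x = c}"
  using affine_hull_openin[of "{x. n \<bullet> x = c}" \<sigma>] opn nonempty affine_hyperplane
  by (metis affine_hull_eq)

lemma contains_ball:
  assumes "x \<in> \<sigma>"
  obtains r where "r > 0" "\<And>y. dist x y < r \<Longrightarrow> n \<bullet> y = c \<Longrightarrow> y \<in> \<sigma>"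
proof -
  obtain T where "open T" "\<sigma> = {x. n \<bullet> x = c} \<inter> T"
    using opn by (auto simp: openin_open)
  moreover then obtain r where "r > 0" "ball x r \<subseteq> T"
    using assms openE[of T x] by auto
  ultimately show ?thesis
    by (intro that[of r]) auto
qed

lemma borel: "\<sigma> \<in> sets borel"
proof -
  obtain T where "open T" "\<sigma> = {x. n \<bullet> x = c} \<inter> T"
    using opn by (auto simp: openin_open)
  then show ?thesis
    by (simp add: closed_hyperplane)
qed

lemma space_face_measure [simp]: "space (face_measure \<sigma>) = \<sigma>"
  by (simp add: face_measure_def space_restrict_space)

lemma face_measure_eq: "face_measure \<sigma> = restrict_space (hyperplane_measure {x. n \<bullet> x = c}) \<sigma>"
  by (simp add: face_measure_def affine_hull_eq_plane)

lemma emeasure_face_measure: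
  assumes "A \<in> sets borel" "A \<subseteq> \<sigma>"
  shows "emeasure (face_measure \<sigma>) A = emeasure (hyperplane_measure {x. n \<bullet> x = c}) A"
  unfolding face_measure_eq using assms borel by (intro emeasure_restrict_space) auto

lemma sets_face_measure: "A \<in> sets (face_measure \<sigma>) \<longleftrightarrow> A \<subseteq> \<sigma> \<and> A \<in> sets borel"
  using borel by (auto simp: face_measure_def sets_restrict_space_iff)

lemma finite_measure_face: "finite_measure (face_measure \<sigma>)"
proof
  obtain R where "\<forall>x\<in>\<sigma>. norm x \<le> R"
    using bnd by (auto simp: bounded_iff)
  then have R: "\<sigma> \<subseteq> cball 0 R" by auto
  have "emeasure (face_measure \<sigma>) \<sigma> = (\<integral>\<^sup>+z. indicator {-1/2..1/2} (n \<bullet> z - c) * indicator \<sigma> (slant_proj n c n z) \<partial>lborel)"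
    using emeasure_face_measure[OF borel] emeasure_hyperplane_measure[OF norm_n borel] by simp
  also have "\<dots> \<le> (\<integral>\<^sup>+z. indicator (cball (0::'a) (R + 1)) z \<partial>lborel)"
  proof (intro nn_integral_mono)
    fix z
    have "z \<in> cball 0 (R + 1)" if "n \<bullet> z - c \<in> {-1/2..1/2}" "slant_proj n c n z \<in> \<sigma>"
    proof -
      have "\<bar>n \<bullet> z - c\<bar> \<le> 1" using that(1) by auto
      have "norm z \<le> norm (slant_proj n c n z) + norm ((n \<bullet> z - c) *\<^sub>R n)"
        using norm_triangle_ineq[of "slant_proj n c n z" "(n \<bullet> z - c) *\<^sub>R n"]
        by (simp add: slant_proj_def inner_n)
      also have "\<dots> \<le> R + 1" using that(2) R norm_n \<open>\<bar>n \<bullet> z - c\<bar> \<le> 1\<close> by (auto intro!: add_mono)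
      finally show ?thesis by simp
    qed
    then show "indicator {-1/2..1/2} (n \<bullet> z - c) * indicator \<sigma> (slant_proj n c n z) \<le> (indicator (cball (0::'a) (R + 1)) z :: ennreal)"
      by (auto simp: indicator_def)
  qed
  also have "\<dots> < \<infinity>"
    using emeasure_bounded_finite[of "cball 0 (R + 1) :: 'a set"] by (simp add: less_top)
  finally show "emeasure (face_measure \<sigma>) (space (face_measure \<sigma>)) \<noteq> \<infinity>" by simp
qed

text \<open>Projection onto the plane does not increase the distance to \<open>x\<close>, so a small
  full-dimensional ball lies in the prism that measures
  \<open>\<sigma> \<inter> ball x r\<close>.\<close>

lemma emeasure_face_ball_pos:
  assumes "x \<in> \<sigma>" "r > 0"
  shows "emeasure (face_measure \<sigma>) (\<sigma> \<inter> ball x r) > 0"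
proof -
  obtain r' where r': "r' > 0" "\<And>y. dist x y < r' \<Longrightarrow> n \<bullet> y = c \<Longrightarrow> y \<in> \<sigma>"
    using contains_ball[OF assms(1)] by metis
  \<comment> \<open>The radius keeps the ball in the slab (\<open>1/2\<close>), and its projection
    in the face (\<open>r'\<close>) and in \<open>ball x r\<close>.\<close>
  define s where "s = min r (min r' (1/2))"
  have s: "s > 0" using assms r' by (simp add: s_def)
  have "0 < emeasure lborel (ball x s)"
    using s open_not_negligible[of "ball x s"]
    by (auto simp: negligible_iff_null_sets null_sets_def zero_less_iff_neq_zero)
  also have "\<dots> = (\<integral>\<^sup>+z. indicator (ball x s) z \<partial>lborel)" by simp
  also have "\<dots> \<le> (\<integral>\<^sup>+z. indicator {-1/2..1/2} (n \<bullet> z - c) * indicator (\<sigma> \<inter> ball x r) (slant_proj n c n z) \<partial>lborel)"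
  proof (intro nn_integral_mono)
    fix z
    have "n \<bullet> z - c \<in> {-1/2..1/2} \<and> slant_proj n c n z \<in> \<sigma> \<inter> ball x r" if "z \<in> ball x s"
    proof -
      let ?p = "slant_proj n c n z"
      have "n \<bullet> z - c = n \<bullet> (z - x)" using on_plane[OF assms(1)] by (simp add: inner_diff_right)
      then have nz: "\<bar>n \<bullet> z - c\<bar> \<le> norm (z - x)"
        using Cauchy_Schwarz_ineq2[of n "z - x"] norm_n by simp
      have "norm (?p - x) \<le> norm (z - x)"
      proof -
        have "n \<bullet> (?p - x) = 0"
          using slant_proj_in[of n n c z] inner_n on_plane[OF assms(1)] by (simp add: inner_diff_right)
        then have "(norm (z - x))\<^sup>2 = (norm (?p - x))\<^sup>2 + (n \<bullet> z - c)\<^sup>2"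
          using norm_add_Pythagorean[of "?p - x" "(n \<bullet> z - c) *\<^sub>R n"] norm_n
          by (simp add: orthogonal_def inner_commute slant_proj_def inner_n)
        then show ?thesis by (metis le_add_same_cancel1 norm_ge_zero power2_le_imp_le zero_le_power2)
      qed
      then have "dist x ?p < s"
        using that by (simp add: dist_norm norm_minus_commute)
      then have "?p \<in> \<sigma> \<inter> ball x r"
        using r'(2)[of ?p] slant_proj_in[of n n c z] inner_n by (auto simp: s_def)
      moreover have "norm (z - x) < 1/2" using that by (simp add: s_def dist_norm norm_minus_commute)
      ultimately show ?thesis using nz by auto
    qed
    then show "indicator (ball x s) z \<le> indicator {-1/2..1/2} (n \<bullet> z - c) * (indicator (\<sigma> \<inter> ball x r) (slant_proj n c n z) :: ennreal)"
      by (auto simp: indicator_def)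
  qed
  also have "\<dots> = emeasure (face_measure \<sigma>) (\<sigma> \<inter> ball x r)"
    using borel by (subst emeasure_face_measure) (auto simp: emeasure_hyperplane_measure[OF norm_n])
  finally show ?thesis .
qed

lemma AE_face_continuous_eq_0:
  assumes f: "continuous_on \<sigma> f" and ae: "AE x in face_measure \<sigma>. f x = (0::real)" and x: "x \<in> \<sigma>"
  shows "f x = 0"
proof (rule ccontr)
  assume "f x \<noteq> 0"
  then obtain r where r: "r > 0" "\<And>y. y \<in> \<sigma> \<Longrightarrow> dist y x < r \<Longrightarrow> dist (f y) (f x) < \<bar>f x\<bar>"
    using f x unfolding continuous_on_iff by (metis zero_less_abs_iff)
  have "AE y in face_measure \<sigma>. y \<notin> \<sigma> \<inter> ball x r"
    using ae by eventually_elim (use r in \<open>force simp: dist_commute dist_real_def\<close>)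
  then have "\<sigma> \<inter> ball x r \<in> null_sets (face_measure \<sigma>)"
    using borel by (subst AE_iff_null_sets) (auto simp: sets_face_measure)
  then show False using emeasure_face_ball_pos[OF x r(1)] by (simp add: null_sets_def)
qed

lemma integral_face_measure:
  fixes g :: "'a \<Rightarrow> real"
  shows "(LINT x|face_measure \<sigma>. g x) = (LINT x|hyperplane_measure {x. n \<bullet> x = c}. indicator \<sigma> x * g x)"
  unfolding face_measure_eq using borel by (subst integral_restrict_space) auto

lemma measurable_face_continuous:
  fixes g :: "'a \<Rightarrow> real"
  assumes "continuous_on \<sigma> g" shows "g \<in> borel_measurable (face_measure \<sigma>)"
proof -
  have "sets (face_measure \<sigma>) = sets (restrict_space borel \<sigma>)"
    unfolding face_measure_def by (intro sets_restrict_space_cong) simp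
  then show ?thesis
    using borel_measurable_continuous_on_restrict[OF assms] by (simp cong: measurable_cong_sets)
qed

end

section \<open>Local geometry of cells and faces\<close>

text \<open>A relatively open set misses its frontier, so frontier points are not strictly below the
  graph; the region strictly above is open and misses \<open>S\<close>, so they are not there
  either.\<close>

lemma rel_frontier_on_graph:
  fixes S :: "'a::euclidean_space set" and g :: "'a \<Rightarrow> real"
  assumes S: "openin (top_of_set (affine hull S)) S" and U: "open U" and g: "continuous_on UNIV g"
    and sub: "S \<inter> U = {y \<in> affine hull S \<inter> U. y \<bullet> e < g (y - (y \<bullet> e) *\<^sub>R e)}"
    and y: "y \<in> rel_frontier S" "y \<in> U"
  shows "y \<bullet> e = g (y - (y \<bullet> e) *\<^sub>R e)"
proof (rule antisym)
  have mem: "z \<in> S \<longleftrightarrow> z \<bullet> e < g (z - (z \<bullet> e) *\<^sub>R e)" if "z \<in> affine hull S" "z \<in> U" for z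
  proof -
    have "z \<in> S \<inter> U \<longleftrightarrow> z \<in> {y \<in> affine hull S \<inter> U. y \<bullet> e < g (y - (y \<bullet> e) *\<^sub>R e)}"
      by (simp only: sub)
    then show ?thesis using that by simp
  qed
  have yS: "y \<notin> S" "y \<in> closure S"
    using y(1) S rel_interior_eq[of S] by (auto simp: rel_frontier_def)
  have "closure S \<subseteq> affine hull S"
    by (rule closure_minimal) (auto intro: hull_inc)
  then have "y \<in> affine hull S" using yS by auto
  then show "g (y - (y \<bullet> e) *\<^sub>R e) \<le> y \<bullet> e"
    using mem[OF _ y(2)] yS(1) by simp
  show "y \<bullet> e \<le> g (y - (y \<bullet> e) *\<^sub>R e)"
  proof (rule ccontr)
    assume above: "\<not> ?thesis"
    define W where "W = U \<inter> {y. g (y - (y \<bullet> e) *\<^sub>R e) < y \<bullet> e}"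
    have "continuous_on UNIV (\<lambda>y. g (y - (y \<bullet> e) *\<^sub>R e))"
      by (rule continuous_on_compose2[OF g]) (auto intro!: continuous_intros)
    then have "open W"
      unfolding W_def using U by (intro open_Int open_Collect_less continuous_intros)
    moreover have "y \<in> W" using above y(2) by (simp add: W_def)
    ultimately have "W \<inter> S \<noteq> {}"
      using yS(2) open_Int_closure_eq_empty[of W S] by blast
    then obtain z where "z \<in> W" "z \<in> S" by auto
    then have "z \<in> U" "g (z - (z \<bullet> e) *\<^sub>R e) < z \<bullet> e" by (auto simp: W_def)
    then show False using mem[OF hull_inc[OF \<open>z \<in> S\<close>]] \<open>z \<in> S\<close> by simp
  qed
qed

text \<open>Near \<open>x\<close> the set \<open>K\<close> is an open half-ball with
  \<open>m\<close> pointing outwards. Including \<open>\<sigma>\<close> in the condition says that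
  locally the boundary of \<open>K\<close> is this one face.\<close>

definition halfspace_at :: "'a::euclidean_space set \<Rightarrow> 'a set \<Rightarrow> 'a \<Rightarrow> 'a \<Rightarrow> bool" where
  "halfspace_at K \<sigma> m x \<longleftrightarrow> (\<exists>r>0. \<forall>y\<in>ball x r. (y \<in> K \<longleftrightarrow> m \<bullet> (y - x) < 0) \<and> (y \<in> \<sigma> \<longleftrightarrow> m \<bullet> (y - x) = 0))"

context flat_face
begin

text \<open>Relative openness gives a disc of the plane inside \<open>\<sigma>\<close>, and this
  disc lies on the Lipschitz graph that bounds \<open>K\<close>. A graph is single-valued, so its
  direction \<open>e\<close> is transversal to the plane, and near \<open>x\<close> the graph is the
  plane.\<close>

lemma local_halfspace:
  assumes K: "open K" "lipschitz_boundary K" and \<sigma>K: "\<sigma> \<subseteq> frontier K" and x: "x \<in> \<sigma>"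
  shows "halfspace_at K \<sigma> n x \<or> halfspace_at K \<sigma> (- n) x"
proof -
  have Kne: "K \<noteq> {}" using \<sigma>K x by auto
  have aff: "affine hull K = UNIV" using affine_hull_open[OF K(1) Kne] .
  have fr: "rel_frontier K = frontier K"
    using K(1) by (simp add: rel_frontier_def frontier_def rel_interior_open interior_open)
  obtain U e g L where U: "open U" "x \<in> U" and e: "norm e = 1" and g: "L-lipschitz_on UNIV (g :: 'a \<Rightarrow> real)"
    and sub: "K \<inter> U = {y \<in> affine hull K \<inter> U. y \<bullet> e < g (y - (y \<bullet> e) *\<^sub>R e)}"
    using bspec[OF K(2)[unfolded lipschitz_boundary_def fr] subsetD[OF \<sigma>K x]] by blast
  have ee: "e \<bullet> e = 1" using e by (simp add: dot_square_norm)
  have graph: "y \<bullet> e = g (y - (y \<bullet> e) *\<^sub>R e)" if "y \<in> \<sigma>" "y \<in> U" for y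
    using that \<sigma>K K(1) by (intro rel_frontier_on_graph[OF _ U(1) lipschitz_on_continuous_on[OF g] sub])
      (auto simp: fr aff)
  have foot: "y + s *\<^sub>R e - ((y + s *\<^sub>R e) \<bullet> e) *\<^sub>R e = y - (y \<bullet> e) *\<^sub>R e" for y s
    by (simp add: inner_add_left ee algebra_simps)
  obtain r0 where r0: "r0 > 0" "\<And>y. dist x y < r0 \<Longrightarrow> n \<bullet> y = c \<Longrightarrow> y \<in> \<sigma>"
    using contains_ball[OF x] by metis
  obtain r1 where r1: "r1 > 0" "ball x r1 \<subseteq> U"
    by (rule openE[OF U])
  define r2 where "r2 = min r0 r1"
  have r2: "r2 > 0" using r0 r1 by (simp add: r2_def)
  have in\<sigma>: "y \<in> \<sigma>" "y \<in> U" if "dist x y < r2" "n \<bullet> y = c" for y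
    using that r0(2)[of y] r1(2) by (auto simp: r2_def)
  \<comment> \<open>Otherwise moving from \<open>x\<close> along \<open>e\<close> would stay in the
    disc and give two points of the graph with the same foot.\<close>
  have ne: "n \<bullet> e \<noteq> 0"
  proof
    assume 0: "n \<bullet> e = 0"
    let ?y = "x + (r2 / 2) *\<^sub>R e"
    have "dist x ?y < r2" using r2 e by (simp add: dist_norm)
    moreover have "n \<bullet> ?y = c" using on_plane[OF x] 0 by (simp add: inner_add_right)
    ultimately have "?y \<bullet> e = x \<bullet> e"
      using graph[of ?y] graph[OF x U(2)] in\<sigma>[of ?y] foot[of x "r2 / 2"] by simp
    then show False using r2 by (simp add: inner_add_left ee)
  qed
  \<comment> \<open>The orientation with \<open>m \<bullet> e > 0\<close>: the subgraph lies on the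
    negative side.\<close>
  define m where "m = sgn (n \<bullet> e) *\<^sub>R n"
  have me: "m \<bullet> e > 0" using ne by (auto simp: m_def sgn_if)
  have norm_m: "norm m = 1" using norm_n ne by (simp add: m_def abs_sgn_eq)
  have m0: "m \<bullet> (y - x) = 0 \<longleftrightarrow> n \<bullet> y = c" for y
    using ne on_plane[OF x] by (auto simp: m_def sgn_if inner_diff_right)
  \<comment> \<open>Sliding \<open>y\<close> along \<open>e\<close> onto the plane moves it by at
    most \<open>norm (y - x) / (m \<bullet> e)\<close>; this radius keeps the result within
    \<open>r2\<close> of \<open>x\<close>.\<close>
  define r where "r = r2 / (1 + 1 / (m \<bullet> e))"
  have r: "r > 0" using r2 me by (simp add: r_def add_pos_pos)
  have rr2: "r \<le> r2" using r2 me by (simp add: r_def field_simps add_pos_pos)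
  have "(y \<in> K \<longleftrightarrow> m \<bullet> (y - x) < 0) \<and> (y \<in> \<sigma> \<longleftrightarrow> m \<bullet> (y - x) = 0)" if y: "y \<in> ball x r" for y
  proof
    define s where "s = (m \<bullet> (y - x)) / (m \<bullet> e)"
    define y' where "y' = y + (- s) *\<^sub>R e"
    have "\<bar>m \<bullet> (y - x)\<bar> \<le> norm (y - x)"
      using Cauchy_Schwarz_ineq2[of m "y - x"] norm_m by simp
    then have "\<bar>s\<bar> \<le> norm (y - x) / (m \<bullet> e)"
      using me by (simp add: s_def divide_right_mono)
    have "dist x y' = norm ((y - x) - s *\<^sub>R e)"
      by (simp add: y'_def dist_norm norm_minus_commute algebra_simps)
    also have "\<dots> \<le> norm (y - x) + \<bar>s\<bar>"
      using norm_triangle_ineq4[of "y - x" "s *\<^sub>R e"] e by simp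
    also have "\<dots> \<le> norm (y - x) * (1 + 1 / (m \<bullet> e))"
      using \<open>\<bar>s\<bar> \<le> _\<close> by (simp add: distrib_left)
    also have "\<dots> < r * (1 + 1 / (m \<bullet> e))"
      using y me by (intro mult_strict_right_mono) (auto simp: dist_norm norm_minus_commute add_pos_pos)
    also have "\<dots> = r2"
    proof -
      have "1 + 1 / (m \<bullet> e) > 0" using me by (simp add: add_pos_pos)
      then show ?thesis by (simp add: r_def)
    qed
    finally have d: "dist x y' < r2" .
    have "m \<bullet> (y' - x) = 0"
      using me by (simp add: y'_def s_def inner_diff_right inner_add_right)
    then have y': "y' \<in> \<sigma>" "y' \<in> U"
      using in\<sigma>[OF d] m0 by auto
    have "y \<in> U" using y rr2 r1(2) by (auto simp: r2_def)
    then have "y \<in> K \<longleftrightarrow> y \<in> K \<inter> U" by simp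
    also have "\<dots> \<longleftrightarrow> y \<bullet> e < g (y - (y \<bullet> e) *\<^sub>R e)"
      unfolding sub using \<open>y \<in> U\<close> by (simp add: aff)
    also have "g (y - (y \<bullet> e) *\<^sub>R e) = y' \<bullet> e"
      using graph[OF y'] unfolding foot[of y "- s", folded y'_def] by simp
    also have "y \<bullet> e < y' \<bullet> e \<longleftrightarrow> s < 0"
      by (simp add: y'_def inner_diff_left ee)
    also have "\<dots> \<longleftrightarrow> m \<bullet> (y - x) < 0"
      using me by (simp add: s_def divide_less_0_iff)
    finally show "y \<in> K \<longleftrightarrow> m \<bullet> (y - x) < 0" .
    show "y \<in> \<sigma> \<longleftrightarrow> m \<bullet> (y - x) = 0"
      using in\<sigma>(1)[of y] y rr2 on_plane[of y] m0[of y] by auto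
  qed
  then have "halfspace_at K \<sigma> m x"
    using r unfolding halfspace_at_def by blast
  then show ?thesis
    using ne by (auto simp: m_def sgn_if split: if_splits)
qed

lemma halfspace_at_neighbour:
  assumes hs: "halfspace_at K \<sigma> m x" and x: "x \<in> \<sigma>" and m: "m = n \<or> m = - n"
  shows "\<exists>r>0. \<forall>z\<in>ball x r \<inter> \<sigma>. halfspace_at K \<sigma> m z"
proof -
  obtain r where r: "r > 0" "\<And>y. y \<in> ball x r \<Longrightarrow> (y \<in> K \<longleftrightarrow> m \<bullet> (y - x) < 0) \<and> (y \<in> \<sigma> \<longleftrightarrow> m \<bullet> (y - x) = 0)"
    using hs unfolding halfspace_at_def by blast
  have "halfspace_at K \<sigma> m z" if z: "z \<in> ball x r \<inter> \<sigma>" for z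
    unfolding halfspace_at_def
  proof (intro exI conjI ballI)
    show "r - dist x z > 0" using z by simp
    fix y assume "y \<in> ball z (r - dist x z)"
    then have "y \<in> ball x r" using dist_triangle[of x y z] by (simp add: dist_commute)
    moreover have "m \<bullet> (y - z) = m \<bullet> (y - x)"
      using m on_plane[OF x] on_plane[of z] z by (auto simp: inner_diff_right)
    ultimately show "y \<in> K \<longleftrightarrow> m \<bullet> (y - z) < 0" "y \<in> \<sigma> \<longleftrightarrow> m \<bullet> (y - z) = 0"
      using r(2) by auto
  qed
  with r(1) show ?thesis by blast
qed

text \<open>Each of the two orientations holds on a relatively open part of \<open>\<sigma>\<close>.
  The parts are disjoint, since \<open>x - s n\<close> for small \<open>s > 0\<close> is inside
  \<open>K\<close> for one and outside for the other; connectedness then leaves a single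
  orientation.\<close>

lemma constant_side:
  assumes K: "open K" "lipschitz_boundary K" and \<sigma>K: "\<sigma> \<subseteq> frontier K" and con: "connected \<sigma>"
  shows "\<exists>m. (m = n \<or> m = - n) \<and> (\<forall>x\<in>\<sigma>. halfspace_at K \<sigma> m x)"
proof -
  let ?A = "\<lambda>m. {x\<in>\<sigma>. halfspace_at K \<sigma> m x}"
  have op: "openin (top_of_set \<sigma>) (?A m)" if "m = n \<or> m = - n" for m
    unfolding openin_contains_ball using halfspace_at_neighbour[OF _ _ that] by blast
  have "?A n \<inter> ?A (- n) = {}"
  proof (rule ccontr)
    assume "\<not> ?thesis"
    then obtain x where "halfspace_at K \<sigma> n x" "halfspace_at K \<sigma> (- n) x" by auto
    then obtain r r' where r: "r > 0" "r' > 0"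
      "\<And>y. y \<in> ball x r \<Longrightarrow> y \<in> K \<longleftrightarrow> n \<bullet> (y - x) < 0" "\<And>y. y \<in> ball x r' \<Longrightarrow> y \<in> K \<longleftrightarrow> (- n) \<bullet> (y - x) < 0"
      unfolding halfspace_at_def by metis
    define s where "s = min r r' / 2"
    have s: "s > 0" "s < r" "s < r'" using r(1,2) by (auto simp: s_def min_def)
    have "x - s *\<^sub>R n \<in> ball x r" "x - s *\<^sub>R n \<in> ball x r'"
      using s norm_n by (auto simp: dist_norm)
    then show False using r(3,4)[of "x - s *\<^sub>R n"] s(1) inner_n by (auto simp: inner_diff_right)
  qed
  moreover have "\<sigma> \<subseteq> ?A n \<union> ?A (- n)"
    using local_halfspace[OF K \<sigma>K] by auto
  ultimately have "?A n = {} \<or> ?A (- n) = {}"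
    using con op unfolding connected_openin by blast
  then show ?thesis
    using local_halfspace[OF K \<sigma>K] by blast
qed

text \<open>Uniqueness in the description: \<open>\<sigma>\<close> contains a disc, so a candidate
  is orthogonal to the plane and equals \<open>m\<close> or \<open>- m\<close>; the side conditions
  exclude the latter.\<close>

lemma outward_normal_eq:
  assumes m: "m = n \<or> m = - n" and hs: "\<And>x. x \<in> \<sigma> \<Longrightarrow> halfspace_at K \<sigma> m x"
  shows "outward_normal K \<sigma> = m"
  unfolding outward_normal_def
proof (rule the_equality)
  have norm_m: "norm m = 1" and mm: "m \<bullet> m = 1" using m norm_n inner_n by auto
  have side: "\<forall>\<^sub>F t in at_right 0. x - t *\<^sub>R m \<in> K \<and> x + t *\<^sub>R m \<notin> K" if x: "x \<in> \<sigma>" for x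
  proof -
    obtain r where r: "r > 0" "\<And>y. y \<in> ball x r \<Longrightarrow> (y \<in> K \<longleftrightarrow> m \<bullet> (y - x) < 0)"
      using hs[OF x] unfolding halfspace_at_def by blast
    have "x - t *\<^sub>R m \<in> K \<and> x + t *\<^sub>R m \<notin> K" if "0 < t" "t < r" for t
      using r(2)[of "x - t *\<^sub>R m"] r(2)[of "x + t *\<^sub>R m"] that norm_m mm
      by (auto simp: dist_norm)
    then show ?thesis
      using r(1) by (auto simp: eventually_at_right[OF zero_less_one])
  qed
  show "norm m = 1 \<and> (\<forall>x\<in>\<sigma>. \<forall>y\<in>\<sigma>. m \<bullet> (x - y) = 0) \<and>
      (\<forall>x\<in>\<sigma>. \<forall>\<^sub>F t in at_right 0. x - t *\<^sub>R m \<in> K \<and> x + t *\<^sub>R m \<notin> K)"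
    using m on_plane norm_m side by (auto simp: inner_diff_right)
  fix n'
  assume n': "norm n' = 1 \<and> (\<forall>x\<in>\<sigma>. \<forall>y\<in>\<sigma>. n' \<bullet> (x - y) = 0) \<and>
      (\<forall>x\<in>\<sigma>. \<forall>\<^sub>F t in at_right 0. x - t *\<^sub>R n' \<in> K \<and> x + t *\<^sub>R n' \<notin> K)"
  obtain x where x: "x \<in> \<sigma>" using nonempty by auto
  obtain r where r: "r > 0" "\<And>y. dist x y < r \<Longrightarrow> n \<bullet> y = c \<Longrightarrow> y \<in> \<sigma>"
    using contains_ball[OF x] by metis
  have orth: "n' \<bullet> u = 0" if "n \<bullet> u = 0" for u
  proof -
    define d where "d = 1 + norm u"
    define s where "s = r / 2 / d"
    have d: "d > 0" by (simp add: d_def add_pos_nonneg)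
    have s: "s > 0" using r d by (simp add: s_def)
    have "s * norm u \<le> s * d" using s by (intro mult_left_mono) (auto simp: d_def)
    also have "\<dots> < r" using r(1) d by (simp add: s_def)
    finally have "x + s *\<^sub>R u \<in> \<sigma>"
      using s on_plane[OF x] that by (intro r(2)) (auto simp: dist_norm inner_add_right)
    then have "n' \<bullet> ((x + s *\<^sub>R u) - x) = 0" using n' x by blast
    then show ?thesis using s by simp
  qed
  have nn': "n' \<bullet> n' = 1" using n' by (simp add: dot_square_norm)
  \<comment> \<open>The tangential part of the candidate, which vanishes because the candidate is
    orthogonal to every tangent vector.\<close>
  define u where "u = n' - (n' \<bullet> m) *\<^sub>R m"
  have "n \<bullet> u = 0"
    using m inner_n by (auto simp: u_def inner_diff_right inner_commute)
  then have "n' \<bullet> u = 0" by (rule orth)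
  then have 1: "(n' \<bullet> m)\<^sup>2 = 1"
    by (simp add: u_def inner_diff_right nn' power2_eq_square)
  have "u \<bullet> u = 0"
    using 1 by (simp add: u_def inner_diff_right inner_diff_left nn' mm power2_eq_square inner_commute)
  then have "n' = (n' \<bullet> m) *\<^sub>R m" by (simp add: u_def)
  moreover have "n' \<bullet> m = 1 \<or> n' \<bullet> m = -1" using 1 by (simp add: power2_eq_1_iff)
  ultimately consider "n' = m" | "n' = - m" by fastforce
  then show "n' = m"
  proof cases
    case 2
    then have "\<forall>\<^sub>F t in at_right (0::real). x + t *\<^sub>R m \<in> K" using n' x by (auto elim: eventually_mono)
    moreover have "\<forall>\<^sub>F t in at_right (0::real). x + t *\<^sub>R m \<notin> K" using side[OF x] by (auto elim: eventually_mono)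
    ultimately have "\<forall>\<^sub>F t in at_right (0::real). False" by eventually_elim simp
    then show ?thesis by (simp add: trivial_limit_at_right_real eventually_False)
  qed
qed

end

text \<open>The equation of the plane is normalised; non-emptiness comes from positive surface
  measure.\<close>

lemma flat_face_of_mesh_face:
  assumes "mesh_face \<sigma>" "bounded \<sigma>"
  shows "\<exists>n c. flat_face \<sigma> n c"
proof -
  obtain a b where ab: "a \<noteq> 0" "openin (top_of_set {x. a \<bullet> x = b}) \<sigma>"
    using assms(1) unfolding mesh_face_def hyperplane_def by blast
  have "{x. (a /\<^sub>R norm a) \<bullet> x = b / norm a} = {x. a \<bullet> x = b}"
    using ab(1) by (auto simp: field_simps)
  moreover have "\<sigma> \<noteq> {}" using assms(1) unfolding mesh_face_def by auto
  ultimately have "flat_face \<sigma> (a /\<^sub>R norm a) (b / norm a)"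
    using ab assms(2) by unfold_locales auto
  then show ?thesis by blast
qed

lemma flat_face_flip:
  assumes "flat_face \<sigma> n c" shows "flat_face \<sigma> (- n) (- c)"
  using assms by (simp add: flat_face_def)

lemma flat_face_outward_normal:
  assumes "mesh_face \<sigma>" "bounded \<sigma>" "mesh_cell K" "\<sigma> \<subseteq> frontier K"
  shows "\<exists>c. flat_face \<sigma> (outward_normal K \<sigma>) c"
    and "x \<in> \<sigma> \<Longrightarrow> halfspace_at K \<sigma> (outward_normal K \<sigma>) x"
proof -
  obtain n c where nc: "flat_face \<sigma> n c" using flat_face_of_mesh_face[OF assms(1,2)] by blast
  interpret flat_face \<sigma> n c by (rule nc)
  obtain m where m: "m = n \<or> m = - n" "\<And>x. x \<in> \<sigma> \<Longrightarrow> halfspace_at K \<sigma> m x"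
    using constant_side[of K] assms unfolding mesh_cell_def mesh_face_def by blast
  have "outward_normal K \<sigma> = m" by (rule outward_normal_eq[OF m])
  then show "\<exists>c. flat_face \<sigma> (outward_normal K \<sigma>) c"
    and "x \<in> \<sigma> \<Longrightarrow> halfspace_at K \<sigma> (outward_normal K \<sigma>) x"
    using m nc flat_face_flip[OF nc] by auto
qed

text \<open>The closure of a face has empty interior in every hyperplane other than its own, and in its
  own hyperplane its interior cannot avoid the face.\<close>

lemma (in flat_face) not_covered_by_disjoint_faces:
  assumes "finite G" "\<And>\<tau>. \<tau> \<in> G \<Longrightarrow> \<exists>n' c'. flat_face \<tau> n' c'" "\<And>\<tau>. \<tau> \<in> G \<Longrightarrow> \<sigma> \<inter> \<tau> = {}"
  shows "\<exists>W\<subseteq>\<sigma>. W \<noteq> {} \<and> openin (top_of_set {x. n \<bullet> x = c}) W \<and> W \<inter> (\<Union>\<tau>\<in>G. closure \<tau>) = {}"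
  using assms
proof (induction G rule: finite_induct)
  case empty
  then show ?case using opn nonempty by blast
next
  case (insert \<tau> G)
  then obtain W where W: "W \<subseteq> \<sigma>" "W \<noteq> {}" "openin (top_of_set {x. n \<bullet> x = c}) W" "W \<inter> (\<Union>\<tau>\<in>G. closure \<tau>) = {}"
    by auto
  obtain n' c' where "flat_face \<tau> n' c'" using insert.prems(1) by blast
  then interpret \<tau>: flat_face \<tau> n' c' .
  have "\<not> W \<subseteq> closure \<tau>"
  proof
    assume sub: "W \<subseteq> closure \<tau>"
    have "closure \<tau> \<subseteq> {x. n' \<bullet> x = c'}"
      using \<tau>.on_plane closed_hyperplane by (intro closure_minimal) auto
    then have "affine hull W \<subseteq> {x. n' \<bullet> x = c'}"
      using sub affine_hyperplane by (intro hull_minimal) auto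
    moreover have "affine hull W = {x. n \<bullet> x = c}"
      using affine_hull_openin[of "{x. n \<bullet> x = c}" W] W(2,3) affine_hyperplane by (metis affine_hull_eq)
    moreover have "n \<noteq> 0" "n' \<noteq> 0" using norm_n \<tau>.norm_n by auto
    moreover have "{x. n \<bullet> x = c} \<noteq> {}" using on_plane nonempty by blast
    ultimately have eq: "{x. n \<bullet> x = c} = {x. n' \<bullet> x = c'}"
      by (intro affine_dim_equal affine_hyperplane) auto
    obtain T where T: "open T" "W = {x. n' \<bullet> x = c'} \<inter> T"
      using W(3) unfolding eq by (auto simp: openin_open)
    obtain y where "y \<in> W" using W(2) by auto
    then have "T \<inter> \<tau> \<noteq> {}"
      using sub T open_Int_closure_eq_empty[of T \<tau>] by blast
    then have "W \<inter> \<tau> \<noteq> {}" using T(2) \<tau>.on_plane by auto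
    then show False using insert.prems(2)[of \<tau>] W(1) by auto
  qed
  moreover have "openin (top_of_set {x. n \<bullet> x = c}) (W - closure \<tau>)"
    using W(3) openin_Int_open[of _ W "- closure \<tau>"] by (simp add: Diff_eq open_Compl)
  ultimately show ?case
    using W(1,4) by (intro exI[of _ "W - closure \<tau>"]) auto
qed

section \<open>The divergence theorem on polytopal cells\<close>

text \<open>Averaging over translations along \<open>w\<close>: each line parallel to \<open>w\<close> meets the set at most once.\<close>

lemma negligible_single_crossing:
  fixes A :: "'a::euclidean_space set"
  assumes A[measurable]: "A \<in> sets borel" and single: "\<And>x s. \<lbrakk>x \<in> A; x + s *\<^sub>R w \<in> A\<rbrakk> \<Longrightarrow> s = 0"
  shows "negligible A"
proof -
  let ?k = "indicator {0..1} :: real \<Rightarrow> ennreal"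
  have "emeasure lborel A = (\<integral>\<^sup>+s. ?k s * (\<integral>\<^sup>+z. indicator A z \<partial>lborel) \<partial>lborel)"
    by (simp add: nn_integral_multc)
  also have "\<dots> = (\<integral>\<^sup>+s. (\<integral>\<^sup>+z. ?k s * indicator A (z + s *\<^sub>R w) \<partial>lborel) \<partial>lborel)"
  proof (rule nn_integral_cong)
    fix s
    show "?k s * (\<integral>\<^sup>+z. indicator A z \<partial>lborel) = (\<integral>\<^sup>+z. ?k s * indicator A (z + s *\<^sub>R w) \<partial>lborel)"
      using nn_integral_lborel_translate[of "indicator A" "s *\<^sub>R w"]
      by (simp add: nn_integral_cmult del: nn_integral_indicator)
  qed
  also have "\<dots> = (\<integral>\<^sup>+z. (\<integral>\<^sup>+s. ?k s * indicator A (z + s *\<^sub>R w) \<partial>lborel) \<partial>lborel)"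
    by (rule lborel_pair.Fubini') measurable
  also have "\<dots> = (\<integral>\<^sup>+(z::'a). 0 \<partial>lborel)"
  proof (rule nn_integral_cong)
    fix z
    have "\<exists>s0. \<forall>s. z + s *\<^sub>R w \<in> A \<longrightarrow> s = s0"
    proof (cases "\<exists>s0. z + s0 *\<^sub>R w \<in> A")
      case True
      then obtain s0 where s0: "z + s0 *\<^sub>R w \<in> A" by blast
      have "s = s0" if "z + s *\<^sub>R w \<in> A" for s
        using single[OF s0, of "s - s0"] that by (simp add: algebra_simps)
      then show ?thesis by blast
    qed blast
    then obtain s0 where s0: "\<And>s. z + s *\<^sub>R w \<in> A \<Longrightarrow> s = s0" by blast
    have "(\<integral>\<^sup>+s. ?k s * indicator A (z + s *\<^sub>R w) \<partial>lborel) \<le> (\<integral>\<^sup>+s. indicator {s0} s \<partial>lborel)"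
    proof (rule nn_integral_mono)
      fix s
      show "?k s * indicator A (z + s *\<^sub>R w) \<le> indicator {s0} s"
      proof (cases "z + s *\<^sub>R w \<in> A")
        case True
        then have "s \<in> {s0}" using s0 by blast
        then show ?thesis by (simp only: indicator_simps) (simp add: indicator_def)
      qed simp
    qed
    then show "(\<integral>\<^sup>+s. ?k s * indicator A (z + s *\<^sub>R w) \<partial>lborel) = 0" by simp
  qed
  finally have "A \<in> null_sets lborel" by (auto simp: null_sets_def)
  then show ?thesis
    by (simp add: negligible_iff_null_sets null_sets_completionI)
qed

section \<open>Cylinders and prisms over a face\<close>

context flat_face
begin

lemma slant_proj_line:
  assumes "n \<bullet> e \<noteq> 0" "z + s *\<^sub>R e \<in> {x. n \<bullet> x = c}"
  shows "slant_proj n c e z = z + s *\<^sub>R e"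
  using slant_proj_add[OF assms(1), of "z + s *\<^sub>R e" c "- s"] assms(2) by simp

text \<open>Locally the relative frontier lies on a Lipschitz graph inside the plane, whose
  direction \<open>e'\<close> is tangent to it. A line along \<open>e'\<close> meets the cylinder
  over that graph at most once, so \<open>negligible_single_crossing\<close> applies, and
  negligibility is a local property.\<close>

lemma negligible_rel_frontier_cylinder:
  assumes ne: "n \<bullet> e \<noteq> 0" and lip: "lipschitz_boundary \<sigma>"
  shows "negligible {z. slant_proj n c e z \<in> rel_frontier \<sigma>}" (is "negligible ?N")
proof (subst locally_negligible_alt, rule ballI)
  fix z assume z: "z \<in> ?N"
  then have z': "slant_proj n c e z \<in> rel_frontier \<sigma>" by simp
  obtain U e' g L where U: "open U" "slant_proj n c e z \<in> U" and e': "norm e' = 1"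
    "slant_proj n c e z + e' \<in> affine hull \<sigma>" and g: "L-lipschitz_on UNIV (g :: 'a \<Rightarrow> real)"
    and sub: "\<sigma> \<inter> U = {y \<in> affine hull \<sigma> \<inter> U. y \<bullet> e' < g (y - (y \<bullet> e') *\<^sub>R e')}"
    using bspec[OF lip[unfolded lipschitz_boundary_def] z'] by blast
  have ee: "e' \<bullet> e' = 1" using e' by (simp add: dot_square_norm)
  \<comment> \<open>The slanted foot and its translate by \<open>e'\<close> both lie in the plane,
    so \<open>e'\<close> is tangent to it.\<close>
  have n0: "n \<bullet> e' = 0"
    using e'(2) slant_proj_in[OF ne, of c z] by (simp add: affine_hull_eq_plane inner_add_right)
  have contg: "continuous_on UNIV g" by (rule lipschitz_on_continuous_on[OF g])
  let ?V = "slant_proj n c e -` U"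
  have V: "open ?V"
    by (rule open_vimage[OF U(1) continuous_on_slant_proj])
  let ?F = "\<lambda>y. y \<bullet> e' = g (y - (y \<bullet> e') *\<^sub>R e')"
  let ?A = "{z. ?F (slant_proj n c e z)}"
  have [measurable]: "g \<in> borel_measurable borel"
    by (rule borel_measurable_continuous_onI[OF contg])
  have "negligible ?A"
  proof (rule negligible_single_crossing[where w = e'])
    show "?A \<in> sets borel" by measurable
    fix x s assume x: "x \<in> ?A" "x + s *\<^sub>R e' \<in> ?A"
    define y where "y = slant_proj n c e x"
    have sl: "slant_proj n c e (x + s *\<^sub>R e') = y + s *\<^sub>R e'"
      by (simp add: y_def slant_proj_def inner_add_right n0)
    have foot: "y + s *\<^sub>R e' - ((y + s *\<^sub>R e') \<bullet> e') *\<^sub>R e' = y - (y \<bullet> e') *\<^sub>R e'"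
      by (simp add: inner_add_left ee algebra_simps)
    have "(y + s *\<^sub>R e') \<bullet> e' = g (y - (y \<bullet> e') *\<^sub>R e')"
      using x(2) unfolding mem_Collect_eq sl foot .
    also have "\<dots> = y \<bullet> e'"
      using x(1) unfolding mem_Collect_eq y_def[symmetric] by (rule sym)
    finally have "(y + s *\<^sub>R e') \<bullet> e' = y \<bullet> e'" .
    then show "s = 0" by (simp add: inner_add_left ee)
  qed
  moreover have "?F (slant_proj n c e x)" if "x \<in> ?N \<inter> ?V" for x
    using that opn by (intro rel_frontier_on_graph[OF _ U(1) contg sub]) (auto simp: affine_hull_eq_plane)
  then have "?N \<inter> ?V \<subseteq> ?A" by blast
  ultimately have "negligible (?N \<inter> ?V)"
    by (rule negligible_subset)
  then show "\<exists>W. openin (top_of_set ?N) W \<and> z \<in> W \<and> negligible W"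
    using z U(2) V by (intro exI[of _ "?N \<inter> ?V"]) (auto simp: openin_open_Int)
qed

text \<open>For \<open>e\<close> transversal to the face, the set swept by \<open>\<sigma>\<close>
  when moved by \<open>s e\<close> with \<open>0 \<le> s \<le> t\<close>, see
  \<open>prism_iff\<close>; the form by height and foot is the one whose volume is known.\<close>

definition prism :: "'a \<Rightarrow> real \<Rightarrow> 'a set" where
  "prism e t = {z. (n \<bullet> z - c) / (n \<bullet> e) \<in> {0..t} \<and> slant_proj n c e z \<in> \<sigma>}"

lemma prism_iff:
  assumes ne: "n \<bullet> e \<noteq> 0"
  shows "z \<in> prism e t \<longleftrightarrow> (\<exists>s\<in>{0..t}. z - s *\<^sub>R e \<in> \<sigma>)"
proof
  assume "z \<in> prism e t"
  then show "\<exists>s\<in>{0..t}. z - s *\<^sub>R e \<in> \<sigma>"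
    by (intro bexI[of _ "(n \<bullet> z - c) / (n \<bullet> e)"]) (auto simp: prism_def slant_proj_def)
next
  assume "\<exists>s\<in>{0..t}. z - s *\<^sub>R e \<in> \<sigma>"
  then obtain s where s: "s \<in> {0..t}" "z - s *\<^sub>R e \<in> \<sigma>" by blast
  from on_plane[OF s(2)] have "n \<bullet> z - c = s * (n \<bullet> e)" by (simp add: inner_diff_right)
  then show "z \<in> prism e t" using s ne by (simp add: prism_def slant_proj_def)
qed

lemma prism_borel: "prism e t \<in> sets borel"
proof -
  have [measurable]: "\<sigma> \<in> sets borel" by (rule borel)
  show ?thesis unfolding prism_def by measurable
qed

lemma bounded_prism:
  assumes ne: "n \<bullet> e \<noteq> 0" shows "bounded (prism e t)"
proof -
  obtain R where R: "\<And>x. x \<in> \<sigma> \<Longrightarrow> norm x \<le> R"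
    using bnd by (auto simp: bounded_iff)
  have "norm z \<le> R + \<bar>t\<bar> * norm e" if "z \<in> prism e t" for z
  proof -
    obtain s where s: "s \<in> {0..t}" "z - s *\<^sub>R e \<in> \<sigma>" using \<open>z \<in> prism e t\<close> prism_iff[OF ne] by blast
    have "norm z \<le> norm (z - s *\<^sub>R e) + norm (s *\<^sub>R e)"
      using norm_triangle_ineq[of "z - s *\<^sub>R e" "s *\<^sub>R e"] by simp
    also have "\<dots> \<le> R + \<bar>t\<bar> * norm e"
      using R[OF s(2)] s(1) by (auto intro!: add_mono mult_right_mono)
    finally show ?thesis .
  qed
  then show ?thesis by (auto simp: bounded_iff)
qed

lemma integrable_prism:
  assumes ne: "n \<bullet> e \<noteq> 0" and q: "continuous_on UNIV q"
  shows "integrable lborel (\<lambda>z. indicat_real (prism e t) z * q z)"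
proof (rule integrable_mult_continuous[OF _ _ q])
  show "integrable lborel (indicat_real (prism e t))"
    using prism_borel emeasure_bounded_finite[OF bounded_prism[OF ne]]
    by (intro integrable_real_indicator) (auto simp: less_top)
  show "bounded {x. indicat_real (prism e t) x \<noteq> 0}"
    by (rule bounded_subset[OF bounded_prism[OF ne]]) (auto simp: indicator_def)
qed

lemma integral_prism_slant:
  assumes ne: "n \<bullet> e \<noteq> 0" and t: "0 \<le> t" and q: "continuous_on UNIV (q :: 'a \<Rightarrow> real)"
  shows "(LINT z|lborel. indicator (prism e t) z * q (slant_proj n c e z))
    = t * \<bar>n \<bullet> e\<bar> * (LINT x|face_measure \<sigma>. q x)"
proof -
  have [measurable]: "\<sigma> \<in> sets borel" by (rule borel)
  have [measurable]: "q \<in> borel_measurable borel" by (rule borel_measurable_continuous_onI[OF q])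
  have "(LINT z|lborel. indicator (prism e t) z * q (slant_proj n c e z))
      = (LINT z|lborel. indicator {z. (n \<bullet> z - c) / (n \<bullet> e) \<in> {0..t}} z *
          (indicator \<sigma> (slant_proj n c e z) * q (slant_proj n c e z)))"
    by (intro Bochner_Integration.integral_cong) (auto simp: prism_def indicator_def)
  also have "\<dots> = t * \<bar>n \<bullet> e\<bar> * (LINT x|hyperplane_measure {x. n \<bullet> x = c}. indicator \<sigma> x * q x)"
    by (rule integral_prism[OF norm_n ne t]) measurable
  finally show ?thesis by (simp add: integral_face_measure)
qed

text \<open>By uniform continuity \<open>q\<close> at a point of a thin prism is close to
  \<open>q\<close> at its foot, and for functions of the foot the formula holds exactly, by
  \<open>integral_prism_slant\<close>.\<close>

lemma integral_prism_limit:
  assumes ne: "n \<bullet> e \<noteq> 0" and q: "continuous_on UNIV (q :: 'a \<Rightarrow> real)"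
  shows "((\<lambda>t. (LINT z|lborel. indicator (prism e t) z * q z) / t)
    \<longlongrightarrow> \<bar>n \<bullet> e\<bar> * (LINT x|face_measure \<sigma>. q x)) (at_right 0)"
proof (rule tendstoI)
  fix \<epsilon> :: real assume "\<epsilon> > 0"
  \<comment> \<open>The volume of the prism per unit of \<open>t\<close>.\<close>
  define A where "A = \<bar>n \<bullet> e\<bar> * (LINT x|face_measure \<sigma>. 1)"
  have A0: "0 \<le> A" by (simp add: A_def)
  define \<eta> where "\<eta> = \<epsilon> / (A + 1)"
  have \<eta>: "\<eta> > 0" using \<open>\<epsilon> > 0\<close> A0 by (simp add: \<eta>_def add_nonneg_pos)
  let ?C = "closure \<sigma> \<union> closure (prism e 1)"
  have "compact ?C"
    using bnd bounded_prism[OF ne] by (intro compact_Un) (auto simp: compact_closure)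
  then have "uniformly_continuous_on ?C q"
    using q by (intro compact_uniformly_continuous) (auto intro: continuous_on_subset)
  then obtain d where d: "d > 0" "\<And>x y. x \<in> ?C \<Longrightarrow> y \<in> ?C \<Longrightarrow> dist y x < d \<Longrightarrow> dist (q y) (q x) < \<eta>"
    using \<eta> unfolding uniformly_continuous_on_def by metis
  \<comment> \<open>The bound 1 keeps all prisms in one compact set; the other keeps their points
    within \<open>d\<close> of the feet.\<close>
  define b where "b = min 1 (d / (1 + norm e))"
  have b: "b > 0" using d by (simp add: b_def add_pos_nonneg)
  have "dist ((LINT z|lborel. indicator (prism e t) z * q z) / t)
      (\<bar>n \<bullet> e\<bar> * (LINT x|face_measure \<sigma>. q x)) < \<epsilon>" if t: "0 < t" "t < b" for t
  proof -
    let ?P = "prism e t" and ?p = "slant_proj n c e"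
    have qp: "continuous_on UNIV (\<lambda>z. q (?p z))"
      by (rule continuous_on_compose2[OF q continuous_on_slant_proj]) auto
    have close: "\<bar>q z - q (?p z)\<bar> \<le> \<eta>" if z: "z \<in> ?P" for z
    proof -
      obtain s where s: "s \<in> {0..t}" "z - s *\<^sub>R e \<in> \<sigma>" using z prism_iff[OF ne] by blast
      have p: "?p z = z - s *\<^sub>R e"
        using slant_proj_line[OF ne, of z "- s"] on_plane[OF s(2)] by simp
      have "z \<in> prism e 1"
        using s t by (auto simp: prism_iff[OF ne] b_def intro!: bexI[of _ s])
      then have "z \<in> ?C" "?p z \<in> ?C"
        using s(2) closure_subset by (auto simp: p subset_iff)
      moreover have "dist z (?p z) < d"
      proof -
        have pos: "1 + norm e > 0" by (simp add: add_pos_nonneg)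
        have "dist z (?p z) = s * norm e" using s(1) by (simp add: p dist_norm)
        also have "\<dots> \<le> t * (1 + norm e)" using s(1) by (intro mult_mono) auto
        also have "\<dots> < d" using t(2) pos by (simp add: b_def pos_less_divide_eq)
        finally show ?thesis .
      qed
      ultimately show ?thesis using d(2)[of "?p z" z] by (auto simp: dist_real_def)
    qed
    have "\<bar>(LINT z|lborel. indicator ?P z * q z) - t * (\<bar>n \<bullet> e\<bar> * (LINT x|face_measure \<sigma>. q x))\<bar>
        = \<bar>(LINT z|lborel. indicator ?P z * q z - indicator ?P z * q (?p z))\<bar>"
      using integral_prism_slant[OF ne less_imp_le[OF t(1)] q]
      by (subst Bochner_Integration.integral_diff) (auto intro!: integrable_prism[OF ne] q qp)
    also have "\<dots> \<le> (LINT z|lborel. indicator ?P z * \<eta>)"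
    proof (rule Bochner_Integration.integral_norm_bound_integral[of lborel "\<lambda>z. indicator ?P z * q z - indicator ?P z * q (?p z)", unfolded real_norm_def])
      show "\<bar>indicator ?P z * q z - indicator ?P z * q (?p z)\<bar> \<le> indicator ?P z * \<eta>" for z
        using close[of z] by (auto simp: indicator_def)
      show "integrable lborel (\<lambda>z. indicator ?P z * \<eta>)"
        by (rule integrable_prism[OF ne]) simp
    qed (auto intro!: integrable_prism[OF ne] q qp Bochner_Integration.integrable_diff)
    also have "\<dots> = t * (\<bar>n \<bullet> e\<bar> * (LINT x|face_measure \<sigma>. \<eta>))"
      using integral_prism_slant[OF ne less_imp_le[OF t(1)], of "\<lambda>_. \<eta>"] by simp
    also have "\<dots> = t * (\<eta> * A)" by (simp add: A_def)
    finally have "\<bar>(LINT z|lborel. indicator ?P z * q z) - t * (\<bar>n \<bullet> e\<bar> * (LINT x|face_measure \<sigma>. q x))\<bar> \<le> t * (\<eta> * A)" .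
    then have "\<bar>(LINT z|lborel. indicator ?P z * q z) - t * (\<bar>n \<bullet> e\<bar> * (LINT x|face_measure \<sigma>. q x))\<bar> / t \<le> \<eta> * A"
      using t(1) by (simp add: divide_le_eq mult.commute)
    moreover have "(LINT z|lborel. indicator ?P z * q z) / t - \<bar>n \<bullet> e\<bar> * (LINT x|face_measure \<sigma>. q x)
        = ((LINT z|lborel. indicator ?P z * q z) - t * (\<bar>n \<bullet> e\<bar> * (LINT x|face_measure \<sigma>. q x))) / t"
      using t(1) by (simp add: diff_divide_distrib)
    moreover have "\<eta> * A < \<epsilon>"
    proof -
      have "\<eta> * A < \<eta> * (A + 1)" using \<eta> by simp
      also have "\<dots> = \<epsilon>" using A0 by (simp add: \<eta>_def)
      finally show ?thesis .
    qed
    ultimately show ?thesis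
      using t(1) by (simp add: dist_real_def abs_divide)
  qed
  then show "\<forall>\<^sub>F t in at_right 0. dist ((LINT z|lborel. indicator (prism e t) z * q z) / t)
      (\<bar>n \<bullet> e\<bar> * (LINT x|face_measure \<sigma>. q x)) < \<epsilon>"
    using b by (auto simp: eventually_at_right[OF zero_less_one])
qed

end

text \<open>A cell with chosen outward unit normals \<open>N\<close> and plane offsets
  \<open>c\<close>, so that the divergence theorem is proved for explicit data and not for the
  description in \<open>outward_normal\<close>.\<close>

locale flat_cell =
  fixes K :: "'a::euclidean_space set" and F :: "'a set set" and N :: "'a set \<Rightarrow> 'a" and c :: "'a set \<Rightarrow> real"
  assumes open_K: "open K" and bounded_K: "bounded K" and finite_F: "finite F" and disjoint_F: "disjoint F"
    and frontier_K: "frontier K = (\<Union>\<sigma>\<in>F. closure \<sigma>)"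
    and face: "\<And>\<sigma>. \<sigma> \<in> F \<Longrightarrow> flat_face \<sigma> (N \<sigma>) (c \<sigma>)"
    and lipschitz_face: "\<And>\<sigma>. \<sigma> \<in> F \<Longrightarrow> lipschitz_boundary \<sigma>"
    and halfspace: "\<And>\<sigma> x. \<lbrakk>\<sigma> \<in> F; x \<in> \<sigma>\<rbrakk> \<Longrightarrow> halfspace_at K \<sigma> (N \<sigma>) x"
begin

lemma face_in_frontier: "\<sigma> \<in> F \<Longrightarrow> \<sigma> \<subseteq> frontier K"
  using frontier_K closure_subset by blast

lemma face_disjoint_K: "\<sigma> \<in> F \<Longrightarrow> x \<in> \<sigma> \<Longrightarrow> x \<notin> K"
  using face_in_frontier open_K frontier_disjoint_eq[of K] by blast

lemma same_face: "\<lbrakk>\<sigma> \<in> F; \<tau> \<in> F; x \<in> \<sigma>; x \<in> \<tau>\<rbrakk> \<Longrightarrow> \<sigma> = \<tau>"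
  using disjoint_F by (auto simp: disjoint_def)

lemma negligible_frontier: "negligible (frontier K)"
proof -
  have "negligible (closure \<sigma>)" if "\<sigma> \<in> F" for \<sigma>
  proof -
    interpret flat_face \<sigma> "N \<sigma>" "c \<sigma>" by (rule face[OF that])
    have "closure \<sigma> \<subseteq> {x. N \<sigma> \<bullet> x = c \<sigma>}"
      using on_plane closed_hyperplane by (intro closure_minimal) auto
    moreover have "N \<sigma> \<noteq> 0" using norm_n by auto
    ultimately show ?thesis using negligible_hyperplane negligible_subset by blast
  qed
  then show ?thesis unfolding frontier_K using finite_F by (intro negligible_Union) auto
qed

text \<open>Bisection: the change of the indicator of \<open>K\<close> along a segment and the signed number of faces
  crossed are additive, and agree on short segments.  At a crossing point the indicator is
  replaced by its value just after the crossing.\<close>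

lemma crossing_count:
  assumes trans: "\<And>\<sigma>. \<sigma> \<in> F \<Longrightarrow> N \<sigma> \<bullet> e \<noteq> 0"
    and avoid: "\<And>\<sigma> s. \<sigma> \<in> F \<Longrightarrow> z + s *\<^sub>R e \<notin> rel_frontier \<sigma>"
    and t: "0 \<le> t" and ends: "z \<notin> frontier K" "z + t *\<^sub>R e \<notin> frontier K"
  shows "indicator K (z + t *\<^sub>R e) - indicator K z
    = - (\<Sum>\<sigma>\<in>F. sgn (N \<sigma> \<bullet> e) * of_bool (\<exists>s\<in>{0..t}. z + s *\<^sub>R e \<in> \<sigma>) :: real)"
proof -
  define l where "l s = z + s *\<^sub>R e" for s
  define k :: "real \<Rightarrow> real" where "k s = of_bool (l s \<in> K \<or> (\<exists>\<sigma>\<in>F. l s \<in> \<sigma> \<and> N \<sigma> \<bullet> e < 0))" for s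
  \<comment> \<open>The intervals are half-open so that counts over adjacent intervals add up
    without double counting.\<close>
  define C :: "'a set \<Rightarrow> real \<Rightarrow> real \<Rightarrow> real" where "C \<sigma> u u' = of_bool (\<exists>s\<in>{u<..u'}. l s \<in> \<sigma>)" for \<sigma> u u'
  have once: "s = s'" if "\<sigma> \<in> F" "l s \<in> \<sigma>" "l s' \<in> \<sigma>" for \<sigma> s s'
  proof -
    interpret flat_face \<sigma> "N \<sigma>" "c \<sigma>" by (rule face[OF that(1)])
    have "N \<sigma> \<bullet> l s = N \<sigma> \<bullet> l s'" using on_plane that by simp
    then show ?thesis using trans[OF that(1)] by (simp add: l_def inner_add_right)
  qed
  \<comment> \<open>The frontier is covered by closures of faces only; on a line that avoids the
    relative frontiers, the faces themselves cover it.\<close>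
  have on_face: "\<exists>\<sigma>\<in>F. l s \<in> \<sigma>" if "l s \<in> frontier K" for s
  proof -
    obtain \<sigma> where \<sigma>: "\<sigma> \<in> F" "l s \<in> closure \<sigma>" using \<open>l s \<in> frontier K\<close> frontier_K by blast
    interpret flat_face \<sigma> "N \<sigma>" "c \<sigma>" by (rule face[OF \<sigma>(1)])
    have "rel_interior \<sigma> = \<sigma>" using rel_interior_eq opn affine_hull_eq_plane by metis
    then have "l s \<in> \<sigma>" using \<sigma> avoid[OF \<sigma>(1), of s] by (auto simp: rel_frontier_def l_def)
    then show ?thesis using \<sigma>(1) by blast
  qed
  have contl: "continuous_on UNIV l" unfolding l_def by (intro continuous_intros)
  have "k t - k 0 = - (\<Sum>\<sigma>\<in>F. sgn (N \<sigma> \<bullet> e) * C \<sigma> 0 t)"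
    using t
  proof (induction rule: Bolzano)
    case (trans a b c)
    have "C \<sigma> a b + C \<sigma> b c = C \<sigma> a c" if "\<sigma> \<in> F" for \<sigma>
    proof -
      have "{a<..c} = {a<..b} \<union> {b<..c}" using trans(3,4) by auto
      then have "(\<exists>s\<in>{a<..c}. l s \<in> \<sigma>) \<longleftrightarrow> (\<exists>s\<in>{a<..b}. l s \<in> \<sigma>) \<or> (\<exists>s\<in>{b<..c}. l s \<in> \<sigma>)"
        by (simp only: bex_Un)
      moreover have "\<not> ((\<exists>s\<in>{a<..b}. l s \<in> \<sigma>) \<and> (\<exists>s\<in>{b<..c}. l s \<in> \<sigma>))"
      proof
        assume "(\<exists>s\<in>{a<..b}. l s \<in> \<sigma>) \<and> (\<exists>s\<in>{b<..c}. l s \<in> \<sigma>)"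
        then obtain s s' where "s \<le> b" "b < s'" "l s \<in> \<sigma>" "l s' \<in> \<sigma>" by auto
        then show False using once[OF that, of s s'] by simp
      qed
      ultimately show ?thesis by (auto simp: C_def)
    qed
    then have "(\<Sum>\<sigma>\<in>F. sgn (N \<sigma> \<bullet> e) * C \<sigma> a c)
        = (\<Sum>\<sigma>\<in>F. sgn (N \<sigma> \<bullet> e) * C \<sigma> a b) + (\<Sum>\<sigma>\<in>F. sgn (N \<sigma> \<bullet> e) * C \<sigma> b c)"
      by (subst sum.distrib[symmetric]) (auto intro!: sum.cong simp: distrib_left[symmetric])
    then show ?case using trans(1,2) by simp
  next
    case (local x)
    have near: "\<exists>d>0. \<forall>u. \<bar>u - x\<bar> < d \<longrightarrow> l u \<in> W" if W: "open W" "l x \<in> W" for W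
    proof -
      have "open (l -` W)" using W(1) contl by (rule open_vimage)
      moreover have "x \<in> l -` W" using W(2) by simp
      ultimately obtain d where "d > 0" "ball x d \<subseteq> l -` W" by (rule openE)
      then show ?thesis by (intro exI[of _ d]) (auto simp: dist_real_def abs_minus_commute subset_iff)
    qed
    consider "l x \<in> K" | "l x \<notin> closure K" | "l x \<in> frontier K"
      using open_K by (auto simp: frontier_def interior_open)
    then show ?case
    proof cases
      case 1
      then obtain d where d: "d > 0" "\<And>u. \<bar>u - x\<bar> < d \<Longrightarrow> l u \<in> K" using near[OF open_K] by blast
      have "k b - k a = - (\<Sum>\<sigma>\<in>F. sgn (N \<sigma> \<bullet> e) * C \<sigma> a b)" if "a \<le> x" "x \<le> b" "b - a < d" for a b
      proof -
        have *: "l u \<in> K" if "u \<in> {a..b}" for u using d(2) that \<open>a \<le> x\<close> \<open>x \<le> b\<close> \<open>b - a < d\<close> by auto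
        then have **: "l u \<notin> \<sigma>" if "u \<in> {a..b}" "\<sigma> \<in> F" for u \<sigma>
          using that face_disjoint_K by blast
        have "k a = 1" "k b = 1" "\<And>\<sigma>. \<sigma> \<in> F \<Longrightarrow> C \<sigma> a b = 0"
          using that * ** by (auto simp: k_def C_def)
        then show ?thesis by simp
      qed
      then show ?thesis using d(1) by blast
    next
      case 2
      then obtain d where d: "d > 0" "\<And>u. \<bar>u - x\<bar> < d \<Longrightarrow> l u \<notin> closure K"
        using near[of "- closure K"] by auto
      have "k b - k a = - (\<Sum>\<sigma>\<in>F. sgn (N \<sigma> \<bullet> e) * C \<sigma> a b)" if "a \<le> x" "x \<le> b" "b - a < d" for a b
      proof -
        have *: "l u \<notin> closure K" if "u \<in> {a..b}" for u using d(2) that \<open>a \<le> x\<close> \<open>x \<le> b\<close> \<open>b - a < d\<close> by auto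
        moreover have "\<sigma> \<subseteq> closure K" if "\<sigma> \<in> F" for \<sigma>
          using face_in_frontier[OF that] by (auto simp: frontier_def)
        ultimately have **: "l u \<notin> K" "\<And>\<sigma>. \<sigma> \<in> F \<Longrightarrow> l u \<notin> \<sigma>" if "u \<in> {a..b}" for u
          using that closure_subset[of K] by blast+
        have "k a = 0" "k b = 0" "\<And>\<sigma>. \<sigma> \<in> F \<Longrightarrow> C \<sigma> a b = 0"
          using that ** by (auto simp: k_def C_def)
        then show ?thesis by simp
      qed
      then show ?thesis using d(1) by blast
    next
      case 3
      then obtain \<sigma> where \<sigma>: "\<sigma> \<in> F" "l x \<in> \<sigma>" using on_face by blast
      obtain r where r: "r > 0" "\<And>y. y \<in> ball (l x) r \<Longrightarrow> (y \<in> K \<longleftrightarrow> N \<sigma> \<bullet> (y - l x) < 0) \<and> (y \<in> \<sigma> \<longleftrightarrow> N \<sigma> \<bullet> (y - l x) = 0)"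
        using halfspace[OF \<sigma>] unfolding halfspace_at_def by blast
      obtain d where d: "d > 0" "\<And>u. \<bar>u - x\<bar> < d \<Longrightarrow> l u \<in> ball (l x) r"
        using near[of "ball (l x) r"] r(1) by auto
      have ip: "N \<sigma> \<bullet> (l u - l x) = (u - x) * (N \<sigma> \<bullet> e)" for u
        by (simp add: l_def inner_diff_right inner_add_right algebra_simps)
      have inK: "l u \<in> K \<longleftrightarrow> (u - x) * (N \<sigma> \<bullet> e) < 0" if "\<bar>u - x\<bar> < d" for u
        using r(2)[OF d(2)[OF that]] ip by simp
      \<comment> \<open>Near the crossing only \<open>\<sigma>\<close> is met, and only at
        \<open>x\<close>: on one side the line is inside \<open>K\<close>, on the other it is not
        even in the closure of \<open>K\<close>, whereas every face lies in the frontier.\<close>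
      have in\<tau>: "l u \<in> \<tau> \<longleftrightarrow> \<tau> = \<sigma> \<and> u = x" if "\<bar>u - x\<bar> < d" "\<tau> \<in> F" for u \<tau>
      proof
        assume u: "l u \<in> \<tau>"
        then have fr: "l u \<in> frontier K" using face_in_frontier that(2) by blast
        have "\<not> (u - x) * (N \<sigma> \<bullet> e) < 0" using inK[OF that(1)] face_disjoint_K[OF that(2) u] by simp
        moreover have "\<not> (u - x) * (N \<sigma> \<bullet> e) > 0"
        proof
          assume pos: "(u - x) * (N \<sigma> \<bullet> e) > 0"
          let ?W = "ball (l x) r \<inter> {y. N \<sigma> \<bullet> (y - l x) > 0}"
          have "open ?W" by (intro open_Int open_ball open_Collect_less continuous_intros)
          moreover have "l u \<in> ?W" using d(2)[OF that(1)] pos ip by simp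
          moreover have "?W \<inter> K = {}" using r(2) by fastforce
          ultimately have "l u \<notin> closure K" using open_Int_closure_eq_empty[of ?W K] by blast
          then show False using fr by (auto simp: frontier_def)
        qed
        ultimately have "u = x" using trans[OF \<sigma>(1)] by (auto simp: not_less antisym_conv)
        then show "\<tau> = \<sigma> \<and> u = x" using same_face[OF that(2) \<sigma>(1)] u \<sigma>(2) by simp
      qed (use \<sigma> in simp)
      have "k b - k a = - (\<Sum>\<tau>\<in>F. sgn (N \<tau> \<bullet> e) * C \<tau> a b)" if ab: "a \<le> x" "x \<le> b" "b - a < d" for a b
      proof -
        have d': "\<bar>u - x\<bar> < d" if "u \<in> {a..b}" for u using ab that by auto
        have "C \<tau> a b = of_bool (\<tau> = \<sigma> \<and> a < x)" if "\<tau> \<in> F" for \<tau>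
        proof -
          have "l s \<in> \<tau> \<longleftrightarrow> \<tau> = \<sigma> \<and> s = x" if "s \<in> {a<..b}" for s
            using in\<tau>[OF d' \<open>\<tau> \<in> F\<close>] that by auto
          then have "(\<exists>s\<in>{a<..b}. l s \<in> \<tau>) \<longleftrightarrow> \<tau> = \<sigma> \<and> a < x" using ab by auto
          then show ?thesis by (simp add: C_def)
        qed
        then have "(\<Sum>\<tau>\<in>F. sgn (N \<tau> \<bullet> e) * C \<tau> a b) = (\<Sum>\<tau>\<in>F. if \<tau> = \<sigma> then sgn (N \<sigma> \<bullet> e) * of_bool (a < x) else 0)"
          by (intro sum.cong) auto
        also have "\<dots> = sgn (N \<sigma> \<bullet> e) * of_bool (a < x)" using \<sigma>(1) finite_F by simp
        finally have sum: "(\<Sum>\<tau>\<in>F. sgn (N \<tau> \<bullet> e) * C \<tau> a b) = sgn (N \<sigma> \<bullet> e) * of_bool (a < x)" .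
        have k: "k u = of_bool ((u - x) * (N \<sigma> \<bullet> e) < 0 \<or> u = x \<and> N \<sigma> \<bullet> e < 0)" if "u \<in> {a..b}" for u
        proof -
          have "(\<exists>\<tau>\<in>F. l u \<in> \<tau> \<and> N \<tau> \<bullet> e < 0) \<longleftrightarrow> u = x \<and> N \<sigma> \<bullet> e < 0"
            using in\<tau>[OF d'[OF that]] \<sigma>(1) by auto
          then show ?thesis using inK[OF d'[OF that]] by (simp add: k_def)
        qed
        have kab: "k a = of_bool ((a - x) * (N \<sigma> \<bullet> e) < 0 \<or> a = x \<and> N \<sigma> \<bullet> e < 0)"
          "k b = of_bool ((b - x) * (N \<sigma> \<bullet> e) < 0 \<or> b = x \<and> N \<sigma> \<bullet> e < 0)"
          using k ab by auto
        show ?thesis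
          unfolding sum kab using trans[OF \<sigma>(1)] ab(1,2)
          by (cases "N \<sigma> \<bullet> e > 0") (auto simp: mult_less_0_iff not_less)
      qed
      then show ?thesis using d(1) by blast
    qed
  qed
  moreover have "k 0 = indicator K z" "k t = indicator K (z + t *\<^sub>R e)"
    using ends face_in_frontier by (auto simp: k_def l_def indicator_def)
  \<comment> \<open>The starting point is on no face, so the half-open count equals the closed
    one.\<close>
  moreover have "C \<sigma> 0 t = of_bool (\<exists>s\<in>{0..t}. z + s *\<^sub>R e \<in> \<sigma>)" if "\<sigma> \<in> F" for \<sigma>
  proof -
    have "z \<notin> \<sigma>" using ends(1) face_in_frontier[OF that] by blast
    then have "(\<exists>s\<in>{0<..t}. l s \<in> \<sigma>) \<longleftrightarrow> (\<exists>s\<in>{0..t}. z + s *\<^sub>R e \<in> \<sigma>)"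
      unfolding l_def by (metis add.right_neutral atLeastAtMost_iff greaterThanAtMost_iff less_eq_real_def scaleR_zero_left)
    then show ?thesis by (simp add: C_def)
  qed
  ultimately show ?thesis by simp
qed

lemma gauss_generic:
  fixes p :: "'a \<Rightarrow> real"
  assumes p: "C1_fun p" and trans: "\<And>\<sigma>. \<sigma> \<in> F \<Longrightarrow> N \<sigma> \<bullet> e \<noteq> 0"
  shows "(LINT z|lborel. indicator K z * frechet_derivative p (at z) e)
    = (\<Sum>\<sigma>\<in>F. (N \<sigma> \<bullet> e) * (LINT x|face_measure \<sigma>. p x))"
proof -
  define P where "P \<sigma> t = flat_face.prism \<sigma> (N \<sigma>) (c \<sigma>) e t" for \<sigma> t
  have K[measurable]: "K \<in> sets borel" using open_K by auto
  have intK: "integrable lborel (indicat_real K)"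
    using emeasure_bounded_finite[OF bounded_K] by (intro integrable_real_indicator) (auto simp: less_top)
  have bK: "bounded {x. indicat_real K x \<noteq> 0}"
    by (rule bounded_subset[OF bounded_K]) (auto simp: indicator_def)
  have cont: "continuous_on UNIV p" by (rule C1_fun_continuous[OF p])
  define \<Phi> where "\<Phi> t = (LINT z|lborel. indicator K z * p (z + t *\<^sub>R e))" for t
  have intP: "integrable lborel (\<lambda>w. indicator (P \<sigma> t) w * p w)" if "\<sigma> \<in> F" for \<sigma> t
    unfolding P_def by (rule flat_face.integrable_prism[OF face[OF that] trans[OF that] cont])
  have P_iff: "w \<in> P \<sigma> t \<longleftrightarrow> (\<exists>s\<in>{0..t}. w - s *\<^sub>R e \<in> \<sigma>)" if "\<sigma> \<in> F" for \<sigma> t w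
    unfolding P_def by (rule flat_face.prism_iff[OF face[OF that] trans[OF that]])
  \<comment> \<open>Once the shift is moved onto the indicator, the increment is the integral of
    \<open>p\<close> against the change of the indicator along \<open>e\<close>, which
    \<open>crossing_count\<close> expresses by the prisms.\<close>
  have diff: "\<Phi> t - \<Phi> 0 = (\<Sum>\<sigma>\<in>F. sgn (N \<sigma> \<bullet> e) * (LINT w|lborel. indicator (P \<sigma> t) w * p w))" if t: "0 \<le> t" for t
  proof -
    have "negligible (\<Union>\<sigma>\<in>F. {z. slant_proj (N \<sigma>) (c \<sigma>) e z \<in> rel_frontier \<sigma>})"
      using finite_F flat_face.negligible_rel_frontier_cylinder[OF face trans lipschitz_face]
      by (intro negligible_Union) auto
    then have ae1: "AE z in lebesgue. z \<notin> (\<Union>\<sigma>\<in>F. {z. slant_proj (N \<sigma>) (c \<sigma>) e z \<in> rel_frontier \<sigma>})"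
      unfolding negligible_iff_null_sets by (rule AE_not_in)
    have ae2: "AE z in lebesgue. z \<notin> frontier K"
      using negligible_frontier unfolding negligible_iff_null_sets by (rule AE_not_in)
    then have "AE z in lborel. z \<notin> frontier K" by (simp add: AE_completion_iff)
    then have "AE z in lborel. (t *\<^sub>R e + z) - t *\<^sub>R e \<notin> frontier K" by simp
    then have ae3: "AE w in lborel. w - t *\<^sub>R e \<notin> frontier K"
      by (rule AE_lborel_translate)
    have ae: "AE w in lborel. indicator K w - indicator K (w - t *\<^sub>R e)
        = - (\<Sum>\<sigma>\<in>F. sgn (N \<sigma> \<bullet> e) * indicator (P \<sigma> t) w :: real)"
      using ae1[unfolded AE_completion_iff] ae2[unfolded AE_completion_iff] ae3
    proof eventually_elim
      case (elim w)
      define z where "z = w - t *\<^sub>R e"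
      have w: "w = z + t *\<^sub>R e" by (simp add: z_def)
      have avoid: "z + s *\<^sub>R e \<notin> rel_frontier \<sigma>" if "\<sigma> \<in> F" for \<sigma> s
      proof
        assume s: "z + s *\<^sub>R e \<in> rel_frontier \<sigma>"
        interpret flat_face \<sigma> "N \<sigma>" "c \<sigma>" by (rule face[OF that])
        have "closure \<sigma> \<subseteq> {x. N \<sigma> \<bullet> x = c \<sigma>}"
          using on_plane closed_hyperplane by (intro closure_minimal) auto
        then have "w + (s - t) *\<^sub>R e \<in> {x. N \<sigma> \<bullet> x = c \<sigma>}"
          using s by (auto simp: rel_frontier_def w algebra_simps)
        from slant_proj_line[OF trans[OF that] this]
        have "slant_proj (N \<sigma>) (c \<sigma>) e w = z + s *\<^sub>R e" by (simp add: w algebra_simps)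
        then show False using elim(1) s that by auto
      qed
      \<comment> \<open>Crossings are counted forwards from \<open>z\<close>, membership in a prism
        backwards from \<open>w\<close>, whence the change from \<open>s\<close> to
        \<open>t - s\<close>.\<close>
      have "(\<exists>s\<in>{0..t}. z + s *\<^sub>R e \<in> \<sigma>) \<longleftrightarrow> w \<in> P \<sigma> t" if "\<sigma> \<in> F" for \<sigma>
      proof -
        have "z + s *\<^sub>R e = w - (t - s) *\<^sub>R e" for s by (simp add: z_def algebra_simps)
        then have "(\<exists>s\<in>{0..t}. z + s *\<^sub>R e \<in> \<sigma>) \<longleftrightarrow> (\<exists>s\<in>{0..t}. w - (t - s) *\<^sub>R e \<in> \<sigma>)" by simp
        also have "\<dots> \<longleftrightarrow> (\<exists>s\<in>{0..t}. w - s *\<^sub>R e \<in> \<sigma>)"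
        proof
          assume "\<exists>s\<in>{0..t}. w - (t - s) *\<^sub>R e \<in> \<sigma>"
          then obtain s where "s \<in> {0..t}" "w - (t - s) *\<^sub>R e \<in> \<sigma>" by blast
          then show "\<exists>s\<in>{0..t}. w - s *\<^sub>R e \<in> \<sigma>" by (intro bexI[of _ "t - s"]) auto
        next
          assume "\<exists>s\<in>{0..t}. w - s *\<^sub>R e \<in> \<sigma>"
          then obtain s where "s \<in> {0..t}" "w - s *\<^sub>R e \<in> \<sigma>" by blast
          then show "\<exists>s\<in>{0..t}. w - (t - s) *\<^sub>R e \<in> \<sigma>" by (intro bexI[of _ "t - s"]) auto
        qed
        finally show ?thesis using P_iff[OF that] by simp
      qed
      then show ?case
        using crossing_count[OF trans avoid t] elim(2,3)
        by (simp add: z_def[symmetric] w[symmetric] indicator_def cong: sum.cong)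
    qed
    have [measurable]: "p \<in> borel_measurable borel" by (rule borel_measurable_continuous_onI[OF cont])
    have [measurable]: "P \<sigma> t \<in> sets borel" if "\<sigma> \<in> F" for \<sigma>
      unfolding P_def by (rule flat_face.prism_borel[OF face[OF that]])
    have iK: "integrable lborel (\<lambda>w. indicator K w * p w)"
      by (rule integrable_mult_continuous[OF intK bK cont])
    have iKt0: "integrable lborel (\<lambda>w. indicator K w * p (w + t *\<^sub>R e))"
      by (rule integrable_mult_continuous[OF intK bK C1_fun_continuous[OF C1_fun_translate[OF p]]])
    from integrable_lborel_translate[OF this, of "- (t *\<^sub>R e)"]
    have iKt: "integrable lborel (\<lambda>w. indicator K (w - t *\<^sub>R e) * p w)" by simp
    have "\<Phi> t = (LINT w|lborel. indicator K (w - t *\<^sub>R e) * p w)"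
      unfolding \<Phi>_def using integral_lborel_translate[of "\<lambda>w. indicator K w * p (w + t *\<^sub>R e)" "- (t *\<^sub>R e)"]
      by simp
    then have "\<Phi> t - \<Phi> 0 = (LINT w|lborel. indicator K (w - t *\<^sub>R e) * p w - indicator K w * p w)"
      using iK iKt by (simp add: \<Phi>_def)
    also have "\<dots> = (LINT w|lborel. (\<Sum>\<sigma>\<in>F. sgn (N \<sigma> \<bullet> e) * (indicator (P \<sigma> t) w * p w)))"
    proof (rule integral_cong_AE)
      show "AE w in lborel. indicator K (w - t *\<^sub>R e) * p w - indicator K w * p w
          = (\<Sum>\<sigma>\<in>F. sgn (N \<sigma> \<bullet> e) * (indicator (P \<sigma> t) w * p w))"
        using ae
      proof eventually_elim
        case (elim w)
        have "indicator K (w - t *\<^sub>R e) * p w - indicator K w * p w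
            = - ((indicator K w - indicator K (w - t *\<^sub>R e)) * p w)" by (simp add: algebra_simps)
        also have "\<dots> = (\<Sum>\<sigma>\<in>F. sgn (N \<sigma> \<bullet> e) * (indicator (P \<sigma> t) w * p w))"
          unfolding elim by (simp add: sum_distrib_right mult.assoc)
        finally show ?case .
      qed
    qed measurable
    also have "\<dots> = (\<Sum>\<sigma>\<in>F. sgn (N \<sigma> \<bullet> e) * (LINT w|lborel. indicator (P \<sigma> t) w * p w))"
      using intP by simp
    finally show ?thesis .
  qed
  have "(\<Phi> has_real_derivative (LINT z|lborel. indicator K z * frechet_derivative p (at z) e)) (at 0)"
    using has_real_derivative_integral_translate[OF intK bK p, of e 0] by (simp add: \<Phi>_def[abs_def])
  then have "((\<lambda>t. (\<Phi> t - \<Phi> 0) / t) \<longlongrightarrow> (LINT z|lborel. indicator K z * frechet_derivative p (at z) e)) (at 0)"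
    by (simp add: DERIV_def)
  \<comment> \<open>The prism limits are one-sided, so the derivative is read off from the
    right.\<close>
  then have lim1: "((\<lambda>t. (\<Phi> t - \<Phi> 0) / t) \<longlongrightarrow> (LINT z|lborel. indicator K z * frechet_derivative p (at z) e)) (at_right 0)"
    by (rule tendsto_mono[rotated]) (simp add: at_le)
  have "((\<lambda>t. \<Sum>\<sigma>\<in>F. sgn (N \<sigma> \<bullet> e) * ((LINT w|lborel. indicator (P \<sigma> t) w * p w) / t))
      \<longlongrightarrow> (\<Sum>\<sigma>\<in>F. sgn (N \<sigma> \<bullet> e) * (\<bar>N \<sigma> \<bullet> e\<bar> * (LINT x|face_measure \<sigma>. p x)))) (at_right 0)"
    unfolding P_def
    by (intro tendsto_sum tendsto_mult tendsto_const flat_face.integral_prism_limit face trans cont)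
  moreover have "\<forall>\<^sub>F t in at_right 0. (\<Sum>\<sigma>\<in>F. sgn (N \<sigma> \<bullet> e) * ((LINT w|lborel. indicator (P \<sigma> t) w * p w) / t)) = (\<Phi> t - \<Phi> 0) / t"
    using diff by (auto simp: eventually_at_right[OF zero_less_one] sum_divide_distrib intro!: exI[of _ 1])
  ultimately have "((\<lambda>t. (\<Phi> t - \<Phi> 0) / t) \<longlongrightarrow> (\<Sum>\<sigma>\<in>F. sgn (N \<sigma> \<bullet> e) * (\<bar>N \<sigma> \<bullet> e\<bar> * (LINT x|face_measure \<sigma>. p x)))) (at_right 0)"
    by (rule Lim_transform_eventually)
  from tendsto_unique[OF _ lim1 this] show ?thesis
    by (simp add: mult.assoc[symmetric] sgn_mult_abs)
qed

text \<open>A direction parallel to a face is the sum of two directions that are transversal to all faces.\<close>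

lemma gauss:
  fixes p :: "'a \<Rightarrow> real"
  assumes p: "C1_fun p"
  shows "(LINT z|lborel. indicator K z * frechet_derivative p (at z) e)
    = (\<Sum>\<sigma>\<in>F. (N \<sigma> \<bullet> e) * (LINT x|face_measure \<sigma>. p x))"
proof -
  \<comment> \<open>The excluded planes: \<open>e1\<close> tangent to a face, or
    \<open>e - e1\<close> tangent to a face. Finitely many hyperplanes do not fill the
    space.\<close>
  define Z where "Z = (\<Union>\<sigma>\<in>F. {x. N \<sigma> \<bullet> x = 0} \<union> {x. N \<sigma> \<bullet> x = N \<sigma> \<bullet> e})"
  have "N \<sigma> \<noteq> 0" if "\<sigma> \<in> F" for \<sigma> using flat_face.norm_n[OF face[OF that]] by auto
  then have "negligible Z"
    unfolding Z_def using finite_F by (intro negligible_Union) (auto intro!: negligible_Un negligible_hyperplane)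
  then have "Z \<noteq> UNIV" using open_not_negligible[of UNIV] by auto
  then obtain e1 where e1: "e1 \<notin> Z" by auto
  have t1: "N \<sigma> \<bullet> e1 \<noteq> 0" and t2: "N \<sigma> \<bullet> (e - e1) \<noteq> 0" if "\<sigma> \<in> F" for \<sigma>
    using e1 that by (auto simp: Z_def inner_diff_right)
  have intK: "integrable lborel (indicat_real K)"
    using emeasure_bounded_finite[OF bounded_K] open_K by (intro integrable_real_indicator) (auto simp: less_top)
  have bK: "bounded {x. indicat_real K x \<noteq> 0}"
    by (rule bounded_subset[OF bounded_K]) (auto simp: indicator_def)
  have int: "integrable lborel (\<lambda>z. indicator K z * frechet_derivative p (at z) v)" for v
    by (rule integrable_mult_continuous[OF intK bK C1_fun_derivative(2)[OF p]])
  have "frechet_derivative p (at z) e = frechet_derivative p (at z) e1 + frechet_derivative p (at z) (e - e1)" for z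
    using linear_add[OF has_derivative_linear[OF C1_fun_derivative(1)[OF p]], of z e1 "e - e1"] by simp
  then have "(LINT z|lborel. indicator K z * frechet_derivative p (at z) e)
      = (LINT z|lborel. indicator K z * frechet_derivative p (at z) e1) + (LINT z|lborel. indicator K z * frechet_derivative p (at z) (e - e1))"
    using int by (simp add: distrib_left)
  also have "\<dots> = (\<Sum>\<sigma>\<in>F. (N \<sigma> \<bullet> e1) * (LINT x|face_measure \<sigma>. p x)) + (\<Sum>\<sigma>\<in>F. (N \<sigma> \<bullet> (e - e1)) * (LINT x|face_measure \<sigma>. p x))"
    by (simp add: gauss_generic[OF p t1] gauss_generic[OF p t2])
  also have "\<dots> = (\<Sum>\<sigma>\<in>F. (N \<sigma> \<bullet> e) * (LINT x|face_measure \<sigma>. p x))"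
    by (simp add: sum.distrib[symmetric] inner_diff_right algebra_simps)
  finally show ?thesis .
qed

end

section \<open>Discrete operators\<close>

text \<open>The analogue of \<open>Linf\<close> for an arbitrary measure, so that the same closure
  rules serve cells and faces.\<close>

definition bdd_meas :: "'x measure \<Rightarrow> ('x \<Rightarrow> real) \<Rightarrow> bool" where
  "bdd_meas M f \<longleftrightarrow> f \<in> borel_measurable M \<and> (\<exists>C. AE x in M. \<bar>f x\<bar> \<le> C)"

lemma Linf_eq_bdd_meas: "Linf S f \<longleftrightarrow> bdd_meas (lebesgue_on S) f"
  by (simp add: Linf_def bdd_meas_def)

lemma bdd_meas_const: "bdd_meas M (\<lambda>x. c)"
  by (auto simp: bdd_meas_def)

lemma bdd_meas_add:
  assumes "bdd_meas M f" "bdd_meas M g" shows "bdd_meas M (\<lambda>x. f x + g x)"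
proof -
  obtain C D where "AE x in M. \<bar>f x\<bar> \<le> C" "AE x in M. \<bar>g x\<bar> \<le> D"
    using assms by (auto simp: bdd_meas_def)
  then have "AE x in M. \<bar>f x + g x\<bar> \<le> C + D" by eventually_elim linarith
  then show ?thesis using assms by (auto simp: bdd_meas_def)
qed

lemma bdd_meas_mult:
  assumes "bdd_meas M f" "bdd_meas M g" shows "bdd_meas M (\<lambda>x. f x * g x)"
proof -
  obtain C D where "AE x in M. \<bar>f x\<bar> \<le> C" "AE x in M. \<bar>g x\<bar> \<le> D"
    using assms by (auto simp: bdd_meas_def)
  then have "AE x in M. \<bar>f x * g x\<bar> \<le> C * D"
    by eventually_elim (auto simp: abs_mult intro!: mult_mono)
  then show ?thesis using assms by (auto simp: bdd_meas_def)
qed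

lemma bdd_meas_sum: "(\<And>i. i \<in> A \<Longrightarrow> bdd_meas M (f i)) \<Longrightarrow> bdd_meas M (\<lambda>x. \<Sum>i\<in>A. f i x)"
  by (induction A rule: infinite_finite_induct) (auto intro: bdd_meas_add bdd_meas_const)

lemma bdd_meas_exp:
  assumes "bdd_meas M f" shows "bdd_meas M (\<lambda>x. exp (- f x))"
proof -
  obtain C where "AE x in M. \<bar>f x\<bar> \<le> C"
    using assms by (auto simp: bdd_meas_def)
  then have "AE x in M. \<bar>exp (- f x)\<bar> \<le> exp C" by eventually_elim auto
  moreover have "(\<lambda>x. exp (- f x)) \<in> borel_measurable M"
    using assms by (auto simp: bdd_meas_def)
  ultimately show ?thesis unfolding bdd_meas_def by blast
qed

lemma bdd_meas_integrable: "finite_measure M \<Longrightarrow> bdd_meas M f \<Longrightarrow> integrable M f"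
  unfolding bdd_meas_def real_norm_def[symmetric] by (metis finite_measure.integrable_const_bound)

lemma integrable_mult_bdd_meas:
  assumes "integrable M f" "bdd_meas M g" shows "integrable M (\<lambda>x. f x * g x :: real)"
proof -
  obtain C where C: "AE x in M. \<bar>g x\<bar> \<le> C" using assms(2) by (auto simp: bdd_meas_def)
  show ?thesis
  proof (rule Bochner_Integration.integrable_bound)
    show "integrable M (\<lambda>x. C * f x)" using assms(1) by simp
    show "(\<lambda>x. f x * g x) \<in> borel_measurable M"
      using assms by (auto simp: bdd_meas_def)
    show "AE x in M. norm (f x * g x) \<le> norm (C * f x)"
      using C
    proof eventually_elim
      case (elim x)
      then have "\<bar>g x\<bar> * \<bar>f x\<bar> \<le> \<bar>C\<bar> * \<bar>f x\<bar>" by (intro mult_right_mono) auto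
      then show ?case by (simp add: abs_mult mult.commute)
    qed
  qed
qed

lemma bounded_range_of_continuous:
  fixes f :: "'a::euclidean_space \<Rightarrow> real"
  assumes "bounded S" "continuous_on UNIV f" shows "\<exists>C. \<forall>x\<in>S. \<bar>f x\<bar> \<le> C"
proof -
  have "compact (f ` closure S)"
    using assms by (intro compact_continuous_image) (auto simp: compact_closure intro: continuous_on_subset)
  then have "bounded (f ` S)"
    using closure_subset by (intro bounded_subset[OF compact_imp_bounded]) auto
  then show ?thesis by (auto simp: bounded_iff)
qed

lemma bdd_meas_continuous_cell:
  fixes f :: "'a::euclidean_space \<Rightarrow> real"
  assumes "open K" "bounded K" "continuous_on UNIV f"
  shows "bdd_meas (lebesgue_on K) f"
proof -
  obtain C where C: "\<forall>x\<in>K. \<bar>f x\<bar> \<le> C" using bounded_range_of_continuous[OF assms(2,3)] by blast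
  have "f \<in> borel_measurable (lebesgue_on K)"
    using borel_measurable_continuous_onI[OF assms(3)]
    by (intro measurable_restrict_space1 measurable_completion) simp
  moreover have "AE x in lebesgue_on K. \<bar>f x\<bar> \<le> C"
    using C by (intro AE_I2) (simp add: space_restrict_space)
  ultimately show ?thesis by (auto simp: bdd_meas_def)
qed

lemma finite_measure_cell:
  assumes "open K" "bounded K" shows "finite_measure (lebesgue_on K)"
  using finite_measure_lebesgue_on[OF lmeasurable_open[OF assms(2,1)]] .

lemma (in flat_face) bdd_meas_face:
  fixes p f :: "'a \<Rightarrow> real"
  assumes "continuous_on UNIV p" "\<And>x. x \<in> \<sigma> \<Longrightarrow> f x = p x"
  shows "bdd_meas (face_measure \<sigma>) f"
proof -
  obtain C where C: "\<forall>x\<in>\<sigma>. \<bar>p x\<bar> \<le> C" using bounded_range_of_continuous[OF bnd assms(1)] by blast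
  have "p \<in> borel_measurable (face_measure \<sigma>)"
    by (rule measurable_face_continuous[OF continuous_on_subset[OF assms(1)]]) auto
  then have "f \<in> borel_measurable (face_measure \<sigma>)"
    using assms(2) by (subst measurable_cong[where g = p]) auto
  moreover have "AE x in face_measure \<sigma>. \<bar>f x\<bar> \<le> C"
    using C assms(2) by (intro AE_I2) auto
  ultimately show ?thesis by (auto simp: bdd_meas_def)
qed

lemma AE_lebesgue_on_subset:
  assumes "AE x in lebesgue_on S. P x" "open S" "open T" "T \<subseteq> S"
  shows "AE x in lebesgue_on T. P x"
proof -
  have "AE x in lebesgue. x \<in> S \<longrightarrow> P x"
    using assms(1,2) by (simp add: AE_restrict_space_iff)
  then have "AE x in lebesgue. x \<in> T \<longrightarrow> P x"
    by eventually_elim (use assms(4) in auto)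
  then show ?thesis using assms(3) by (simp add: AE_restrict_space_iff)
qed

lemma Linf_subset:
  assumes "Linf S f" "open S" "open T" "T \<subseteq> S" shows "Linf T f"
proof -
  have "f \<in> borel_measurable (lebesgue_on T)"
    using assms unfolding Linf_def by (meson measurable_restrict_mono)
  then show ?thesis
    using assms AE_lebesgue_on_subset[OF _ assms(2-4)] unfolding Linf_def by blast
qed

lemma vec_polys_zero_on_open:
  assumes "\<tau> \<in> vec_polys q" "open U" "U \<noteq> {}" "\<And>x. x \<in> U \<Longrightarrow> \<tau> x = 0"
  shows "\<tau> = 0"
proof
  fix x
  have "(\<lambda>x. \<tau> x $ i) = 0" for i
    using assms by (intro polys_eq_0[OF vec_polys_component[OF assms(1)]]) auto
  then show "\<tau> x = 0 x" by (simp add: vec_eq_iff fun_eq_iff)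
qed

section \<open>Polynomial fields on a cell\<close>

context
  fixes K :: "(real^'d) set" and k :: nat
  assumes K: "open K" "bounded K" "K \<noteq> {}"
begin

lemma integrable_cell:
  fixes f :: "real^'d \<Rightarrow> real"
  shows "continuous_on UNIV f \<Longrightarrow> integrable (lebesgue_on K) f"
  by (rule bdd_meas_integrable[OF finite_measure_cell bdd_meas_continuous_cell]) (use K in auto)

lemma vec_polys_definite:
  assumes \<tau>: "\<tau> \<in> vec_polys k" and 0: "(LINT x|lebesgue_on K. \<tau> x \<bullet> \<tau> x) = 0"
  shows "\<tau> = (0 :: real^'d \<Rightarrow> real^'d)"
proof (rule vec_polys_zero_on_open[OF \<tau> K(1,3)])
  have c: "continuous_on UNIV (\<lambda>x. \<tau> x \<bullet> \<tau> x)"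
    by (intro continuous_intros continuous_on_vec_polys[OF \<tau>])
  have "AE x in lebesgue_on K. \<tau> x \<bullet> \<tau> x = 0"
    using 0 integrable_cell[OF c] by (subst (asm) integral_nonneg_eq_0_iff_AE) auto
  then show "\<tau> x = 0" if "x \<in> K" for x
    using continuous_AE_eq_0[OF K(1) continuous_on_subset[OF c] _ that] by auto
qed

text \<open>Gives meaning to the description in \<open>discrete_gradient\<close>: the inner product
  over the non-empty open set \<open>K\<close> is definite on polynomial fields, so a linear
  functional has exactly one representative.\<close>

lemma riesz_vec_polys:
  fixes L :: "(real^'d \<Rightarrow> real^'d) \<Rightarrow> real"
  assumes L: "\<And>\<sigma> \<tau> c. \<lbrakk>\<sigma> \<in> vec_polys k; \<tau> \<in> vec_polys k\<rbrakk> \<Longrightarrow> L (\<sigma> + c *\<^sub>R \<tau>) = L \<sigma> + c * L \<tau>"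
  shows "\<exists>!G. G \<in> vec_polys k \<and> (\<forall>\<tau>\<in>vec_polys k. (LINT x|lebesgue_on K. G x \<bullet> \<tau> x) = L \<tau>)"
proof -
  define B where "B \<sigma> \<tau> = (LINT x|lebesgue_on K. \<sigma> x \<bullet> \<tau> x)" for \<sigma> \<tau> :: "real^'d \<Rightarrow> real^'d"
  have int: "integrable (lebesgue_on K) (\<lambda>x. \<sigma> x \<bullet> \<tau> x)" if "\<sigma> \<in> vec_polys k" "\<tau> \<in> vec_polys k"
    for \<sigma> \<tau> :: "real^'d \<Rightarrow> real^'d"
    by (intro integrable_cell continuous_intros continuous_on_vec_polys[OF that(1)] continuous_on_vec_polys[OF that(2)])
  have Bl: "B (\<sigma> + c *\<^sub>R \<sigma>') \<tau> = B \<sigma> \<tau> + c * B \<sigma>' \<tau>"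
    if "\<sigma> \<in> vec_polys k" "\<sigma>' \<in> vec_polys k" "\<tau> \<in> vec_polys k" for \<sigma> \<sigma>' \<tau> c
    using int[OF that(1,3)] int[OF that(2,3)] by (simp add: B_def inner_add_left)
  have Br: "B \<tau> (\<sigma> + c *\<^sub>R \<sigma>') = B \<tau> \<sigma> + c * B \<tau> \<sigma>'"
    if "\<sigma> \<in> vec_polys k" "\<sigma>' \<in> vec_polys k" "\<tau> \<in> vec_polys k" for \<sigma> \<sigma>' \<tau> c
    using Bl[OF that] by (simp add: B_def inner_commute)
  have 0: "0 \<in> vec_polys k" by (rule subspace_0[OF subspace_vec_polys])
  have L0: "L 0 = 0" using L[OF 0 0, of 1] by simp
  define Fn :: "(real^'d \<Rightarrow> real^'d) set" where
    "Fn = (\<lambda>(p, i) x. p x *\<^sub>R axis i 1) ` (monomial ` {\<alpha>. sum \<alpha> UNIV \<le> k} \<times> UNIV)"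
  have span: "vec_polys k = span Fn" unfolding Fn_def by (rule vec_polys_eq_span)
  have "\<exists>G\<in>span Fn. \<forall>\<tau>\<in>span Fn. B G \<tau> = L \<tau>"
  proof (rule galerkin_solvable[where V = "vec_polys k"])
    show "finite Fn" unfolding Fn_def by (intro finite_imageI finite_cartesian_product finite_multi_indices finite)
    show "Fn \<subseteq> vec_polys k" unfolding span by (auto intro: span_base)
    show "B \<sigma> \<tau> = 0 \<and> L \<tau> = 0" if "\<tau> \<in> vec_polys k" "B \<tau> \<tau> = 0" for \<sigma> \<tau>
      using vec_polys_definite[OF that(1)] that(2) L0 by (simp add: B_def)
  qed (fact subspace_vec_polys Bl Br L)+
  then obtain G where G: "G \<in> vec_polys k" "\<forall>\<tau>\<in>vec_polys k. B G \<tau> = L \<tau>" unfolding span by blast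
  show ?thesis
  proof (rule ex1I[of _ G])
    show "G \<in> vec_polys k \<and> (\<forall>\<tau>\<in>vec_polys k. (LINT x|lebesgue_on K. G x \<bullet> \<tau> x) = L \<tau>)"
      using G by (simp add: B_def)
    fix H assume H: "H \<in> vec_polys k \<and> (\<forall>\<tau>\<in>vec_polys k. (LINT x|lebesgue_on K. H x \<bullet> \<tau> x) = L \<tau>)"
    define D where "D = H + (-1) *\<^sub>R G"
    have D: "D \<in> vec_polys k"
      unfolding D_def using G(1) H by (intro subspace_add[OF subspace_vec_polys] subspace_scale[OF subspace_vec_polys]) auto
    have "B D D = B H D + (-1) * B G D"
      unfolding D_def by (rule Bl) (use H G(1) D in \<open>auto simp: D_def\<close>)
    also have "\<dots> = 0" using H G D by (simp add: B_def)
    finally have "D = 0" using vec_polys_definite[OF D] by (simp add: B_def)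
    then show "H = G" by (simp add: D_def)
  qed
qed

end

context flat_face
begin

lemma integrable_face:
  fixes p f :: "'a \<Rightarrow> real"
  assumes "continuous_on UNIV p" "\<And>x. x \<in> \<sigma> \<Longrightarrow> f x = p x"
  shows "integrable (face_measure \<sigma>) f"
  by (rule bdd_meas_integrable[OF finite_measure_face bdd_meas_face[OF assms]])

text \<open>Only values on \<open>\<sigma>\<close> are recovered: a polynomial that vanishes on a
  face need not be zero.\<close>

lemma face_definite:
  fixes p :: "'a \<Rightarrow> real"
  assumes p: "continuous_on UNIV p" and 0: "(LINT x|face_measure \<sigma>. p x * p x) = 0" and x: "x \<in> \<sigma>"
  shows "p x = 0"
proof -
  have c: "continuous_on UNIV (\<lambda>x. p x * p x)" by (intro continuous_intros p)
  have "AE x in face_measure \<sigma>. p x * p x = 0"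
    using 0 integrable_face[OF c refl] by (subst (asm) integral_nonneg_eq_0_iff_AE) auto
  then show ?thesis
    using AE_face_continuous_eq_0[OF continuous_on_subset[OF c] _ x] by auto
qed

end

section \<open>Orthogonal projection onto polynomials on a face\<close>

context
  fixes \<sigma> :: "(real^'d) set" and n c and k :: nat
  assumes flat: "flat_face \<sigma> n c"
begin

interpretation flat_face \<sigma> n c by (rule flat)

text \<open>Two candidates differ on \<open>\<sigma>\<close> by a polynomial orthogonal to itself.
  Orthogonality may be tested with global polynomials, since their restrictions are the members of
  \<open>polys_on\<close>.\<close>

lemma face_projection_unique:
  assumes f: "continuous_on UNIV f" and p: "p \<in> polys k"
    and orth: "\<And>q. q \<in> polys k \<Longrightarrow> (LINT x|face_measure \<sigma>. (f x - p x) * q x) = 0"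
  shows "face_projection k \<sigma> f = restrict p \<sigma>"
  unfolding face_projection_def
proof (rule the_equality)
  have cong: "(LINT x|face_measure \<sigma>. (f x - restrict r \<sigma> x) * restrict q \<sigma> x)
      = (LINT x|face_measure \<sigma>. (f x - r x) * q x)" for r q
    by (intro Bochner_Integration.integral_cong) auto
  show "restrict p \<sigma> \<in> polys_on k \<sigma> \<and>
      (\<forall>q\<in>polys_on k \<sigma>. (LINT x|face_measure \<sigma>. (f x - restrict p \<sigma> x) * q x) = 0)"
  proof (intro conjI ballI)
    fix q assume "q \<in> polys_on k \<sigma>"
    then obtain q' where "q' \<in> polys k" "q = restrict q' \<sigma>" by (auto simp: polys_on_def)
    then show "(LINT x|face_measure \<sigma>. (f x - restrict p \<sigma> x) * q x) = 0"
      by (simp only: cong orth)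
  qed (use p in \<open>simp add: polys_on_def\<close>)
  fix p' assume p': "p' \<in> polys_on k \<sigma> \<and>
      (\<forall>q\<in>polys_on k \<sigma>. (LINT x|face_measure \<sigma>. (f x - p' x) * q x) = 0)"
  then obtain r where r: "r \<in> polys k" "p' = restrict r \<sigma>" by (auto simp: polys_on_def)
  have orth': "(LINT x|face_measure \<sigma>. (f x - r x) * q x) = 0" if "q \<in> polys k" for q
  proof -
    have "restrict q \<sigma> \<in> polys_on k \<sigma>" using that by (simp add: polys_on_def)
    then have "(LINT x|face_measure \<sigma>. (f x - restrict r \<sigma> x) * restrict q \<sigma> x) = 0"
      using p' unfolding r(2) by blast
    then show ?thesis by (simp only: cong)
  qed
  define d where "d = p + (-1) *\<^sub>R r"
  have d: "d \<in> polys k"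
    unfolding d_def using p r by (intro subspace_add[OF subspace_polys] subspace_scale[OF subspace_polys])
  have int: "integrable (face_measure \<sigma>) (\<lambda>x. (f x - q x) * d x)" if "q \<in> polys k" for q
    by (rule integrable_face[OF _ refl])
      (intro continuous_intros f continuous_on_polys[OF that] continuous_on_polys[OF d])
  have "(LINT x|face_measure \<sigma>. d x * d x) = (LINT x|face_measure \<sigma>. (f x - r x) * d x - (f x - p x) * d x)"
    by (intro Bochner_Integration.integral_cong) (auto simp: d_def algebra_simps)
  also have "\<dots> = 0" using int r(1) p orth[OF d] orth'[OF d] by simp
  finally have "d x = 0" if "x \<in> \<sigma>" for x
    using face_definite[OF continuous_on_polys[OF d] _ that] by simp
  then show "p' = restrict p \<sigma>" by (auto simp: r d_def fun_eq_iff restrict_def)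
qed

text \<open>On global polynomials the product over \<open>\<sigma>\<close> is only semidefinite, as
  multiples of the equation of the plane are null. A null vector vanishes on \<open>\<sigma>\<close>
  and so pairs to 0 with everything, which is the hypothesis \<open>null\<close> of the
  elimination.\<close>

lemma face_projection_exists:
  assumes f: "continuous_on UNIV f"
  shows "\<exists>p\<in>polys k. face_projection k \<sigma> f = restrict p \<sigma> \<and>
    (\<forall>q\<in>polys k. (LINT x|face_measure \<sigma>. (f x - p x) * q x) = 0)"
proof -
  define B where "B p q = (LINT x|face_measure \<sigma>. p x * q x)" for p q :: "real^'d \<Rightarrow> real"
  have int: "integrable (face_measure \<sigma>) (\<lambda>x. p x * q x)" if "continuous_on UNIV p" "continuous_on UNIV q"
    for p q :: "real^'d \<Rightarrow> real"
    by (rule integrable_face[OF _ refl]) (intro continuous_intros that)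
  have Bl: "B (p + a *\<^sub>R p') q = B p q + a * B p' q"
    if "continuous_on UNIV p" "continuous_on UNIV p'" "continuous_on UNIV q"
    for p p' q :: "real^'d \<Rightarrow> real" and a
    using int[OF that(1,3)] int[OF that(2,3)] by (simp add: B_def distrib_right mult.assoc)
  have Bc: "B p q = B q p" for p q by (simp add: B_def mult.commute)
  define Fn :: "(real^'d \<Rightarrow> real) set" where "Fn = monomial ` {\<alpha>. sum \<alpha> UNIV \<le> k}"
  have span: "polys k = span Fn" unfolding Fn_def by (rule polys_eq_span)
  note cp = continuous_on_polys[where S = UNIV]
  have "\<exists>p\<in>span Fn. \<forall>q\<in>span Fn. B p q = B f q"
  proof (rule galerkin_solvable[where V = "polys k"])
    show "finite Fn" unfolding Fn_def by (intro finite_imageI finite_multi_indices)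
    show "Fn \<subseteq> polys k" unfolding span by (auto intro: span_base)
    show "B w v = 0 \<and> B f v = 0" if "v \<in> polys k" "B v v = 0" for v w
    proof -
      have "v x = 0" if "x \<in> \<sigma>" for x
        using face_definite[OF cp[OF \<open>v \<in> polys k\<close>] _ that] \<open>B v v = 0\<close> by (simp add: B_def)
      then have "B g v = (LINT x|face_measure \<sigma>. 0)" for g
        unfolding B_def by (intro Bochner_Integration.integral_cong) auto
      then show ?thesis by simp
    qed
    show "B (p + a *\<^sub>R p') q = B p q + a * B p' q" if "p \<in> polys k" "p' \<in> polys k" "q \<in> polys k" for p p' q a
      by (intro Bl cp[OF that(1)] cp[OF that(2)] cp[OF that(3)])
    show "B q (p + a *\<^sub>R p') = B q p + a * B q p'" if "p \<in> polys k" "p' \<in> polys k" "q \<in> polys k" for p p' q a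
      unfolding Bc[of q] by (intro Bl cp[OF that(1)] cp[OF that(2)] cp[OF that(3)])
    show "B f (p + a *\<^sub>R p') = B f p + a * B f p'" if "p \<in> polys k" "p' \<in> polys k" for p p' a
      unfolding Bc[of f] by (intro Bl cp[OF that(1)] cp[OF that(2)] f)
  qed (rule subspace_polys)
  then obtain p where p: "p \<in> polys k" "\<And>q. q \<in> polys k \<Longrightarrow> B p q = B f q" unfolding span by blast
  have orth: "(LINT x|face_measure \<sigma>. (f x - p x) * q x) = 0" if "q \<in> polys k" for q
    using p(2)[OF that] int[OF f cp[OF that]] int[OF cp[OF p(1)] cp[OF that]]
    by (simp add: left_diff_distrib B_def)
  then show ?thesis using face_projection_unique[OF f p(1) orth] p(1) by blast
qed

lemma face_projection_linear:
  assumes f: "continuous_on UNIV f" and g: "continuous_on UNIV g" and x: "x \<in> \<sigma>"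
  shows "face_projection k \<sigma> (f + a *\<^sub>R g) x = face_projection k \<sigma> f x + a * face_projection k \<sigma> g x"
proof -
  obtain p where p: "p \<in> polys k" "face_projection k \<sigma> f = restrict p \<sigma>"
    "\<forall>q\<in>polys k. (LINT x|face_measure \<sigma>. (f x - p x) * q x) = 0"
    using face_projection_exists[OF f] by blast
  obtain r where r: "r \<in> polys k" "face_projection k \<sigma> g = restrict r \<sigma>"
    "\<forall>q\<in>polys k. (LINT x|face_measure \<sigma>. (g x - r x) * q x) = 0"
    using face_projection_exists[OF g] by blast
  have "face_projection k \<sigma> (f + a *\<^sub>R g) = restrict (p + a *\<^sub>R r) \<sigma>"
  proof (rule face_projection_unique)
    show "continuous_on UNIV (f + a *\<^sub>R g)"
      unfolding plus_fun_def scaleR_fun_def by (intro continuous_intros f g)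
    show "p + a *\<^sub>R r \<in> polys k"
      using p r by (intro subspace_add[OF subspace_polys] subspace_scale[OF subspace_polys])
    fix q :: "real^'d \<Rightarrow> real" assume q: "q \<in> polys k"
    have int: "integrable (face_measure \<sigma>) (\<lambda>x. (f' x - p' x) * q x)"
      if "continuous_on UNIV f'" "p' \<in> polys k" for f' p' :: "real^'d \<Rightarrow> real"
      by (rule integrable_face[OF _ refl])
        (intro continuous_intros that(1) continuous_on_polys[OF that(2)] continuous_on_polys[OF q])
    have "(LINT x|face_measure \<sigma>. ((f + a *\<^sub>R g) x - (p + a *\<^sub>R r) x) * q x)
        = (LINT x|face_measure \<sigma>. (f x - p x) * q x + a * ((g x - r x) * q x))"
      by (simp add: algebra_simps)
    also have "\<dots> = 0" using int[OF f p(1)] int[OF g r(1)] p(3) r(3) q by simp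
    finally show "(LINT x|face_measure \<sigma>. ((f + a *\<^sub>R g) x - (p + a *\<^sub>R r) x) * q x) = 0" .
  qed
  then show ?thesis using p(2) r(2) x by simp
qed

end

section \<open>Positivity of the face weights\<close>

text \<open>As a limit along the filter generated by neighbourhoods of \<open>x\<close> and sets of
  full measure, the essential limit inherits the algebra of limits and, for a proper filter, their
  uniqueness.\<close>

lemma ess_limit_iff_tendsto:
  assumes "open C"
  shows "ess_limit C f x l \<longleftrightarrow> (f \<longlongrightarrow> l) (inf (nhds x) (ae_filter (lebesgue_on C)))"
proof -
  have "(\<forall>\<^sub>F y in inf (nhds x) (ae_filter (lebesgue_on C)). P y) \<longleftrightarrow>
      (\<exists>\<delta>>0. AE y in lebesgue_on (C \<inter> ball x \<delta>). P y)" for P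
  proof
    assume "\<forall>\<^sub>F y in inf (nhds x) (ae_filter (lebesgue_on C)). P y"
    then obtain Q R where QR: "\<forall>\<^sub>F y in nhds x. Q y" "AE y in lebesgue_on C. R y" "\<And>y. Q y \<Longrightarrow> R y \<Longrightarrow> P y"
      unfolding eventually_inf by blast
    obtain d where d: "d > 0" "\<And>y. dist y x < d \<Longrightarrow> Q y" using QR(1) unfolding eventually_nhds_metric by blast
    have "AE y in lebesgue. y \<in> C \<longrightarrow> R y" using QR(2) assms by (simp add: AE_restrict_space_iff)
    then have "AE y in lebesgue. y \<in> C \<inter> ball x d \<longrightarrow> P y"
      by eventually_elim (use d QR(3) in \<open>auto simp: dist_commute\<close>)
    then have "AE y in lebesgue_on (C \<inter> ball x d). P y" using assms by (subst AE_restrict_space_iff) auto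
    then show "\<exists>\<delta>>0. AE y in lebesgue_on (C \<inter> ball x \<delta>). P y" using d(1) by blast
  next
    assume "\<exists>\<delta>>0. AE y in lebesgue_on (C \<inter> ball x \<delta>). P y"
    then obtain d where d: "d > 0" "AE y in lebesgue_on (C \<inter> ball x d). P y" by blast
    have "AE y in lebesgue. y \<in> C \<inter> ball x d \<longrightarrow> P y" using d(2) assms by (subst (asm) AE_restrict_space_iff) auto
    then have "AE y in lebesgue. y \<in> C \<longrightarrow> (y \<in> ball x d \<longrightarrow> P y)" by eventually_elim auto
    then have "AE y in lebesgue_on C. y \<in> ball x d \<longrightarrow> P y" using assms by (simp add: AE_restrict_space_iff)
    moreover have "\<forall>\<^sub>F y in nhds x. y \<in> ball x d" using d(1) by (intro eventually_nhds_in_open) auto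
    ultimately show "\<forall>\<^sub>F y in inf (nhds x) (ae_filter (lebesgue_on C)). P y"
      unfolding eventually_inf by blast
  qed
  then show ?thesis unfolding ess_limit_def tendsto_iff dist_real_def by simp
qed

text \<open>The filter is proper because an open set that meets every ball about \<open>x\<close>
  meets it in a set that is not null.\<close>

lemma ess_filter_nontrivial:
  assumes "open C" "x \<in> closure C"
  shows "inf (nhds x) (ae_filter (lebesgue_on C)) \<noteq> bot"
proof
  assume "inf (nhds x) (ae_filter (lebesgue_on C)) = bot"
  then have "\<forall>\<^sub>F y in inf (nhds x) (ae_filter (lebesgue_on C)). False" by simp
  then obtain Q R where QR: "\<forall>\<^sub>F y in nhds x. Q y" "AE y in lebesgue_on C. R y" "\<And>y. Q y \<Longrightarrow> R y \<Longrightarrow> False"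
    unfolding eventually_inf by blast
  obtain d where d: "d > 0" "\<And>y. dist y x < d \<Longrightarrow> Q y" using QR(1) unfolding eventually_nhds_metric by blast
  have "AE y in lebesgue. y \<in> C \<longrightarrow> R y" using QR(2) assms by (simp add: AE_restrict_space_iff)
  moreover have "C \<inter> ball x d \<noteq> {}"
  proof -
    obtain y where "y \<in> C" "dist y x < d" using assms(2) d(1) unfolding closure_approachable by blast
    then have "y \<in> C \<inter> ball x d" by (simp add: dist_commute)
    then show ?thesis by blast
  qed
  ultimately obtain y where "y \<in> C \<inter> ball x d" "y \<in> C \<longrightarrow> R y"
    using AE_lebesgue_exists[of _ "C \<inter> ball x d"] assms(1) by blast
  then show False using QR(3)[of y] d(2)[of y] by (auto simp: dist_commute)
qed

lemma ess_limit_unique: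
  assumes "open C" "x \<in> closure C" "ess_limit C f x l" "ess_limit C f x l'"
  shows "l = l'"
  using assms tendsto_unique[OF ess_filter_nontrivial] by (auto simp: ess_limit_iff_tendsto)

lemma trace_from_eq:
  assumes "open C" "x \<in> closure C" "ess_limit C f x l"
  shows "trace_from C f x = l"
  unfolding trace_from_def ess_limit_def[symmetric]
  using assms by (auto intro: ess_limit_unique)

lemma ess_limit_bounds:
  assumes "open C" "x \<in> closure C" "ess_limit C f x l" "\<delta> > 0"
    "AE y in lebesgue_on (C \<inter> ball x \<delta>). a \<le> f y \<and> f y \<le> b"
  shows "a \<le> l \<and> l \<le> b"
proof -
  let ?F = "inf (nhds x) (ae_filter (lebesgue_on C))"
  have lim: "(f \<longlongrightarrow> l) ?F" using assms ess_limit_iff_tendsto by blast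
  have "AE y in lebesgue. y \<in> C \<inter> ball x \<delta> \<longrightarrow> a \<le> f y \<and> f y \<le> b"
    using assms(1,5) by (subst (asm) AE_restrict_space_iff) auto
  then have "AE y in lebesgue. y \<in> C \<longrightarrow> (y \<in> ball x \<delta> \<longrightarrow> a \<le> f y \<and> f y \<le> b)" by eventually_elim auto
  then have 1: "AE y in lebesgue_on C. y \<in> ball x \<delta> \<longrightarrow> a \<le> f y \<and> f y \<le> b"
    using assms(1) by (simp add: AE_restrict_space_iff)
  have "\<forall>\<^sub>F y in nhds x. y \<in> ball x \<delta>" using assms(4) by (intro eventually_nhds_in_open) auto
  with 1 have ev: "\<forall>\<^sub>F y in ?F. a \<le> f y \<and> f y \<le> b" unfolding eventually_inf by blast
  show ?thesis
  proof
    show "a \<le> l" by (rule tendsto_lowerbound[OF lim _ ess_filter_nontrivial[OF assms(1,2)]])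
      (use ev in \<open>auto elim: eventually_mono\<close>)
    show "l \<le> b" by (rule tendsto_upperbound[OF lim _ ess_filter_nontrivial[OF assms(1,2)]])
      (use ev in \<open>auto elim: eventually_mono\<close>)
  qed
qed

text \<open>Closeness of \<open>f\<close> to \<open>T x\<close> on a ball about \<open>x\<close>
  persists on smaller balls about nearby points, where it bounds their own essential limits.\<close>

lemma trace_continuous_on:
  assumes C: "open C" "S \<subseteq> closure C" and lim: "\<And>x. x \<in> S \<Longrightarrow> ess_limit C f x (T x)"
  shows "continuous_on S T"
  unfolding continuous_on_iff
proof (intro ballI allI impI)
  fix x and e :: real assume x: "x \<in> S" and e: "e > 0"
  obtain d where d: "d > 0" "AE y in lebesgue_on (C \<inter> ball x d). \<bar>f y - T x\<bar> < e / 2"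
    using lim[OF x] e unfolding ess_limit_def by (meson half_gt_zero)
  have ae: "AE y in lebesgue. y \<in> C \<inter> ball x d \<longrightarrow> \<bar>f y - T x\<bar> < e / 2"
    using C(1) d(2) by (subst (asm) AE_restrict_space_iff) auto
  have "dist (T x') (T x) < e" if x': "x' \<in> S" "dist x' x < d" for x'
  proof -
    define r where "r = d - dist x' x"
    have r: "r > 0" using x' by (simp add: r_def)
    have sub: "ball x' r \<subseteq> ball x d"
    proof
      fix y assume "y \<in> ball x' r"
      then show "y \<in> ball x d"
        using dist_triangle[of x y x'] by (simp add: r_def dist_commute)
    qed
    from ae have "AE y in lebesgue. y \<in> C \<inter> ball x' r \<longrightarrow> T x - e / 2 \<le> f y \<and> f y \<le> T x + e / 2"
    proof eventually_elim
      case (elim y)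
      show ?case
      proof
        assume "y \<in> C \<inter> ball x' r"
        then have "\<bar>f y - T x\<bar> < e / 2" using elim sub by blast
        then show "T x - e / 2 \<le> f y \<and> f y \<le> T x + e / 2" by linarith
      qed
    qed
    then have "AE y in lebesgue_on (C \<inter> ball x' r). T x - e / 2 \<le> f y \<and> f y \<le> T x + e / 2"
      using C(1) by (subst AE_restrict_space_iff) auto
    from ess_limit_bounds[OF C(1) subsetD[OF C(2) x'(1)] lim[OF x'(1)] r this]
    have "\<bar>T x' - T x\<bar> \<le> e / 2" by linarith
    then show ?thesis using e by (simp add: dist_real_def)
  qed
  then show "\<exists>d>0. \<forall>x'\<in>S. dist x' x < d \<longrightarrow> dist (T x') (T x) < e" using d(1) by blast
qed

text \<open>\<open>real_of_ereal\<close> sends an infinite essential supremum to 0, so for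
  positivity the upper bound on \<open>T\<close> matters as much as the lower one.\<close>

lemma (in flat_face) Linf_norm_pos:
  assumes T: "continuous_on \<sigma> T" and b: "b > 0" "\<And>x. x \<in> \<sigma> \<Longrightarrow> b \<le> T x \<and> T x \<le> B"
  shows "Linf_norm (face_measure \<sigma>) T > 0"
proof -
  let ?M = "face_measure \<sigma>" and ?f = "\<lambda>x. ereal \<bar>T x\<bar>"
  have m: "?f \<in> borel_measurable ?M"
    using measurable_face_continuous[OF T] by measurable
  have "esssup ?M ?f \<le> ereal B"
    using b by (intro esssup_I[OF m] AE_I2) fastforce
  moreover have "ereal b \<le> esssup ?M ?f"
  proof (rule ccontr)
    \<comment> \<open>An essential supremum below \<open>b\<close> would make the whole face a null
      set.\<close>
    assume *: "\<not> ereal b \<le> esssup ?M ?f"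
    have "AE x in ?M. ?f x \<le> esssup ?M ?f" by (rule esssup_AE)
    then have "AE x in ?M. x \<notin> \<sigma>"
    proof (rule AE_mp, intro AE_I2 impI notI)
      fix x assume x: "?f x \<le> esssup ?M ?f" "x \<in> \<sigma>"
      have "b \<le> \<bar>T x\<bar>" using b(2)[OF x(2)] by linarith
      then have "ereal b \<le> ?f x" by simp
      then show False using * x(1) order_trans by blast
    qed
    then have "\<sigma> \<in> null_sets ?M" using borel by (subst AE_iff_null_sets) (auto simp: sets_face_measure)
    moreover obtain x where "x \<in> \<sigma>" using nonempty by blast
    ultimately show False
      using emeasure_face_ball_pos[of x 1] emeasure_mono[of "\<sigma> \<inter> ball x 1" \<sigma> ?M] borel
      by (auto simp: null_sets_def sets_face_measure)
  qed
  ultimately show ?thesis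
    using b(1) unfolding Linf_norm_def by (cases "esssup ?M ?f") auto
qed

text \<open>In dimension at least 2 the plane of a face contains a direction along which the face
  extends. A zero diameter would switch off the jump term through division by zero.\<close>

lemma (in flat_face) diameter_pos:
  assumes "2 \<le> DIM('a)" shows "0 < diameter \<sigma>"
proof -
  obtain u where u: "u \<noteq> 0" "orthogonal n u" using orthogonal_to_vector_exists[OF assms] by blast
  obtain x where x: "x \<in> \<sigma>" using nonempty by blast
  obtain r where r: "r > 0" "\<And>y. dist x y < r \<Longrightarrow> n \<bullet> y = c \<Longrightarrow> y \<in> \<sigma>"
    using contains_ball[OF x] by metis
  define y where "y = x + (r / 2 / norm u) *\<^sub>R u"
  have d: "dist x y = r / 2" using r(1) u(1) by (simp add: y_def dist_norm)
  have "n \<bullet> y = c" using on_plane[OF x] u(2) by (simp add: y_def inner_add_right orthogonal_def)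
  then have "y \<in> \<sigma>" using d r by simp
  then show ?thesis using diameter_bounded_bound[OF bnd x] d r(1) by fastforce
qed

text \<open>Traces of \<open>\<phi>\<close> and of the entries of \<open>\<Lambda>\<close> exist
  separately; the algebra of limits gives the trace of the weighted normal coefficient, and the
  almost everywhere bounds on the cell pass to it.\<close>

lemma face_weight_pos:
  fixes \<Lambda> :: "real^'d \<Rightarrow> real^'d^'d"
  assumes \<Omega>: "open \<Omega>" and K: "open K" "K \<subseteq> \<Omega>" and flat: "flat_face \<sigma> n c" and \<sigma>K: "\<sigma> \<subseteq> frontier K"
    and half: "\<And>x. x \<in> \<sigma> \<Longrightarrow> halfspace_at K \<sigma> n x" and nrm: "outward_normal K \<sigma> = n"
    and \<phi>: "W1inf \<Omega> \<phi>" and \<Lambda>: "\<And>i j. W1inf K (\<lambda>x. \<Lambda> x $ i $ j)"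
    and ell: "lam > 0" "AE x in lebesgue_on \<Omega>. \<forall>\<xi>. (\<Lambda> x *v \<xi>) \<bullet> \<xi> \<ge> lam * (norm \<xi>)\<^sup>2"
  shows "face_weight (\<lambda>x. exp (- \<phi> x)) \<Lambda> K \<sigma> > 0"
proof -
  interpret flat_face \<sigma> n c by (rule flat)
  define f where "f x = exp (- \<phi> x) * ((\<Lambda> x *v n) \<bullet> n)" for x
  have f_eq: "f = (\<lambda>x. exp (- \<phi> x) * (\<Sum>i\<in>UNIV. (\<Sum>j\<in>UNIV. \<Lambda> x $ i $ j * n $ j) * n $ i))"
    by (simp add: f_def fun_eq_iff inner_vec_def matrix_vector_mult_def)
  have cl: "x \<in> closure K" if "x \<in> \<sigma>" for x using \<sigma>K that by (auto simp: frontier_def)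
  have lim: "\<exists>l. ess_limit K f x l" if x: "x \<in> \<sigma>" for x
  proof -
    obtain r where r: "r > 0" "\<And>y. y \<in> ball x r \<Longrightarrow> y \<in> K \<longleftrightarrow> n \<bullet> (y - x) < 0"
      using half[OF x] unfolding halfspace_at_def by blast
    \<comment> \<open>A half-ball: convex, as the Lipschitz estimate requires, and contained both in
      \<open>K\<close>, where \<open>\<Lambda>\<close> is regular, and in \<open>\<Omega>\<close>,
      where \<open>\<phi>\<close> is.\<close>
    define C where "C = K \<inter> ball x r"
    have "C = ball x r \<inter> {y. n \<bullet> y < n \<bullet> x}"
      using r(2) by (auto simp: C_def inner_diff_right)
    then have "convex C" by (simp add: convex_Int convex_halfspace_lt)
    moreover have "open C" "bounded C" "C \<subseteq> K" using K(1) by (auto simp: C_def bounded_Int)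
    moreover have xC: "x \<in> closure C"
      using cl[OF x] open_Int_closure_subset[of "ball x r" K] r(1) by (auto simp: C_def Int_commute)
    ultimately have W: "\<exists>l. ess_limit C g x l" if "W1inf S g" "open S" "K \<subseteq> S" for g S
      using that ess_limit_W1inf[of S g C x] by blast
    have C: "open C" by fact
    obtain a where a: "ess_limit C \<phi> x a" using W[OF \<phi> \<Omega> K(2)] by blast
    have "\<forall>i j. \<exists>l. ess_limit C (\<lambda>x. \<Lambda> x $ i $ j) x l" using W[OF \<Lambda> K(1) order_refl] by blast
    then obtain l where l: "\<And>i j. ess_limit C (\<lambda>x. \<Lambda> x $ i $ j) x (l i j)" by metis
    have "ess_limit C f x (exp (- a) * (\<Sum>i\<in>UNIV. (\<Sum>j\<in>UNIV. l i j * n $ j) * n $ i))"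
      using a l unfolding f_eq ess_limit_iff_tendsto[OF C] by (intro tendsto_intros)
    then show ?thesis
      using ess_limit_localize[OF _ C K(1) r(1)] by (auto simp: C_def)
  qed
  define T where "T = trace_from K f"
  have T: "ess_limit K f x (T x)" if "x \<in> \<sigma>" for x
    using lim[OF that] trace_from_eq[OF K(1) cl[OF that]] by (auto simp: T_def)
  have contT: "continuous_on \<sigma> T"
    by (rule trace_continuous_on[OF K(1) _ T]) (use cl in auto)
  obtain C\<phi> where C\<phi>: "AE x in lebesgue_on \<Omega>. \<bar>\<phi> x\<bar> \<le> C\<phi>" using \<phi> by (auto simp: W1inf_def Linf_def)
  have "bdd_meas (lebesgue_on K) f"
  proof -
    have "Linf K \<phi>" using \<phi> Linf_subset[OF _ \<Omega> K] by (simp add: W1inf_def)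
    then show ?thesis
      using \<Lambda> unfolding f_eq W1inf_def Linf_eq_bdd_meas
      by (intro bdd_meas_mult bdd_meas_exp bdd_meas_sum bdd_meas_const) auto
  qed
  then obtain B where B: "AE x in lebesgue_on K. \<bar>f x\<bar> \<le> B" by (auto simp: bdd_meas_def)
  \<comment> \<open>\<open>exp (- C\<phi>)\<close> bounds the exponential weight from below, and
    \<open>lam\<close> the coefficient in the unit direction \<open>n\<close>.\<close>
  define b where "b = exp (- C\<phi>) * lam"
  have "AE x in lebesgue_on K. b \<le> f x \<and> f x \<le> B"
    using AE_lebesgue_on_subset[OF C\<phi> \<Omega> K] AE_lebesgue_on_subset[OF ell(2) \<Omega> K] B
  proof eventually_elim
    case (elim x)
    have "exp (- C\<phi>) \<le> exp (- \<phi> x)" using elim(1) by simp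
    moreover have "lam \<le> (\<Lambda> x *v n) \<bullet> n" using elim(2)[rule_format, of n] norm_n by simp
    ultimately have "b \<le> f x" unfolding b_def f_def using ell(1) by (intro mult_mono) auto
    then show ?case using elim(3) by simp
  qed
  then have "AE y in lebesgue_on (K \<inter> ball x 1). b \<le> f y \<and> f y \<le> B" for x
    by (rule AE_lebesgue_on_subset) (use K(1) in auto)
  then have "b \<le> T x \<and> T x \<le> B" if "x \<in> \<sigma>" for x
    using ess_limit_bounds[OF K(1) cl[OF that] T[OF that] zero_less_one] by blast
  moreover have "b > 0" using ell(1) by (simp add: b_def)
  ultimately show ?thesis
    using Linf_norm_pos[OF contT] unfolding face_weight_def Let_def nrm T_def f_def[abs_def] by blast
qed

section \<open>The scheme\<close>

text \<open>The coefficients enter the linear algebra through signs and bounds: mass and jump terms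
  supply definiteness, for which the face weights must be positive, while the gradient term has to
  be nonnegative.\<close>

locale hybrid_scheme =
  fixes \<Omega> :: "(real^'d) set" and \<M> \<E> :: "(real^'d) set set" and \<E>K :: "(real^'d) set \<Rightarrow> (real^'d) set set"
    and k :: nat and \<omega> :: "real^'d \<Rightarrow> real" and \<Lambda> :: "real^'d \<Rightarrow> real^'d^'d"
  assumes dim: "2 \<le> CARD('d)" and domain: "open \<Omega>" "bounded \<Omega>"
    and mesh: "discretisation \<Omega> \<M> \<E> \<E>K"
    and omega_pos: "\<And>x. 0 < \<omega> x" and omega_Linf: "Linf \<Omega> \<omega>"
    and Lambda_Linf: "\<And>i j. Linf \<Omega> (\<lambda>x. \<Lambda> x $ i $ j)"
    and elliptic: "AE x in lebesgue_on \<Omega>. \<forall>\<xi>. 0 \<le> (\<Lambda> x *v \<xi>) \<bullet> \<xi>"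
    and weight_pos: "\<And>K \<sigma>. \<lbrakk>K \<in> \<M>; \<sigma> \<in> \<E>K K\<rbrakk> \<Longrightarrow> 0 < face_weight \<omega> \<Lambda> K \<sigma>"
begin

abbreviation "diffusion \<equiv> diffusion_form \<M> \<E>K k \<omega> \<Lambda>"
abbreviation "hybrids \<equiv> hybrid_space \<M> \<E> k"
abbreviation "grad \<equiv> discrete_gradient \<E>K k"
abbreviation "solves \<equiv> solves_scheme \<M> \<E> \<E>K k \<omega> \<Lambda>"

lemma mesh_parts:
  shows finite_mesh: "finite \<M>" "finite \<E>"
    and disjoint_mesh: "disjoint \<M>" "disjoint \<E>"
    and mesh_cells: "\<forall>K\<in>\<M>. mesh_cell K \<and> K \<subseteq> \<Omega>"
    and mesh_cover: "closure \<Omega> = (\<Union>K\<in>\<M>. closure K)"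
    and mesh_faces: "\<forall>\<sigma>\<in>\<E>. mesh_face \<sigma> \<and> \<sigma> \<subseteq> closure \<Omega>"
    and skeleton: "(\<Union>K\<in>\<M>. frontier K) = (\<Union>\<sigma>\<in>\<E>. closure \<sigma>)"
    and faces_of_cell: "\<forall>K\<in>\<M>. \<E>K K \<subseteq> \<E> \<and> frontier K = (\<Union>\<sigma>\<in>\<E>K K. closure \<sigma>)"
  using mesh unfolding discretisation_def by - (elim conjE, assumption)+

lemma cell:
  assumes "K \<in> \<M>"
  shows "mesh_cell K" "open K" "bounded K" "K \<noteq> {}" "K \<subseteq> \<Omega>"
proof -
  have c: "mesh_cell K" "K \<subseteq> \<Omega>" using mesh_cells assms by auto
  then show "mesh_cell K" "open K" "K \<subseteq> \<Omega>" by (auto simp: mesh_cell_def)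
  show "bounded K" using c(2) domain(2) bounded_subset by blast
  show "K \<noteq> {}" using c(1) by (auto simp: mesh_cell_def)
qed

lemma face:
  assumes "\<sigma> \<in> \<E>"
  shows "mesh_face \<sigma>" "bounded \<sigma>"
proof -
  have c: "mesh_face \<sigma>" "\<sigma> \<subseteq> closure \<Omega>" using mesh_faces assms by blast+
  show "mesh_face \<sigma>" by (rule c(1))
  show "bounded \<sigma>" by (rule bounded_subset[OF bounded_closure[OF domain(2)] c(2)])
qed

lemma cell_faces:
  assumes "K \<in> \<M>"
  shows "\<E>K K \<subseteq> \<E>" "frontier K = (\<Union>\<sigma>\<in>\<E>K K. closure \<sigma>)" "finite (\<E>K K)"
proof -
  show "\<E>K K \<subseteq> \<E>" "frontier K = (\<Union>\<sigma>\<in>\<E>K K. closure \<sigma>)"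
    using faces_of_cell assms by blast+
  then show "finite (\<E>K K)" using finite_mesh(2) finite_subset by blast
qed

lemma cell_face:
  assumes "K \<in> \<M>" "\<sigma> \<in> \<E>K K"
  shows "\<sigma> \<in> \<E>" "\<sigma> \<subseteq> frontier K" "\<exists>c. flat_face \<sigma> (outward_normal K \<sigma>) c"
    "x \<in> \<sigma> \<Longrightarrow> halfspace_at K \<sigma> (outward_normal K \<sigma>) x"
proof -
  show \<sigma>: "\<sigma> \<in> \<E>" using cell_faces[OF assms(1)] assms(2) by auto
  show fr: "\<sigma> \<subseteq> frontier K" using cell_faces(2)[OF assms(1)] assms(2) closure_subset by blast
  show "\<exists>c. flat_face \<sigma> (outward_normal K \<sigma>) c" "x \<in> \<sigma> \<Longrightarrow> halfspace_at K \<sigma> (outward_normal K \<sigma>) x"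
    using flat_face_outward_normal[OF face[OF \<sigma>] cell(1)[OF assms(1)] fr] by auto
qed

text \<open>A face outside every \<open>\<E>K K\<close> would be disjoint from all faces of cells
  and so have a relatively open piece that their closures miss; but those closures cover the
  skeleton, which contains the face.\<close>

lemma face_belongs_to_cell:
  assumes \<sigma>: "\<sigma> \<in> \<E>" shows "\<exists>K\<in>\<M>. \<sigma> \<in> \<E>K K"
proof (rule ccontr)
  assume no: "\<not> ?thesis"
  define G where "G = (\<Union>K\<in>\<M>. \<E>K K)"
  have GE: "G \<subseteq> \<E>" using cell_faces(1) by (auto simp: G_def)
  obtain n c where "flat_face \<sigma> n c" using flat_face_of_mesh_face[OF face[OF \<sigma>]] by blast
  then interpret flat_face \<sigma> n c .
  have "\<sigma> \<inter> \<tau> = {}" if "\<tau> \<in> G" for \<tau>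
    using disjointD[OF disjoint_mesh(2) \<sigma> subsetD[OF GE that]] that no by (auto simp: G_def)
  moreover have "\<exists>n c. flat_face \<tau> n c" if "\<tau> \<in> G" for \<tau>
    using flat_face_of_mesh_face[OF face] GE that by blast
  ultimately obtain W where W: "W \<subseteq> \<sigma>" "W \<noteq> {}" "W \<inter> (\<Union>\<tau>\<in>G. closure \<tau>) = {}"
    using not_covered_by_disjoint_faces[of G] finite_subset[OF GE finite_mesh(2)] by blast
  have "\<sigma> \<subseteq> (\<Union>K\<in>\<M>. frontier K)"
    unfolding skeleton using \<sigma> closure_subset by blast
  also have "\<dots> = (\<Union>\<tau>\<in>G. closure \<tau>)"
    using cell_faces(2) by (auto simp: G_def)
  finally show False using W by blast
qed

lemma face_flat: "\<sigma> \<in> \<E> \<Longrightarrow> \<exists>n c. flat_face \<sigma> n c"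
  using flat_face_of_mesh_face face by blast

text \<open>\<open>gauss\<close> is a scalar identity; it is applied to each component of
  \<open>\<tau>\<close> in its own coordinate direction, and the results are summed.\<close>

lemma integral_divergence:
  assumes K: "K \<in> \<M>" and \<tau>: "\<tau> \<in> vec_polys q"
  shows "(LINT x|lebesgue_on K. divergence \<tau> x)
    = (\<Sum>\<sigma>\<in>\<E>K K. LINT x|face_measure \<sigma>. \<tau> x \<bullet> outward_normal K \<sigma>)"
proof -
  have "\<forall>\<sigma>\<in>\<E>K K. \<exists>c. flat_face \<sigma> (outward_normal K \<sigma>) c" using cell_face(3)[OF K] by blast
  then obtain c where c: "\<forall>\<sigma>\<in>\<E>K K. flat_face \<sigma> (outward_normal K \<sigma>) (c \<sigma>)" by metis
  interpret flat_cell K "\<E>K K" "outward_normal K" c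
  proof (rule flat_cell.intro)
    show "open K" "bounded K" by (fact cell[OF K])+
    show "finite (\<E>K K)" "frontier K = (\<Union>\<sigma>\<in>\<E>K K. closure \<sigma>)" by (fact cell_faces[OF K])+
    show "flat_face \<sigma> (outward_normal K \<sigma>) (c \<sigma>)" if "\<sigma> \<in> \<E>K K" for \<sigma> using c that by blast
    show "halfspace_at K \<sigma> (outward_normal K \<sigma>) x" if "\<sigma> \<in> \<E>K K" "x \<in> \<sigma>" for \<sigma> x
      using cell_face(4)[OF K that] .
    show "disjoint (\<E>K K)"
      using disjoint_mesh(2) cell_faces(1)[OF K] unfolding disjoint_def by blast
    show "lipschitz_boundary \<sigma>" if "\<sigma> \<in> \<E>K K" for \<sigma>
      using face(1)[OF cell_face(1)[OF K that]] by (simp add: mesh_face_def)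
  qed
  have C1: "C1_fun (\<lambda>x. \<tau> x $ i)" for i by (rule C1_fun_polys[OF vec_polys_component[OF \<tau>]])
  have intK: "integrable (lebesgue_on K) (partial i (\<lambda>x. \<tau> x $ i))" for i
    by (rule integrable_cell[OF cell(2-4)[OF K] C1_fun_partial(1)[OF C1]])
  have "(LINT x|lebesgue_on K. divergence \<tau> x) = (\<Sum>i\<in>UNIV. LINT x|lebesgue_on K. partial i (\<lambda>x. \<tau> x $ i) x)"
    using intK by (simp add: divergence_vec_polys[OF \<tau>])
  also have "\<dots> = (\<Sum>i\<in>UNIV. \<Sum>\<sigma>\<in>\<E>K K. (outward_normal K \<sigma> \<bullet> axis i 1) * (LINT x|face_measure \<sigma>. \<tau> x $ i))"
  proof (rule sum.cong[OF refl])
    fix i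
    have [measurable]: "partial i (\<lambda>x. \<tau> x $ i) \<in> borel_measurable borel"
      by (rule borel_measurable_continuous_onI[OF C1_fun_partial(1)[OF C1]])
    have "(LINT x|lebesgue_on K. partial i (\<lambda>x. \<tau> x $ i) x) = (LINT x|lborel. indicator K x * partial i (\<lambda>x. \<tau> x $ i) x)"
    proof (rule integral_lebesgue_on_eq_lborel)
      show "partial i (\<lambda>x. \<tau> x $ i) \<in> borel_measurable (lebesgue_on K)"
        using intK by (rule borel_measurable_integrable)
    qed (use open_K in auto)
    also have "\<dots> = (\<Sum>\<sigma>\<in>\<E>K K. (outward_normal K \<sigma> \<bullet> axis i 1) * (LINT x|face_measure \<sigma>. \<tau> x $ i))"
      unfolding partial_def by (rule gauss[OF C1])
    finally show "(LINT x|lebesgue_on K. partial i (\<lambda>x. \<tau> x $ i) x)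
        = (\<Sum>\<sigma>\<in>\<E>K K. (outward_normal K \<sigma> \<bullet> axis i 1) * (LINT x|face_measure \<sigma>. \<tau> x $ i))" .
  qed
  also have "\<dots> = (\<Sum>\<sigma>\<in>\<E>K K. \<Sum>i\<in>UNIV. (outward_normal K \<sigma> \<bullet> axis i 1) * (LINT x|face_measure \<sigma>. \<tau> x $ i))"
    by (rule sum.swap)
  also have "\<dots> = (\<Sum>\<sigma>\<in>\<E>K K. LINT x|face_measure \<sigma>. \<tau> x \<bullet> outward_normal K \<sigma>)"
  proof (rule sum.cong[OF refl])
    fix \<sigma> assume "\<sigma> \<in> \<E>K K"
    then have "integrable (face_measure \<sigma>) (\<lambda>x. \<tau> x $ i)" for i
      using flat_face.integrable_face[OF _ C1_fun_continuous[OF C1] refl] c by blast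
    then have "(\<Sum>i\<in>UNIV. (outward_normal K \<sigma> \<bullet> axis i 1) * (LINT x|face_measure \<sigma>. \<tau> x $ i))
        = (LINT x|face_measure \<sigma>. (\<Sum>i\<in>UNIV. (outward_normal K \<sigma> \<bullet> axis i 1) * \<tau> x $ i))"
      by simp
    also have "(\<lambda>x. \<Sum>i\<in>UNIV. (outward_normal K \<sigma> \<bullet> axis i 1) * \<tau> x $ i) = (\<lambda>x. \<tau> x \<bullet> outward_normal K \<sigma>)"
      by (simp add: inner_vec_def[of "\<tau> _"] inner_axis mult.commute)
    finally show "(\<Sum>i\<in>UNIV. (outward_normal K \<sigma> \<bullet> axis i 1) * (LINT x|face_measure \<sigma>. \<tau> x $ i))
        = (LINT x|face_measure \<sigma>. \<tau> x \<bullet> outward_normal K \<sigma>)" .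
  qed
  finally show ?thesis .
qed

text \<open>All forms make sense for families of functions that are polynomial where they are used; what
  happens off the mesh is irrelevant, which is the relation \<open>agree\<close>.  This larger set is a vector
  space for the pointwise operations, unlike the space of extensional families.\<close>

definition broken :: "'d hybrid set" where
  "broken = {v. (\<forall>K\<in>\<M>. fst v K \<in> polys (k + 1)) \<and> (\<forall>\<sigma>\<in>\<E>. \<exists>p\<in>polys k. \<forall>x\<in>\<sigma>. snd v \<sigma> x = p x)}"

definition agree :: "'d hybrid \<Rightarrow> 'd hybrid \<Rightarrow> bool" where
  "agree u v \<longleftrightarrow> (\<forall>K\<in>\<M>. fst u K = fst v K) \<and> (\<forall>\<sigma>\<in>\<E>. \<forall>x\<in>\<sigma>. snd u \<sigma> x = snd v \<sigma> x)"

lemma subspace_broken: "subspace broken"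
proof (rule subspaceI)
  show "0 \<in> broken"
    using const_in_polys[of 0] by (auto simp: broken_def zero_fun_def intro!: bexI[of _ "\<lambda>_. 0"])
  show "u + v \<in> broken" if "u \<in> broken" "v \<in> broken" for u v
  proof -
    have "\<exists>p\<in>polys k. \<forall>x\<in>\<sigma>. snd (u + v) \<sigma> x = p x" if \<sigma>: "\<sigma> \<in> \<E>" for \<sigma>
    proof -
      obtain p q where "p \<in> polys k" "\<forall>x\<in>\<sigma>. snd u \<sigma> x = p x" "q \<in> polys k" "\<forall>x\<in>\<sigma>. snd v \<sigma> x = q x"
        using \<open>u \<in> broken\<close> \<open>v \<in> broken\<close> \<sigma> unfolding broken_def by blast
      then show ?thesis by (intro bexI[of _ "p + q"] subspace_add[OF subspace_polys]) auto
    qed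
    then show ?thesis
      using that by (auto simp: broken_def intro: subspace_add[OF subspace_polys])
  qed
  show "c *\<^sub>R v \<in> broken" if "v \<in> broken" for c v
  proof -
    have "\<exists>p\<in>polys k. \<forall>x\<in>\<sigma>. snd (c *\<^sub>R v) \<sigma> x = p x" if \<sigma>: "\<sigma> \<in> \<E>" for \<sigma>
    proof -
      obtain p where "p \<in> polys k" "\<forall>x\<in>\<sigma>. snd v \<sigma> x = p x"
        using \<open>v \<in> broken\<close> \<sigma> unfolding broken_def by blast
      then show ?thesis by (intro bexI[of _ "c *\<^sub>R p"] subspace_scale[OF subspace_polys]) auto
    qed
    then show ?thesis
      using that by (auto simp: broken_def intro: subspace_scale[OF subspace_polys])
  qed
qed

lemma broken_cell: "v \<in> broken \<Longrightarrow> K \<in> \<M> \<Longrightarrow> fst v K \<in> polys (k + 1)"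
  by (simp add: broken_def)

lemma continuous_on_broken: "v \<in> broken \<Longrightarrow> K \<in> \<M> \<Longrightarrow> continuous_on S (fst v K)"
  using broken_cell continuous_on_polys by blast

lemma broken_face: "v \<in> broken \<Longrightarrow> \<sigma> \<in> \<E> \<Longrightarrow> \<exists>p\<in>polys k. \<forall>x\<in>\<sigma>. snd v \<sigma> x = p x"
  by (simp add: broken_def)

lemma hybrid_in_broken: "v \<in> hybrids \<Longrightarrow> v \<in> broken"
  by (fastforce simp: hybrid_space_def broken_def polys_on_def PiE_iff)

text \<open>For \<open>v\<close> in \<open>broken\<close>, the one element of the extensional space
  that agrees with it.\<close>

definition to_hybrid :: "'d hybrid \<Rightarrow> 'd hybrid" where
  "to_hybrid v = (restrict (fst v) \<M>, \<lambda>\<sigma>\<in>\<E>. restrict (snd v \<sigma>) \<sigma>)"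

lemma agree_to_hybrid: "agree (to_hybrid v) v"
  by (auto simp: agree_def to_hybrid_def)

lemma to_hybrid_in:
  assumes "v \<in> broken" shows "to_hybrid v \<in> hybrids"
proof -
  have "restrict (snd v \<sigma>) \<sigma> \<in> polys_on k \<sigma>" if \<sigma>: "\<sigma> \<in> \<E>" for \<sigma>
  proof -
    obtain p where "p \<in> polys k" "\<forall>x\<in>\<sigma>. snd v \<sigma> x = p x" using broken_face[OF assms \<sigma>] by blast
    then have "restrict (snd v \<sigma>) \<sigma> = restrict p \<sigma>" by (auto simp: fun_eq_iff restrict_def)
    then show ?thesis using \<open>p \<in> polys k\<close> by (simp add: polys_on_def)
  qed
  then show ?thesis
    using broken_cell[OF assms] by (auto simp: hybrid_space_def to_hybrid_def)
qed

lemma agree_hybrid_eq: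
  assumes "u \<in> hybrids" "v \<in> hybrids" "agree u v"
  shows "u = v"
proof (rule prod_eqI)
  show "fst u = fst v"
    using assms by (intro PiE_ext[of _ \<M>]) (auto simp: hybrid_space_def agree_def)
  have "snd u \<sigma> = snd v \<sigma>" if "\<sigma> \<in> \<E>" for \<sigma>
  proof -
    have "snd u \<sigma> \<in> polys_on k \<sigma>" "snd v \<sigma> \<in> polys_on k \<sigma>"
      using assms that by (auto simp: hybrid_space_def)
    then show ?thesis
      using assms(3) that by (auto simp: polys_on_def agree_def fun_eq_iff restrict_def)
  qed
  then show "snd u = snd v"
    using assms by (intro PiE_ext[of _ \<E>]) (auto simp: hybrid_space_def)
qed

section \<open>Linearity of the discrete operators\<close>

abbreviation flux :: "(real^'d) set \<Rightarrow> 'd hybrid \<Rightarrow> (real^'d \<Rightarrow> real^'d) \<Rightarrow> real" where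
  "flux K v \<tau> \<equiv> - (LINT x|lebesgue_on K. fst v K x * divergence \<tau> x) +
    (\<Sum>\<sigma>\<in>\<E>K K. LINT x|face_measure \<sigma>. snd v \<sigma> x * (\<tau> x \<bullet> outward_normal K \<sigma>))"

lemma integrable_cell_flux:
  assumes "v \<in> broken" "K \<in> \<M>" "\<tau> \<in> vec_polys k"
  shows "integrable (lebesgue_on K) (\<lambda>x. fst v K x * divergence \<tau> x)"
  by (intro integrable_cell[OF cell(2-4)[OF assms(2)]] continuous_intros continuous_on_broken assms
      continuous_on_divergence_vec_polys[OF assms(3)])

lemma integrable_face_flux:
  assumes "v \<in> broken" "\<sigma> \<in> \<E>" "\<tau> \<in> vec_polys k"
  shows "integrable (face_measure \<sigma>) (\<lambda>x. snd v \<sigma> x * (\<tau> x \<bullet> n))"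
proof -
  obtain n' c where "flat_face \<sigma> n' c" using face_flat[OF assms(2)] by blast
  moreover obtain p where "p \<in> polys k" "\<forall>x\<in>\<sigma>. snd v \<sigma> x = p x" using broken_face[OF assms(1,2)] by blast
  moreover have "continuous_on UNIV (\<lambda>x. p x * (\<tau> x \<bullet> n))"
    by (intro continuous_intros continuous_on_polys[OF \<open>p \<in> polys k\<close>] continuous_on_vec_polys[OF assms(3)])
  ultimately show ?thesis by (intro flat_face.integrable_face) auto
qed

lemma flux_linear:
  assumes "v \<in> broken" "K \<in> \<M>" "\<sigma> \<in> vec_polys k" "\<tau> \<in> vec_polys k"
  shows "flux K v (\<sigma> + c *\<^sub>R \<tau>) = flux K v \<sigma> + c * flux K v \<tau>"
proof -
  have "(\<Sum>s\<in>\<E>K K. LINT x|face_measure s. snd v s x * ((\<sigma> + c *\<^sub>R \<tau>) x \<bullet> outward_normal K s))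
      = (\<Sum>s\<in>\<E>K K. (LINT x|face_measure s. snd v s x * (\<sigma> x \<bullet> outward_normal K s))
          + c * (LINT x|face_measure s. snd v s x * (\<tau> x \<bullet> outward_normal K s)))"
  proof (rule sum.cong[OF refl])
    fix s assume "s \<in> \<E>K K"
    then have s: "s \<in> \<E>" using cell_face(1)[OF assms(2)] by blast
    show "(LINT x|face_measure s. snd v s x * ((\<sigma> + c *\<^sub>R \<tau>) x \<bullet> outward_normal K s))
      = (LINT x|face_measure s. snd v s x * (\<sigma> x \<bullet> outward_normal K s))
          + c * (LINT x|face_measure s. snd v s x * (\<tau> x \<bullet> outward_normal K s))"
      using integrable_face_flux[OF assms(1) s assms(3)] integrable_face_flux[OF assms(1) s assms(4)]
      by (simp add: inner_add_left distrib_left mult.left_commute[of _ c])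
  qed
  moreover have "(LINT x|lebesgue_on K. fst v K x * divergence (\<sigma> + c *\<^sub>R \<tau>) x)
      = (LINT x|lebesgue_on K. fst v K x * divergence \<sigma> x) + c * (LINT x|lebesgue_on K. fst v K x * divergence \<tau> x)"
    using integrable_cell_flux[OF assms(1,2,3)] integrable_cell_flux[OF assms(1,2,4)]
    by (simp add: divergence_linear[OF assms(3,4)] distrib_left mult.left_commute[of _ c])
  ultimately show ?thesis
    by (simp add: sum.distrib sum_distrib_left algebra_simps)
qed

lemma flux_linear_left:
  assumes "u \<in> broken" "v \<in> broken" "K \<in> \<M>" "\<tau> \<in> vec_polys k"
  shows "flux K (u + c *\<^sub>R v) \<tau> = flux K u \<tau> + c * flux K v \<tau>"
proof -
  have "(\<Sum>s\<in>\<E>K K. LINT x|face_measure s. snd (u + c *\<^sub>R v) s x * (\<tau> x \<bullet> outward_normal K s))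
      = (\<Sum>s\<in>\<E>K K. (LINT x|face_measure s. snd u s x * (\<tau> x \<bullet> outward_normal K s))
          + c * (LINT x|face_measure s. snd v s x * (\<tau> x \<bullet> outward_normal K s)))"
  proof (rule sum.cong[OF refl])
    fix s assume "s \<in> \<E>K K"
    then have s: "s \<in> \<E>" using cell_face(1)[OF assms(3)] by blast
    show "(LINT x|face_measure s. snd (u + c *\<^sub>R v) s x * (\<tau> x \<bullet> outward_normal K s))
      = (LINT x|face_measure s. snd u s x * (\<tau> x \<bullet> outward_normal K s))
          + c * (LINT x|face_measure s. snd v s x * (\<tau> x \<bullet> outward_normal K s))"
      using integrable_face_flux[OF assms(1) s assms(4)] integrable_face_flux[OF assms(2) s assms(4)]
      by (simp add: distrib_right mult.assoc)
  qed
  moreover have "(LINT x|lebesgue_on K. fst (u + c *\<^sub>R v) K x * divergence \<tau> x)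
      = (LINT x|lebesgue_on K. fst u K x * divergence \<tau> x) + c * (LINT x|lebesgue_on K. fst v K x * divergence \<tau> x)"
    using integrable_cell_flux[OF assms(1,3,4)] integrable_cell_flux[OF assms(2,3,4)]
    by (simp add: distrib_right mult.assoc)
  ultimately show ?thesis
    by (simp add: sum.distrib sum_distrib_left algebra_simps)
qed

lemma discrete_gradient_spec:
  assumes "v \<in> broken" "K \<in> \<M>"
  shows "grad K v \<in> vec_polys k"
    and "\<tau> \<in> vec_polys k \<Longrightarrow> (LINT x|lebesgue_on K. grad K v x \<bullet> \<tau> x) = flux K v \<tau>"
  using theI'[OF riesz_vec_polys[OF cell(2-4)[OF assms(2)], where L = "flux K v", OF flux_linear[OF assms]],
      folded discrete_gradient_def] by blast+

text \<open>Every computation of a gradient goes through this: linearity, and the zero gradient of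
  constants.\<close>

lemma discrete_gradient_unique:
  assumes "v \<in> broken" "K \<in> \<M>" "G \<in> vec_polys k"
    and "\<And>\<tau>. \<tau> \<in> vec_polys k \<Longrightarrow> (LINT x|lebesgue_on K. G x \<bullet> \<tau> x) = flux K v \<tau>"
  shows "grad K v = G"
  unfolding discrete_gradient_def
  by (rule the1_equality[OF riesz_vec_polys[OF cell(2-4)[OF assms(2)], where L = "flux K v", OF flux_linear[OF assms(1,2)]]])
    (assumption, assumption, intro conjI ballI assms(3,4))

lemma discrete_gradient_linear:
  assumes "u \<in> broken" "v \<in> broken" "K \<in> \<M>"
  shows "grad K (u + c *\<^sub>R v) = grad K u + c *\<^sub>R grad K v"
proof (rule discrete_gradient_unique[OF _ assms(3)])
  let ?G = "grad K"
  show "u + c *\<^sub>R v \<in> broken"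
    using assms by (intro subspace_add[OF subspace_broken] subspace_scale[OF subspace_broken])
  have G: "?G u \<in> vec_polys k" "?G v \<in> vec_polys k" using discrete_gradient_spec(1) assms by auto
  then show "?G u + c *\<^sub>R ?G v \<in> vec_polys k"
    by (intro subspace_add[OF subspace_vec_polys] subspace_scale[OF subspace_vec_polys])
  fix \<tau> :: "real^'d \<Rightarrow> real^'d" assume \<tau>: "\<tau> \<in> vec_polys k"
  have int: "integrable (lebesgue_on K) (\<lambda>x. H x \<bullet> \<tau> x)" if "H \<in> vec_polys k" for H
    by (intro integrable_cell[OF cell(2-4)[OF assms(3)]] continuous_intros continuous_on_vec_polys[OF that]
        continuous_on_vec_polys[OF \<tau>])
  have "(LINT x|lebesgue_on K. (?G u + c *\<^sub>R ?G v) x \<bullet> \<tau> x) = flux K u \<tau> + c * flux K v \<tau>"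
    using int[OF G(1)] int[OF G(2)] discrete_gradient_spec(2)[OF assms(1,3) \<tau>] discrete_gradient_spec(2)[OF assms(2,3) \<tau>]
    by (simp add: inner_add_left)
  then show "(LINT x|lebesgue_on K. (?G u + c *\<^sub>R ?G v) x \<bullet> \<tau> x) = flux K (u + c *\<^sub>R v) \<tau>"
    by (simp only: flux_linear_left[OF assms \<tau>])
qed

lemma discrete_gradient_cong:
  assumes "agree u v" "K \<in> \<M>"
  shows "grad K u = grad K v"
proof -
  have "(LINT x|face_measure s. snd u s x * (\<tau> x \<bullet> n)) = (LINT x|face_measure s. snd v s x * (\<tau> x \<bullet> n))"
    if "s \<in> \<E>K K" for s and \<tau> :: "real^'d \<Rightarrow> real^'d" and n
  proof (rule Bochner_Integration.integral_cong[OF refl])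
    fix x assume "x \<in> space (face_measure s)"
    then have "x \<in> s" by (simp add: face_measure_def space_restrict_space)
    then show "snd u s x * (\<tau> x \<bullet> n) = snd v s x * (\<tau> x \<bullet> n)"
      using assms cell_face(1)[OF assms(2) that] by (simp add: agree_def)
  qed
  then show ?thesis
    using assms unfolding discrete_gradient_def by (simp add: agree_def cong: sum.cong)
qed

lemma face_jump_linear:
  assumes "u \<in> broken" "v \<in> broken" "K \<in> \<M>" "\<sigma> \<in> \<E>" "x \<in> \<sigma>"
  shows "face_jump k K \<sigma> (u + c *\<^sub>R v) x = face_jump k K \<sigma> u x + c * face_jump k K \<sigma> v x"
proof -
  obtain n b where "flat_face \<sigma> n b" using face_flat[OF assms(4)] by blast
  from face_projection_linear[OF this continuous_on_broken[OF assms(1,3)] continuous_on_broken[OF assms(2,3)] assms(5)]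
  show ?thesis by (simp add: face_jump_def algebra_simps)
qed

lemma face_jump_poly:
  assumes "v \<in> broken" "K \<in> \<M>" "\<sigma> \<in> \<E>"
  shows "\<exists>p\<in>polys k. \<forall>x\<in>\<sigma>. face_jump k K \<sigma> v x = p x"
proof -
  obtain n b where "flat_face \<sigma> n b" using face_flat[OF assms(3)] by blast
  from face_projection_exists[OF this continuous_on_broken[OF assms(1,2)]]
  obtain p where p: "p \<in> polys k" "face_projection k \<sigma> (fst v K) = restrict p \<sigma>" by blast
  obtain q where q: "q \<in> polys k" "\<forall>x\<in>\<sigma>. snd v \<sigma> x = q x" using broken_face[OF assms(1,3)] by blast
  have "p + (-1) *\<^sub>R q \<in> polys k"
    using p q by (intro subspace_add[OF subspace_polys] subspace_scale[OF subspace_polys])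
  then show ?thesis using p q by (intro bexI[of _ "p + (-1) *\<^sub>R q"]) (auto simp: face_jump_def)
qed

lemma face_jump_cong:
  assumes "agree u v" "K \<in> \<M>" "\<sigma> \<in> \<E>" "x \<in> \<sigma>"
  shows "face_jump k K \<sigma> u x = face_jump k K \<sigma> v x"
  using assms by (simp add: agree_def face_jump_def)

definition cell_part :: "(real^'d) set \<Rightarrow> 'd hybrid \<Rightarrow> 'd hybrid \<Rightarrow> real" where
  "cell_part K u v = (LINT x|lebesgue_on K.
     \<omega> x * ((\<Lambda> x *v grad K u x) \<bullet> grad K v x))"

definition face_part :: "(real^'d) set \<Rightarrow> (real^'d) set \<Rightarrow> 'd hybrid \<Rightarrow> 'd hybrid \<Rightarrow> real" where
  "face_part K \<sigma> u v = (LINT x|face_measure \<sigma>. face_jump k K \<sigma> u x * face_jump k K \<sigma> v x)"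

lemma diffusion_form_eq: "diffusion u v
    = (\<Sum>K\<in>\<M>. cell_part K u v + (\<Sum>\<sigma>\<in>\<E>K K. face_weight \<omega> \<Lambda> K \<sigma> / diameter \<sigma> * face_part K \<sigma> u v))"
  by (simp add: diffusion_form_def cell_part_def face_part_def)

lemma integrable_cell_part:
  assumes K: "K \<in> \<M>" and G: "G \<in> vec_polys k" "H \<in> vec_polys k"
  shows "integrable (lebesgue_on K) (\<lambda>x. \<omega> x * ((\<Lambda> x *v G x) \<bullet> H x))"
proof (rule bdd_meas_integrable[OF finite_measure_cell[OF cell(2,3)[OF K]]])
  have \<omega>: "bdd_meas (lebesgue_on K) \<omega>" and \<Lambda>: "bdd_meas (lebesgue_on K) (\<lambda>x. \<Lambda> x $ i $ j)" for i j
    using Linf_subset[OF omega_Linf domain(1) cell(2,5)[OF K]] Linf_subset[OF Lambda_Linf domain(1) cell(2,5)[OF K]]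
    by (simp_all add: Linf_eq_bdd_meas)
  have comp: "bdd_meas (lebesgue_on K) (\<lambda>x. H x $ i)" if "H \<in> vec_polys k" for i and H :: "real^'d \<Rightarrow> real^'d"
    by (rule bdd_meas_continuous_cell[OF cell(2,3)[OF K] continuous_on_polys[OF vec_polys_component[OF that]]])
  have "bdd_meas (lebesgue_on K) (\<lambda>x. \<omega> x * (\<Sum>i\<in>UNIV. (\<Sum>j\<in>UNIV. \<Lambda> x $ i $ j * G x $ j) * H x $ i))"
    by (intro bdd_meas_mult bdd_meas_sum \<omega> \<Lambda> comp[OF G(1)] comp[OF G(2)])
  then show "bdd_meas (lebesgue_on K) (\<lambda>x. \<omega> x * ((\<Lambda> x *v G x) \<bullet> H x))"
    by (simp add: inner_vec_def matrix_vector_mult_def)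
qed

lemma cell_part_linear:
  assumes "u \<in> broken" "v \<in> broken" "w \<in> broken" "K \<in> \<M>"
  shows "cell_part K (u + c *\<^sub>R v) w = cell_part K u w + c * cell_part K v w"
    and "cell_part K w (u + c *\<^sub>R v) = cell_part K w u + c * cell_part K w v"
proof -
  note int = integrable_cell_part[OF assms(4) discrete_gradient_spec(1)[OF _ assms(4)] discrete_gradient_spec(1)[OF _ assms(4)]]
  show "cell_part K (u + c *\<^sub>R v) w = cell_part K u w + c * cell_part K v w"
    using int[OF assms(1,3)] int[OF assms(2,3)]
    by (simp add: cell_part_def discrete_gradient_linear[OF assms(1,2,4)] matrix_vector_right_distrib
        matrix_vector_mult_scaleR inner_add_left distrib_left mult.left_commute[of _ c])
  show "cell_part K w (u + c *\<^sub>R v) = cell_part K w u + c * cell_part K w v"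
    using int[OF assms(3,1)] int[OF assms(3,2)]
    by (simp add: cell_part_def discrete_gradient_linear[OF assms(1,2,4)]
        inner_add_right distrib_left mult.left_commute[of _ c])
qed

lemma face_part_commute: "face_part K \<sigma> u v = face_part K \<sigma> v u"
  by (simp add: face_part_def mult.commute)

lemma face_part_linear:
  assumes "u \<in> broken" "v \<in> broken" "w \<in> broken" "K \<in> \<M>" "\<sigma> \<in> \<E>K K"
  shows "face_part K \<sigma> (u + c *\<^sub>R v) w = face_part K \<sigma> u w + c * face_part K \<sigma> v w"
proof -
  have \<sigma>: "\<sigma> \<in> \<E>" using cell_face(1)[OF assms(4,5)] .
  obtain n b where "flat_face \<sigma> n b" using face_flat[OF \<sigma>] by blast
  then interpret flat_face \<sigma> n b .
  have int: "integrable (face_measure \<sigma>) (\<lambda>x. face_jump k K \<sigma> u' x * face_jump k K \<sigma> w x)" if u': "u' \<in> broken" for u'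
  proof -
    obtain p q where "p \<in> polys k" "\<forall>x\<in>\<sigma>. face_jump k K \<sigma> u' x = p x" "q \<in> polys k" "\<forall>x\<in>\<sigma>. face_jump k K \<sigma> w x = q x"
      using face_jump_poly[OF u' assms(4) \<sigma>] face_jump_poly[OF assms(3,4) \<sigma>] by blast
    moreover then have "continuous_on UNIV (\<lambda>x. p x * q x)"
      by (intro continuous_intros continuous_on_polys)
    ultimately show ?thesis by (intro integrable_face) auto
  qed
  have "face_part K \<sigma> (u + c *\<^sub>R v) w = (LINT x|face_measure \<sigma>. face_jump k K \<sigma> u x * face_jump k K \<sigma> w x
      + c * (face_jump k K \<sigma> v x * face_jump k K \<sigma> w x))"
    unfolding face_part_def
    by (intro Bochner_Integration.integral_cong refl)
      (simp add: face_jump_linear[OF assms(1,2,4) \<sigma>] distrib_right mult.assoc)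
  then show ?thesis using int[OF assms(1)] int[OF assms(2)] by (simp add: face_part_def)
qed

lemma diffusion_form_linear:
  assumes "u \<in> broken" "v \<in> broken" "w \<in> broken"
  shows "diffusion (u + c *\<^sub>R v) w = diffusion u w + c * diffusion v w"
    and "diffusion w (u + c *\<^sub>R v) = diffusion w u + c * diffusion w v"
proof -
  show "diffusion (u + c *\<^sub>R v) w = diffusion u w + c * diffusion v w"
    unfolding diffusion_form_eq sum_distrib_left sum.distrib[symmetric]
    by (intro sum.cong refl) (simp add: cell_part_linear[OF assms] face_part_linear[OF assms]
        sum.distrib sum_distrib_left algebra_simps)
  show "diffusion w (u + c *\<^sub>R v) = diffusion w u + c * diffusion w v"
    unfolding diffusion_form_eq sum_distrib_left sum.distrib[symmetric] face_part_commute[of _ _ w]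
    by (intro sum.cong refl) (simp add: cell_part_linear[OF assms] face_part_linear[OF assms]
        sum.distrib sum_distrib_left algebra_simps)
qed

lemma diffusion_form_cong:
  assumes "agree u u'" "agree v v'"
  shows "diffusion u v = diffusion u' v'"
proof -
  have "face_part K \<sigma> u v = face_part K \<sigma> u' v'" if "K \<in> \<M>" "\<sigma> \<in> \<E>K K" for K \<sigma>
    unfolding face_part_def
  proof (rule Bochner_Integration.integral_cong[OF refl])
    fix x assume "x \<in> space (face_measure \<sigma>)"
    then have "x \<in> \<sigma>" by (simp add: face_measure_def space_restrict_space)
    then show "face_jump k K \<sigma> u x * face_jump k K \<sigma> v x = face_jump k K \<sigma> u' x * face_jump k K \<sigma> v' x"
      using face_jump_cong[OF assms(1) that(1) cell_face(1)[OF that]] face_jump_cong[OF assms(2) that(1) cell_face(1)[OF that]]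
      by simp
  qed
  moreover have "cell_part K u v = cell_part K u' v'" if "K \<in> \<M>" for K
    using discrete_gradient_cong[OF assms(1) that] discrete_gradient_cong[OF assms(2) that] by (simp add: cell_part_def)
  ultimately show ?thesis by (simp add: diffusion_form_eq cong: sum.cong)
qed

lemma cell_part_nonneg:
  assumes "K \<in> \<M>" shows "0 \<le> cell_part K v v"
  unfolding cell_part_def
proof (rule integral_nonneg_AE)
  show "AE x in lebesgue_on K. 0 \<le> \<omega> x * ((\<Lambda> x *v grad K v x) \<bullet> grad K v x)"
    using AE_lebesgue_on_subset[OF elliptic domain(1) cell(2,5)[OF assms]]
    by eventually_elim (use omega_pos[THEN less_imp_le] in \<open>auto intro!: mult_nonneg_nonneg\<close>)
qed

lemma face_coefficient_pos:
  assumes "K \<in> \<M>" "\<sigma> \<in> \<E>K K" shows "0 < face_weight \<omega> \<Lambda> K \<sigma> / diameter \<sigma>"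
proof -
  obtain n b where "flat_face \<sigma> n b" using face_flat[OF cell_face(1)[OF assms]] by blast
  from flat_face.diameter_pos[OF this] show ?thesis using dim weight_pos[OF assms] by simp
qed

lemma face_part_nonneg: "0 \<le> face_part K \<sigma> v v"
  unfolding face_part_def by (intro integral_nonneg_AE) auto

lemma diffusion_form_nonneg: "0 \<le> diffusion v v"
  unfolding diffusion_form_eq
  by (intro sum_nonneg add_nonneg_nonneg cell_part_nonneg mult_nonneg_nonneg face_part_nonneg
      less_imp_le[OF face_coefficient_pos])

section \<open>Mass form and definiteness\<close>

definition mass_form :: "'d hybrid \<Rightarrow> 'd hybrid \<Rightarrow> real" where
  "mass_form u v = (\<Sum>K\<in>\<M>. LINT x|lebesgue_on K. \<omega> x * fst u K x * fst v K x)"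

lemma bdd_meas_broken: "v \<in> broken \<Longrightarrow> K \<in> \<M> \<Longrightarrow> bdd_meas (lebesgue_on K) (fst v K)"
  by (rule bdd_meas_continuous_cell[OF cell(2,3) continuous_on_broken])

lemma bdd_meas_omega: "K \<in> \<M> \<Longrightarrow> bdd_meas (lebesgue_on K) \<omega>"
  using Linf_subset[OF omega_Linf domain(1) cell(2,5)] by (simp add: Linf_eq_bdd_meas)

lemma integrable_mass:
  assumes "u \<in> broken" "v \<in> broken" "K \<in> \<M>"
  shows "integrable (lebesgue_on K) (\<lambda>x. \<omega> x * fst u K x * fst v K x)"
  by (intro bdd_meas_integrable[OF finite_measure_cell[OF cell(2,3)]] bdd_meas_mult bdd_meas_omega bdd_meas_broken assms)

lemma mass_form_commute: "mass_form u v = mass_form v u"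
  by (simp add: mass_form_def mult.commute mult.left_commute)

lemma mass_form_linear:
  assumes "u \<in> broken" "v \<in> broken" "w \<in> broken"
  shows "mass_form (u + c *\<^sub>R v) w = mass_form u w + c * mass_form v w"
  unfolding mass_form_def sum_distrib_left sum.distrib[symmetric]
proof (rule sum.cong[OF refl])
  fix K assume K: "K \<in> \<M>"
  show "(LINT x|lebesgue_on K. \<omega> x * fst (u + c *\<^sub>R v) K x * fst w K x)
      = (LINT x|lebesgue_on K. \<omega> x * fst u K x * fst w K x) + c * (LINT x|lebesgue_on K. \<omega> x * fst v K x * fst w K x)"
    using integrable_mass[OF assms(1,3) K] integrable_mass[OF assms(2,3) K]
    by (simp add: distrib_left distrib_right mult_ac)
qed

lemma mass_form_cong: "agree u u' \<Longrightarrow> agree v v' \<Longrightarrow> mass_form u v = mass_form u' v'"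
  by (simp add: mass_form_def agree_def cong: sum.cong)

text \<open>Values off the mesh are not controlled, hence \<open>agree\<close> in place of equality.
  Once the cell unknowns vanish, the jumps are the face unknowns up to sign.\<close>

lemma definite:
  assumes v: "v \<in> broken" and t: "t > 0" and 0: "mass_form v v / t + diffusion v v = 0"
  shows "agree v 0"
proof -
  have nn: "0 \<le> (LINT x|lebesgue_on K. \<omega> x * fst v K x * fst v K x)" for K
    using omega_pos by (intro integral_nonneg_AE) (auto simp: mult.assoc less_imp_le)
  have m0: "0 \<le> mass_form v v" unfolding mass_form_def by (intro sum_nonneg nn)
  have "0 \<le> mass_form v v / t" using m0 t by simp
  then have mz: "mass_form v v = 0" and dz: "diffusion v v = 0"
    using 0 diffusion_form_nonneg[of v] t by (auto simp: add_nonneg_eq_0_iff)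
  have vK: "fst v K = 0" if K: "K \<in> \<M>" for K
  proof -
    have "(LINT x|lebesgue_on K. \<omega> x * fst v K x * fst v K x) = 0"
      using mz K nn finite_mesh(1) unfolding mass_form_def by (subst (asm) sum_nonneg_eq_0_iff) auto
    then have "AE x in lebesgue_on K. \<omega> x * fst v K x * fst v K x = 0"
      using omega_pos by (subst (asm) integral_nonneg_eq_0_iff_AE[OF integrable_mass[OF v v K]])
        (auto simp: mult.assoc less_imp_le)
    then have "AE x in lebesgue_on K. fst v K x = 0"
      by eventually_elim (use omega_pos in \<open>auto simp: less_le\<close>)
    then have "fst v K x = 0" if "x \<in> K" for x
      using continuous_AE_eq_0[OF cell(2)[OF K] continuous_on_broken[OF v K] _ that] by blast
    then show ?thesis
      by (rule polys_eq_0[OF broken_cell[OF v K] cell(2,4)[OF K]])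
  qed
  have "snd v \<sigma> x = 0" if \<sigma>: "\<sigma> \<in> \<E>" and x: "x \<in> \<sigma>" for \<sigma> x
  proof -
    obtain K where K: "K \<in> \<M>" "\<sigma> \<in> \<E>K K" using face_belongs_to_cell[OF \<sigma>] by blast
    obtain n b where nb: "flat_face \<sigma> n b" using face_flat[OF \<sigma>] by blast
    interpret flat_face \<sigma> n b by (rule nb)
    have fnn: "0 \<le> (\<Sum>\<sigma>\<in>\<E>K K'. face_weight \<omega> \<Lambda> K' \<sigma> / diameter \<sigma> * face_part K' \<sigma> v v)" if "K' \<in> \<M>" for K'
      using that by (intro sum_nonneg mult_nonneg_nonneg face_part_nonneg less_imp_le[OF face_coefficient_pos])
    have "cell_part K v v + (\<Sum>\<sigma>\<in>\<E>K K. face_weight \<omega> \<Lambda> K \<sigma> / diameter \<sigma> * face_part K \<sigma> v v) = 0"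
      using dz K(1) finite_mesh(1) fnn cell_part_nonneg unfolding diffusion_form_eq
      by (subst (asm) sum_nonneg_eq_0_iff) auto
    then have "(\<Sum>\<sigma>\<in>\<E>K K. face_weight \<omega> \<Lambda> K \<sigma> / diameter \<sigma> * face_part K \<sigma> v v) = 0"
      using fnn[OF K(1)] cell_part_nonneg[OF K(1), of v] by linarith
    then have "\<forall>\<sigma>\<in>\<E>K K. face_weight \<omega> \<Lambda> K \<sigma> / diameter \<sigma> * face_part K \<sigma> v v = 0"
      using mult_nonneg_nonneg[OF less_imp_le[OF face_coefficient_pos[OF K(1)]] face_part_nonneg]
      by (rule iffD1[OF sum_nonneg_eq_0_iff[OF cell_faces(3)[OF K(1)]], rotated])
    then have fp: "face_part K \<sigma> v v = 0" using K(2) face_coefficient_pos[OF K] by force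
    have c0: "continuous_on UNIV (0 :: real^'d \<Rightarrow> real)" by (simp add: zero_fun_def)
    \<comment> \<open>With both functions 0 and \<open>a = 1\<close>, linearity says that the value
      equals its double.\<close>
    have fp0: "face_projection k \<sigma> 0 y = 0" if "y \<in> \<sigma>" for y
      using face_projection_linear[OF nb c0 c0 that, where k = k and a = 1] by simp
    obtain p where p: "p \<in> polys k" "\<forall>x\<in>\<sigma>. snd v \<sigma> x = p x" using broken_face[OF v \<sigma>] by blast
    have "face_part K \<sigma> v v = (LINT x|face_measure \<sigma>. p x * p x)"
      unfolding face_part_def using p(2) fp0
      by (intro Bochner_Integration.integral_cong) (auto simp: face_jump_def vK[OF K(1)])
    then show ?thesis
      using face_definite[OF continuous_on_polys[OF p(1)] _ x] fp p(2) x by simp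
  qed
  then show ?thesis using vK by (simp add: agree_def)
qed

section \<open>A finite generating family\<close>

definition cell_unit :: "(real^'d) set \<Rightarrow> (real^'d \<Rightarrow> real) \<Rightarrow> 'd hybrid" where
  "cell_unit K p = (\<lambda>K'. if K' = K then p else 0, 0)"

definition face_unit :: "(real^'d) set \<Rightarrow> (real^'d \<Rightarrow> real) \<Rightarrow> 'd hybrid" where
  "face_unit \<sigma> p = (0, \<lambda>\<sigma>'. if \<sigma>' = \<sigma> then p else 0)"

lemma linear_units: "linear (cell_unit K)" "linear (face_unit \<sigma>)"
  by (auto intro!: linearI simp: cell_unit_def face_unit_def prod_eq_iff fun_eq_iff)

definition generators :: "'d hybrid set" where
  "generators = (\<Union>K\<in>\<M>. cell_unit K ` monomial ` {\<alpha>. sum \<alpha> UNIV \<le> k + 1}) \<union>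
    (\<Union>\<sigma>\<in>\<E>. face_unit \<sigma> ` monomial ` {\<alpha>. sum \<alpha> UNIV \<le> k})"

lemma finite_generators: "finite generators"
  unfolding generators_def
  by (intro finite_UnI finite_UN_I finite_mesh finite_imageI finite_multi_indices)

lemma units_in_broken:
  shows "p \<in> polys (k + 1) \<Longrightarrow> cell_unit K p \<in> broken" and "q \<in> polys k \<Longrightarrow> face_unit \<sigma> q \<in> broken"
proof -
  have 0: "0 \<in> polys r" for r by (rule subspace_0[OF subspace_polys])
  show "cell_unit K p \<in> broken" if "p \<in> polys (k + 1)"
    using that 0 by (auto simp: broken_def cell_unit_def intro!: bexI[of _ 0])
  show "face_unit \<sigma> q \<in> broken" if "q \<in> polys k"
    using that 0 by (auto simp: broken_def face_unit_def intro: bexI[of _ 0] bexI[of _ q])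
qed

lemma generators_broken: "generators \<subseteq> broken"
proof -
  have "monomial \<alpha> \<in> polys r" if "sum \<alpha> UNIV \<le> r" for \<alpha> r
    using that unfolding polys_eq_span by (intro span_base) auto
  then show ?thesis
    unfolding generators_def using units_in_broken by blast
qed

lemma span_generators_broken: "span generators \<subseteq> broken"
  by (rule span_minimal[OF generators_broken subspace_broken])

text \<open>Equality cannot be expected: off the mesh \<open>v\<close> is arbitrary, and on each
  face one polynomial extension is chosen. Agreement suffices because the forms depend on nothing
  else.\<close>

lemma agree_span:
  assumes v: "v \<in> broken" shows "\<exists>w\<in>span generators. agree v w"
proof -
  have "\<forall>\<sigma>\<in>\<E>. \<exists>p. p \<in> polys k \<and> (\<forall>x\<in>\<sigma>. snd v \<sigma> x = p x)" using broken_face[OF v] by blast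
  from bchoice[OF this] obtain p where p: "\<And>\<sigma>. \<sigma> \<in> \<E> \<Longrightarrow> p \<sigma> \<in> polys k"
    "\<And>\<sigma> x. \<sigma> \<in> \<E> \<Longrightarrow> x \<in> \<sigma> \<Longrightarrow> snd v \<sigma> x = p \<sigma> x" by blast
  define w where "w = (\<Sum>K\<in>\<M>. cell_unit K (fst v K)) + (\<Sum>\<sigma>\<in>\<E>. face_unit \<sigma> (p \<sigma>))"
  have 0: "0 \<in> polys k" "0 \<in> polys (k + 1)" by (rule subspace_0[OF subspace_polys])+
  have c: "cell_unit K (fst v K) \<in> span generators" if "K \<in> \<M>" for K
  proof (rule subsetD[OF span_mono])
    show "(\<Union>K\<in>\<M>. cell_unit K ` monomial ` {\<alpha>. sum \<alpha> UNIV \<le> k + 1}) \<subseteq> generators" by (auto simp: generators_def)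
    have "cell_unit K (fst v K) \<in> span (cell_unit K ` monomial ` {\<alpha>. sum \<alpha> UNIV \<le> k + 1})"
      using broken_cell[OF v that] unfolding linear_span_image[OF linear_units(1)] polys_eq_span by (rule imageI)
    then show "cell_unit K (fst v K) \<in> span (\<Union>K\<in>\<M>. cell_unit K ` monomial ` {\<alpha>. sum \<alpha> UNIV \<le> k + 1})"
      by (rule subsetD[OF span_mono, rotated]) (use that in blast)
  qed
  have f: "face_unit \<sigma> (p \<sigma>) \<in> span generators" if "\<sigma> \<in> \<E>" for \<sigma>
  proof (rule subsetD[OF span_mono])
    show "(\<Union>\<sigma>\<in>\<E>. face_unit \<sigma> ` monomial ` {\<alpha>. sum \<alpha> UNIV \<le> k}) \<subseteq> generators" by (auto simp: generators_def)
    have "face_unit \<sigma> (p \<sigma>) \<in> span (face_unit \<sigma> ` monomial ` {\<alpha>. sum \<alpha> UNIV \<le> k})"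
      using p(1)[OF that] unfolding linear_span_image[OF linear_units(2)] polys_eq_span by (rule imageI)
    then show "face_unit \<sigma> (p \<sigma>) \<in> span (\<Union>\<sigma>\<in>\<E>. face_unit \<sigma> ` monomial ` {\<alpha>. sum \<alpha> UNIV \<le> k})"
      by (rule subsetD[OF span_mono, rotated]) (use that in blast)
  qed
  have "w \<in> span generators"
    unfolding w_def by (intro span_add span_sum c f)
  moreover have "fst w K = fst v K" if "K \<in> \<M>" for K
    using that finite_mesh(1) by (simp add: w_def fst_sum sum_fun_apply cell_unit_def face_unit_def)
  moreover have "snd w \<sigma> = p \<sigma>" if "\<sigma> \<in> \<E>" for \<sigma>
    using that finite_mesh(2) by (simp add: w_def snd_sum sum_fun_apply cell_unit_def face_unit_def)
  ultimately show ?thesis using p(2) by (intro bexI[of _ w]) (auto simp: agree_def)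
qed

lemma agree_refl: "agree v v"
  by (simp add: agree_def)

text \<open>The previous density \<open>d\<close> is left general because the initial one,
  \<open>u0\<close>, is in general not the weight times a polynomial.\<close>

definition step_eq :: "real \<Rightarrow> ((real^'d) set \<Rightarrow> real^'d \<Rightarrow> real) \<Rightarrow> 'd hybrid \<Rightarrow> 'd hybrid \<Rightarrow> bool" where
  "step_eq t d u v \<longleftrightarrow> (\<Sum>K\<in>\<M>. LINT x|lebesgue_on K. (\<omega> x * fst u K x - d K x) / t * fst v K x)
    + diffusion u v = 0"

text \<open>The elimination solves the problem on a finite span; \<open>agree\<close> carries the
  solution to all test functions in \<open>broken\<close>, and \<open>to_hybrid\<close> brings it
  back to the extensional space.\<close>

lemma step_solvable:
  assumes t: "0 < t" and d: "\<And>K. K \<in> \<M> \<Longrightarrow> integrable (lebesgue_on K) (d K)"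
  shows "\<exists>!u. u \<in> hybrids \<and> (\<forall>v\<in>hybrids. step_eq t d u v)"
proof -
  define L :: "'d hybrid \<Rightarrow> real" where "L v = (\<Sum>K\<in>\<M>. LINT x|lebesgue_on K. d K x * fst v K x) / t" for v
  define B where "B u v = mass_form u v / t + diffusion u v" for u v
  have intd: "integrable (lebesgue_on K) (\<lambda>x. d K x * fst v K x)" if "v \<in> broken" "K \<in> \<M>" for v K
    by (rule integrable_mult_bdd_meas[OF d[OF that(2)] bdd_meas_broken[OF that]])
  have eq: "step_eq t d u v \<longleftrightarrow> B u v = L v" if "u \<in> broken" "v \<in> broken" for u v
  proof -
    have "(\<Sum>K\<in>\<M>. LINT x|lebesgue_on K. (\<omega> x * fst u K x - d K x) / t * fst v K x)
        = (\<Sum>K\<in>\<M>. (LINT x|lebesgue_on K. \<omega> x * fst u K x * fst v K x) / t - (LINT x|lebesgue_on K. d K x * fst v K x) / t)"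
    proof (rule sum.cong[OF refl])
      fix K assume K: "K \<in> \<M>"
      have "(LINT x|lebesgue_on K. (\<omega> x * fst u K x - d K x) / t * fst v K x)
          = (LINT x|lebesgue_on K. \<omega> x * fst u K x * fst v K x / t - d K x * fst v K x / t)"
        by (intro Bochner_Integration.integral_cong refl) (simp add: diff_divide_distrib left_diff_distrib)
      then show "(LINT x|lebesgue_on K. (\<omega> x * fst u K x - d K x) / t * fst v K x)
          = (LINT x|lebesgue_on K. \<omega> x * fst u K x * fst v K x) / t - (LINT x|lebesgue_on K. d K x * fst v K x) / t"
        using integrable_mass[OF that K] intd[OF that(2) K] by simp
    qed
    also have "\<dots> = mass_form u v / t - L v"
      by (simp add: mass_form_def L_def sum_subtractf sum_divide_distrib)
    finally show ?thesis unfolding step_eq_def B_def by linarith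
  qed
  have Bl: "B (u + c *\<^sub>R v) w = B u w + c * B v w" and Br: "B w (u + c *\<^sub>R v) = B w u + c * B w v"
    if "u \<in> broken" "v \<in> broken" "w \<in> broken" for u v w c
    using mass_form_linear[OF that] diffusion_form_linear[OF that]
    by (simp_all add: B_def mass_form_commute[of w] add_divide_distrib distrib_left)
  have Ll: "L (u + c *\<^sub>R v) = L u + c * L v" if "u \<in> broken" "v \<in> broken" for u v c
  proof -
    have "(\<Sum>K\<in>\<M>. LINT x|lebesgue_on K. d K x * fst (u + c *\<^sub>R v) K x)
        = (\<Sum>K\<in>\<M>. (LINT x|lebesgue_on K. d K x * fst u K x) + c * (LINT x|lebesgue_on K. d K x * fst v K x))"
    proof (rule sum.cong[OF refl])
      fix K assume K: "K \<in> \<M>"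
      show "(LINT x|lebesgue_on K. d K x * fst (u + c *\<^sub>R v) K x)
          = (LINT x|lebesgue_on K. d K x * fst u K x) + c * (LINT x|lebesgue_on K. d K x * fst v K x)"
        using intd[OF that(1) K] intd[OF that(2) K] by (simp add: distrib_left mult.left_commute[of _ c])
    qed
    then show ?thesis
      by (simp add: L_def sum.distrib sum_distrib_left[symmetric] add_divide_distrib)
  qed
  have Bcong: "B u v = B u' v'" if "agree u u'" "agree v v'" for u u' v v'
    using mass_form_cong[OF that] diffusion_form_cong[OF that] by (simp add: B_def)
  have Lcong: "L v = L v'" if "agree v v'" for v v'
    using that by (simp add: L_def agree_def cong: sum.cong)
  have zero: "0 \<in> broken" by (rule subspace_0[OF subspace_broken])
  have def: "agree v 0" if "v \<in> broken" "B v v = 0" for v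
    using definite[OF that(1) t] that(2) by (simp add: B_def)
  have "\<exists>u\<in>span generators. \<forall>v\<in>span generators. B u v = L v"
  proof (rule galerkin_solvable[OF finite_generators generators_broken subspace_broken Bl Br Ll])
    \<comment> \<open>A null vector agrees with 0, and neither the form nor the data distinguish
      families that agree.\<close>
    show "B w v = 0 \<and> L v = 0" if "v \<in> broken" "w \<in> broken" "B v v = 0" for v w
      using Bcong[OF agree_refl def[OF that(1,3)], of w] Lcong[OF def[OF that(1,3)]]
        Br[OF zero zero that(2), of 1] Ll[OF zero zero, of 1] by simp
  qed
  then obtain u where u: "u \<in> span generators" "\<And>v. v \<in> span generators \<Longrightarrow> B u v = L v" by blast
  have uV: "u \<in> broken" using u(1) span_generators_broken by blast
  have uB: "B u v = L v" if v: "v \<in> broken" for v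
  proof -
    obtain w where w: "w \<in> span generators" "agree v w" using agree_span[OF v] by blast
    then show ?thesis using u(2)[OF w(1)] Bcong[OF agree_refl w(2), of u] Lcong[OF w(2)] by simp
  qed
  show ?thesis
  proof (rule ex1I[of _ "to_hybrid u"])
    have "step_eq t d (to_hybrid u) v" if v: "v \<in> hybrids" for v
      using eq[OF hybrid_in_broken[OF to_hybrid_in[OF uV]] hybrid_in_broken[OF v]]
        Bcong[OF agree_to_hybrid agree_refl, of u v] uB[OF hybrid_in_broken[OF v]] by simp
    then show "to_hybrid u \<in> hybrids \<and> (\<forall>v\<in>hybrids. step_eq t d (to_hybrid u) v)"
      using to_hybrid_in[OF uV] by blast
    fix w assume w: "w \<in> hybrids \<and> (\<forall>v\<in>hybrids. step_eq t d w v)"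
    then have wV: "w \<in> broken" by (simp add: hybrid_in_broken)
    define z where "z = w + (-1) *\<^sub>R u"
    have zV: "z \<in> broken"
      unfolding z_def using uV wV by (intro subspace_add[OF subspace_broken] subspace_scale[OF subspace_broken])
    \<comment> \<open>The scheme tests \<open>w\<close> with extensional families only; the
      difference \<open>z\<close> need not be one, but its representative agrees with it.\<close>
    have "B w (to_hybrid z) = L (to_hybrid z)"
      using eq[OF wV hybrid_in_broken[OF to_hybrid_in[OF zV]]] w to_hybrid_in[OF zV] by blast
    then have "B w z = L z"
      using Bcong[OF agree_refl agree_to_hybrid, of w z] Lcong[OF agree_to_hybrid, of z] by simp
    then have "B z z = 0"
      using Bl[OF wV uV zV, of "-1"] uB[OF zV] by (simp add: z_def)
    then have "agree z 0" by (rule def[OF zV])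
    then have "agree w u" by (simp add: agree_def z_def)
    then have "agree w (to_hybrid u)" using agree_to_hybrid[of u] by (simp add: agree_def)
    then show "w = to_hybrid u"
      using agree_hybrid_eq[OF _ to_hybrid_in[OF uV]] w by blast
  qed
qed

lemma bdd_meas_density: "u \<in> broken \<Longrightarrow> K \<in> \<M> \<Longrightarrow> bdd_meas (lebesgue_on K) (\<lambda>x. \<omega> x * fst u K x)"
  by (intro bdd_meas_mult bdd_meas_omega bdd_meas_broken)

lemma integrable_density: "u \<in> broken \<Longrightarrow> K \<in> \<M> \<Longrightarrow> integrable (lebesgue_on K) (\<lambda>x. \<omega> x * fst u K x)"
  by (intro bdd_meas_integrable[OF finite_measure_cell[OF cell(2,3)]] bdd_meas_density)

lemma solves_scheme_iff:
  "solves u0 t \<rho> \<longleftrightarrow> \<rho> \<in> {1..} \<rightarrow>\<^sub>E hybrids \<and>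
    (\<forall>n. \<forall>v\<in>hybrids. step_eq t (cell_density \<omega> u0 \<rho> n) (\<rho> (Suc n)) v)"
  by (simp add: solves_scheme_def step_eq_def cell_density_def)

text \<open>Each step determines the next unknown from the previous one, so existence goes by
  recursion and uniqueness by induction. Index 0 is no unknown: extensionality fixes
  \<open>\<rho> 0\<close> to \<open>undefined\<close>, and the data of the first step ignore
  it.\<close>

lemma scheme_well_posed:
  assumes t: "0 < t" and u0: "\<And>K. K \<in> \<M> \<Longrightarrow> integrable (lebesgue_on K) u0"
  shows "\<exists>!\<rho>. solves u0 t \<rho>"
proof -
  define D where "D n r K x = (if n = 0 then u0 x else \<omega> x * fst r K x)" for n :: nat and r :: "'d hybrid" and K x
  define P where "P n r s \<longleftrightarrow> s \<in> hybrids \<and> (\<forall>v\<in>hybrids. step_eq t (D n r) s v)" for n r s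
  have dens: "cell_density \<omega> u0 \<rho> n = D n (\<rho> n)" for \<rho> n
    by (simp add: cell_density_def D_def fun_eq_iff)
  \<comment> \<open>The case \<open>n = 0\<close> is separate because \<open>r\<close> is then
    \<open>undefined\<close>, of which nothing is known.\<close>
  have ex1: "\<exists>!s. P n r s" if "n = 0 \<or> r \<in> hybrids" for n r
    unfolding P_def
  proof (rule step_solvable[OF t])
    show "integrable (lebesgue_on K) (D n r K)" if "K \<in> \<M>" for K
      using \<open>n = 0 \<or> r \<in> hybrids\<close> u0[OF that] integrable_density[OF hybrid_in_broken that]
      by (cases "n = 0") (auto simp: D_def[abs_def])
  qed
  have sol: "solves u0 t \<rho> \<longleftrightarrow> \<rho> 0 = undefined \<and> (\<forall>n. P n (\<rho> n) (\<rho> (Suc n)))" for \<rho>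
  proof
    assume s: "solves u0 t \<rho>"
    then have "\<rho> \<in> {1..} \<rightarrow>\<^sub>E hybrids" by (simp add: solves_scheme_iff)
    then have "\<rho> 0 = undefined" "\<And>n. \<rho> (Suc n) \<in> hybrids" by (auto intro: PiE_arb PiE_mem)
    then show "\<rho> 0 = undefined \<and> (\<forall>n. P n (\<rho> n) (\<rho> (Suc n)))"
      using s by (simp add: solves_scheme_iff P_def dens)
  next
    assume s: "\<rho> 0 = undefined \<and> (\<forall>n. P n (\<rho> n) (\<rho> (Suc n)))"
    have "\<rho> n \<in> hybrids" if "1 \<le> n" for n using s that by (cases n) (auto simp: P_def)
    moreover have "\<rho> n = undefined" if "\<not> 1 \<le> n" for n using s that by (cases n) auto
    ultimately have "\<rho> \<in> {1..} \<rightarrow>\<^sub>E hybrids" by (intro PiE_I) auto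
    then show "solves u0 t \<rho>"
      using s by (simp add: solves_scheme_iff P_def dens)
  qed
  define \<rho> where "\<rho> = rec_nat undefined (\<lambda>n r. THE s. P n r s)"
  have step: "P n (\<rho> n) (\<rho> (Suc n))" for n
  proof (induction n)
    case 0
    show ?case using theI'[OF ex1[of 0 "\<rho> 0"]] by (simp add: \<rho>_def)
  next
    case (Suc n)
    then have "\<rho> (Suc n) \<in> hybrids" by (simp add: P_def)
    then show ?case using theI'[OF ex1[of "Suc n" "\<rho> (Suc n)"]] by (simp add: \<rho>_def)
  qed
  show ?thesis
  proof (rule ex1I[of _ \<rho>])
    show "solves u0 t \<rho>"
      using step by (simp add: sol) (simp add: \<rho>_def)
    fix \<rho>' assume "solves u0 t \<rho>'"
    then have \<rho>': "\<rho>' 0 = undefined" "\<And>n. P n (\<rho>' n) (\<rho>' (Suc n))" by (auto simp: sol)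
    have "\<rho>' n = \<rho> n" for n
    proof (induction n)
      case 0
      show ?case by (simp add: \<rho>'(1) \<rho>_def)
    next
      case (Suc n)
      \<comment> \<open>For \<open>n > 0\<close> the preceding step puts \<open>\<rho> n\<close> in
        the space.\<close>
      have "n = 0 \<or> \<rho> n \<in> hybrids" using step[of "n - 1"] by (cases n) (auto simp: P_def)
      then show ?case using ex1[of n "\<rho> n"] step[of n] \<rho>'(2)[of n] Suc by auto
    qed
    then show "\<rho>' = \<rho>" by auto
  qed
qed

section \<open>Conservation of mass\<close>

definition one_hybrid :: "'d hybrid" where
  "one_hybrid = (\<lambda>_ _. 1, \<lambda>_ _. 1)"

lemma one_hybrid_broken: "one_hybrid \<in> broken"
  using const_in_polys by (auto simp: one_hybrid_def broken_def)

text \<open>The field 0 satisfies the equation that characterises the gradient, by the divergence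
  theorem, and on a face the constant 1 is its own projection.\<close>

lemma diffusion_form_one: "diffusion u one_hybrid = 0"
proof -
  have "grad K one_hybrid = 0" if K: "K \<in> \<M>" for K
  proof (rule discrete_gradient_unique[OF one_hybrid_broken K subspace_0[OF subspace_vec_polys]])
    show "(LINT x|lebesgue_on K. 0 x \<bullet> \<tau> x) = flux K one_hybrid \<tau>" if "\<tau> \<in> vec_polys k" for \<tau>
      using integral_divergence[OF K that] by (simp add: one_hybrid_def)
  qed
  then have "cell_part K u one_hybrid = 0" if "K \<in> \<M>" for K
    using that by (simp add: cell_part_def)
  moreover have "face_part K \<sigma> u one_hybrid = 0" if \<sigma>: "K \<in> \<M>" "\<sigma> \<in> \<E>K K" for K \<sigma>
  proof -
    obtain n b where nb: "flat_face \<sigma> n b" using face_flat[OF cell_face(1)[OF \<sigma>]] by blast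
    have "face_projection k \<sigma> (\<lambda>_. 1) = restrict (\<lambda>_. 1) \<sigma>"
      by (rule face_projection_unique[OF nb _ const_in_polys]) auto
    then have "face_part K \<sigma> u one_hybrid = (LINT x|face_measure \<sigma>. 0)"
      unfolding face_part_def using flat_face.space_face_measure[OF nb]
      by (intro Bochner_Integration.integral_cong) (auto simp: face_jump_def one_hybrid_def)
    then show ?thesis by simp
  qed
  ultimately show ?thesis by (simp add: diffusion_form_eq)
qed

lemma integrable_cell_density:
  assumes "solves u0 t \<rho>" "\<And>K. K \<in> \<M> \<Longrightarrow> integrable (lebesgue_on K) u0" "K \<in> \<M>"
  shows "integrable (lebesgue_on K) (cell_density \<omega> u0 \<rho> n K)"
proof (cases "n = 0")
  case True
  then show ?thesis using assms(2,3) by (simp add: cell_density_def[abs_def])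
next
  case False
  then have "\<rho> n \<in> hybrids"
    using assms(1) by (intro PiE_mem[of \<rho> "{1..}"]) (auto simp: solves_scheme_def)
  then show ?thesis
    using False integrable_density[OF hybrid_in_broken assms(3)] by (simp add: cell_density_def[abs_def])
qed

lemma mass_conservation:
  assumes s: "solves u0 t \<rho>" and t: "0 < t"
    and u0: "\<And>K. K \<in> \<M> \<Longrightarrow> integrable (lebesgue_on K) u0"
  shows "(\<Sum>K\<in>\<M>. LINT x|lebesgue_on K. cell_density \<omega> u0 \<rho> n K x) = (\<Sum>K\<in>\<M>. LINT x|lebesgue_on K. u0 x)"
proof (induction n)
  case 0
  show ?case by (simp add: cell_density_def)
next
  case (Suc n)
  let ?d = "cell_density \<omega> u0 \<rho>"
  \<comment> \<open>The constant family is not extensional; its representative is an admissible test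
    function and equals 1 on every cell.\<close>
  have one: "to_hybrid one_hybrid \<in> hybrids" by (rule to_hybrid_in[OF one_hybrid_broken])
  have "(\<Sum>K\<in>\<M>. LINT x|lebesgue_on K. (?d (Suc n) K x - ?d n K x) / t * fst (to_hybrid one_hybrid) K x)
      + diffusion (\<rho> (Suc n)) (to_hybrid one_hybrid) = 0"
    using s one unfolding solves_scheme_def by blast
  moreover have "diffusion (\<rho> (Suc n)) (to_hybrid one_hybrid) = 0"
    using diffusion_form_cong[OF agree_refl agree_to_hybrid] diffusion_form_one by simp
  ultimately have Z: "(\<Sum>K\<in>\<M>. LINT x|lebesgue_on K. (?d (Suc n) K x - ?d n K x) / t * fst (to_hybrid one_hybrid) K x) = 0"
    by simp
  have E: "((LINT x|lebesgue_on K. ?d (Suc n) K x) - (LINT x|lebesgue_on K. ?d n K x)) / t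
      = (LINT x|lebesgue_on K. (?d (Suc n) K x - ?d n K x) / t * fst (to_hybrid one_hybrid) K x)" if "K \<in> \<M>" for K
    using that integrable_cell_density[OF s u0 that, of "Suc n"] integrable_cell_density[OF s u0 that, of n]
    by (simp add: to_hybrid_def one_hybrid_def)
  have "(\<Sum>K\<in>\<M>. ((LINT x|lebesgue_on K. ?d (Suc n) K x) - (LINT x|lebesgue_on K. ?d n K x)) / t)
      = (\<Sum>K\<in>\<M>. LINT x|lebesgue_on K. (?d (Suc n) K x - ?d n K x) / t * fst (to_hybrid one_hybrid) K x)"
    by (intro sum.cong refl E)
  also note Z
  finally have "(\<Sum>K\<in>\<M>. ((LINT x|lebesgue_on K. ?d (Suc n) K x) - (LINT x|lebesgue_on K. ?d n K x)) / t) = 0" .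
  then have "(\<Sum>K\<in>\<M>. LINT x|lebesgue_on K. ?d (Suc n) K x) = (\<Sum>K\<in>\<M>. LINT x|lebesgue_on K. ?d n K x)"
    using t by (simp add: sum_divide_distrib[symmetric] sum_subtractf)
  then show ?case using Suc by simp
qed

section \<open>Integrals over the domain as sums over cells\<close>

lemma restrict_integral_to_cell:
  fixes f :: "real^'d \<Rightarrow> real"
  assumes K: "K \<in> \<M>" and f: "integrable (lebesgue_on K) f"
  shows "integrable (lebesgue_on \<Omega>) (\<lambda>x. if x \<in> K then f x else 0)"
    and "(LINT x|lebesgue_on \<Omega>. (if x \<in> K then f x else 0)) = (LINT x|lebesgue_on K. f x)"
proof -
  have K\<Omega>: "indicator \<Omega> x * (if x \<in> K then f x else 0) = indicator K x * f x" for x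
    using cell(5)[OF K] by (auto simp: indicator_def)
  have m: "K \<in> sets lebesgue" "\<Omega> \<in> sets lebesgue" using cell(2)[OF K] domain(1) by auto
  show "integrable (lebesgue_on \<Omega>) (\<lambda>x. if x \<in> K then f x else 0)"
    using f m by (simp add: integrable_restrict_space K\<Omega>)
  show "(LINT x|lebesgue_on \<Omega>. (if x \<in> K then f x else 0)) = (LINT x|lebesgue_on K. f x)"
    using m by (simp add: integral_restrict_space K\<Omega>)
qed

text \<open>A point of the domain is in the closure of some cell, hence in a cell or on the
  skeleton, and the skeleton lies in finitely many hyperplanes.\<close>

lemma negligible_skeleton: "negligible (\<Omega> - \<Union>\<M>)"
proof -
  have "negligible (closure \<sigma>)" if \<sigma>: "\<sigma> \<in> \<E>" for \<sigma>
  proof -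
    obtain n b where "flat_face \<sigma> n b" using face_flat[OF \<sigma>] by blast
    then interpret flat_face \<sigma> n b .
    have "closure \<sigma> \<subseteq> {x. n \<bullet> x = b}"
      using on_plane closed_hyperplane by (intro closure_minimal) auto
    moreover have "n \<noteq> 0" using norm_n by auto
    ultimately show ?thesis using negligible_hyperplane negligible_subset by blast
  qed
  then have "negligible (\<Union>\<sigma>\<in>\<E>. closure \<sigma>)" using finite_mesh(2) by (intro negligible_Union) auto
  then have neg: "negligible (\<Union>K\<in>\<M>. frontier K)" by (simp only: skeleton)
  have "x \<in> (\<Union>K\<in>\<M>. frontier K)" if "x \<in> \<Omega> - \<Union>\<M>" for x
  proof -
    have "x \<in> (\<Union>K\<in>\<M>. closure K)" using that closure_subset[of \<Omega>] unfolding mesh_cover[symmetric] by blast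
    then obtain K where "K \<in> \<M>" "x \<in> closure K" by blast
    then show ?thesis using that cell(2) by (auto simp: frontier_def interior_open)
  qed
  then show ?thesis using neg negligible_subset by blast
qed

lemma integral_cells:
  fixes f :: "real^'d \<Rightarrow> real"
  assumes f: "integrable (lebesgue_on \<Omega>) f"
  shows "\<And>K. K \<in> \<M> \<Longrightarrow> integrable (lebesgue_on K) f"
    and "(LINT x|lebesgue_on \<Omega>. f x) = (\<Sum>K\<in>\<M>. LINT x|lebesgue_on K. f x)"
proof -
  have \<Omega>: "\<Omega> \<in> sets lebesgue" using domain(1) by auto
  show int: "integrable (lebesgue_on K) f" if "K \<in> \<M>" for K
  proof -
    have K: "K \<in> sets lebesgue" using cell(2)[OF that] by auto
    have "integrable lebesgue (\<lambda>x. indicator K x *\<^sub>R (indicator \<Omega> x *\<^sub>R f x))"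
      using f \<Omega> by (intro integrable_mult_indicator[OF K]) (simp add: integrable_restrict_space)
    also have "(\<lambda>x. indicator K x *\<^sub>R (indicator \<Omega> x *\<^sub>R f x)) = (\<lambda>x. indicator K x *\<^sub>R f x)"
      using cell(5)[OF that] by (auto simp: indicator_def fun_eq_iff)
    finally show ?thesis using K by (simp add: integrable_restrict_space)
  qed
  have "AE x in lebesgue. x \<notin> \<Omega> - \<Union>\<M>"
    using negligible_skeleton unfolding negligible_iff_null_sets by (rule AE_not_in)
  then have "AE x in lebesgue. x \<in> \<Omega> \<longrightarrow> x \<in> \<Union>\<M>" by eventually_elim auto
  then have ae: "AE x in lebesgue_on \<Omega>. x \<in> \<Union>\<M>" using \<Omega> by (simp add: AE_restrict_space_iff)
  have eq: "f x = (\<Sum>K\<in>\<M>. if x \<in> K then f x else 0)" if x: "x \<in> \<Union>\<M>" for x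
  proof -
    obtain K where K: "K \<in> \<M>" "x \<in> K" using x by blast
    have "x \<in> K' \<longleftrightarrow> K' = K" if "K' \<in> \<M>" for K'
      using disjointD[OF disjoint_mesh(1) that K(1)] K(2) by auto
    then have "(\<Sum>K'\<in>\<M>. if x \<in> K' then f x else 0) = (\<Sum>K'\<in>\<M>. if K' = K then f x else 0)"
      by (intro sum.cong) auto
    then show ?thesis using K(1) finite_mesh(1) by simp
  qed
  note cells = restrict_integral_to_cell[OF _ int]
  have "(LINT x|lebesgue_on \<Omega>. f x) = (LINT x|lebesgue_on \<Omega>. (\<Sum>K\<in>\<M>. if x \<in> K then f x else 0))"
  proof (rule integral_cong_AE)
    show "f \<in> borel_measurable (lebesgue_on \<Omega>)" using f by (rule borel_measurable_integrable)
    show "(\<lambda>x. \<Sum>K\<in>\<M>. if x \<in> K then f x else 0) \<in> borel_measurable (lebesgue_on \<Omega>)"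
      using cells(1) by (intro borel_measurable_sum borel_measurable_integrable)
    show "AE x in lebesgue_on \<Omega>. f x = (\<Sum>K\<in>\<M>. if x \<in> K then f x else 0)"
      using ae by eventually_elim (rule eq)
  qed
  also have "\<dots> = (\<Sum>K\<in>\<M>. LINT x|lebesgue_on \<Omega>. (if x \<in> K then f x else 0))"
    using cells(1) by (intro Bochner_Integration.integral_sum)
  also have "\<dots> = (\<Sum>K\<in>\<M>. LINT x|lebesgue_on K. f x)"
    using cells(2) by (intro sum.cong refl)
  finally show "(LINT x|lebesgue_on \<Omega>. f x) = (\<Sum>K\<in>\<M>. LINT x|lebesgue_on K. f x)" .
qed

lemma integral_global_density:
  assumes "solves u0 t \<rho>" "0 < t" "integrable (lebesgue_on \<Omega>) u0"
  shows "(LINT x|lebesgue_on \<Omega>. global_density \<M> \<omega> u0 \<rho> n x) = (LINT x|lebesgue_on \<Omega>. u0 x)"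
proof -
  note u0 = integral_cells(1)[OF assms(3)]
  note cells = restrict_integral_to_cell[OF _ integrable_cell_density[OF assms(1) u0]]
  have "(LINT x|lebesgue_on \<Omega>. global_density \<M> \<omega> u0 \<rho> n x)
      = (\<Sum>K\<in>\<M>. LINT x|lebesgue_on \<Omega>. (if x \<in> K then cell_density \<omega> u0 \<rho> n K x else 0))"
    unfolding global_density_def using cells(1) by (intro Bochner_Integration.integral_sum)
  also have "\<dots> = (\<Sum>K\<in>\<M>. LINT x|lebesgue_on K. cell_density \<omega> u0 \<rho> n K x)"
    using cells(2) by (intro sum.cong refl)
  also have "\<dots> = (LINT x|lebesgue_on \<Omega>. u0 x)"
    using mass_conservation[OF assms(1,2) u0] integral_cells(2)[OF assms(3)] by simp
  finally show ?thesis .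
qed

end

theorem proposition2:
  fixes \<Omega> :: "(real^'d) set"
    and \<Lambda> :: "real^'d \<Rightarrow> real^'d^'d"
    and \<phi> \<omega> u0 :: "real^'d \<Rightarrow> real"
    and lam M \<Delta>t :: real
    and k :: nat
    and \<M> \<E> :: "(real^'d) set set"
    and \<E>K :: "(real^'d) set \<Rightarrow> (real^'d) set set"
  assumes dim: "CARD('d) \<in> {2, 3}"
    and domain: "open \<Omega>" "bounded \<Omega>" "connected \<Omega>" "polytopal \<Omega>" "lipschitz_boundary \<Omega>"
    and Lambda_Linf: "\<And>i j. Linf \<Omega> (\<lambda>x. \<Lambda> x $ i $ j)"
    and elliptic: "lam > 0"
      "AE x in lebesgue_on \<Omega>. \<forall>\<xi>. (\<Lambda> x *v \<xi>) \<bullet> \<xi> \<ge> lam * (norm \<xi>)\<^sup>2"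
    and phi: "W1inf \<Omega> \<phi>"
    and omega: "\<omega> = (\<lambda>x. exp (- \<phi> x))"
    and u0: "integrable (lebesgue_on \<Omega>) u0" "AE x in lebesgue_on \<Omega>. u0 x \<ge> 0"
      "integrable (lebesgue_on \<Omega>) (\<lambda>x. u0 x * ln (u0 x))"
    and mass: "M = (LINT x|lebesgue_on \<Omega>. u0 x)" "M > 0"
    and time_step: "\<Delta>t > 0"
    and mesh: "discretisation \<Omega> \<M> \<E> \<E>K"
    and Lambda_W1inf: "\<And>K i j. K \<in> \<M> \<Longrightarrow> W1inf K (\<lambda>x. \<Lambda> x $ i $ j)"
  shows "(\<exists>!\<rho>. solves_scheme \<M> \<E> \<E>K k \<omega> \<Lambda> u0 \<Delta>t \<rho>) \<and>
    (\<forall>\<rho>. solves_scheme \<M> \<E> \<E>K k \<omega> \<Lambda> u0 \<Delta>t \<rho> \<longrightarrow>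
      (\<forall>n\<ge>1. (LINT x|lebesgue_on \<Omega>. global_density \<M> \<omega> u0 \<rho> n x) =
               (LINT x|lebesgue_on \<Omega>. u0 x) \<and>
             (LINT x|lebesgue_on \<Omega>. u0 x) = M))"
proof -
  have omega_Linf: "Linf \<Omega> \<omega>"
    using phi unfolding omega W1inf_def Linf_eq_bdd_meas by (intro bdd_meas_exp) blast
  \<comment> \<open>Positivity of the weights is an assumption of the locale, so it is shown before
    the interpretation and directly from the mesh conditions.\<close>
  have W: "0 < face_weight \<omega> \<Lambda> K \<sigma>" if K: "K \<in> \<M>" and \<sigma>: "\<sigma> \<in> \<E>K K" for K \<sigma>
  proof -
    have parts: "\<forall>K\<in>\<M>. mesh_cell K \<and> K \<subseteq> \<Omega>" "\<forall>\<sigma>\<in>\<E>. mesh_face \<sigma> \<and> \<sigma> \<subseteq> closure \<Omega>"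
      "\<forall>K\<in>\<M>. \<E>K K \<subseteq> \<E> \<and> frontier K = (\<Union>\<sigma>\<in>\<E>K K. closure \<sigma>)"
      using mesh unfolding discretisation_def by - (elim conjE, assumption)+
    have Kc: "mesh_cell K" "K \<subseteq> \<Omega>" "\<sigma> \<in> \<E>" "frontier K = (\<Union>\<sigma>\<in>\<E>K K. closure \<sigma>)"
      using conjunct1[OF bspec[OF parts(1) K]] conjunct2[OF bspec[OF parts(1) K]]
        subsetD[OF conjunct1[OF bspec[OF parts(3) K]] \<sigma>] conjunct2[OF bspec[OF parts(3) K]] .
    have \<sigma>c: "mesh_face \<sigma>" "\<sigma> \<subseteq> closure \<Omega>"
      using conjunct1[OF bspec[OF parts(2) Kc(3)]] conjunct2[OF bspec[OF parts(2) Kc(3)]] .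
    have b\<sigma>: "bounded \<sigma>" by (rule bounded_subset[OF bounded_closure[OF domain(2)] \<sigma>c(2)])
    have fr: "\<sigma> \<subseteq> frontier K" unfolding Kc(4) using \<sigma> closure_subset by blast
    obtain c where c: "flat_face \<sigma> (outward_normal K \<sigma>) c"
      using flat_face_outward_normal(1)[OF \<sigma>c(1) b\<sigma> Kc(1) fr] by blast
    have oK: "open K" using Kc(1) by (simp add: mesh_cell_def)
    show ?thesis
      unfolding omega
      by (rule face_weight_pos[OF domain(1) oK Kc(2) c fr flat_face_outward_normal(2)[OF \<sigma>c(1) b\<sigma> Kc(1) fr]
            refl phi Lambda_W1inf[OF K] elliptic])
  qed
  have nonneg: "AE x in lebesgue_on \<Omega>. \<forall>\<xi>. 0 \<le> (\<Lambda> x *v \<xi>) \<bullet> \<xi>"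
    using elliptic(2)
  proof eventually_elim
    case (elim x)
    show ?case
    proof
      fix \<xi> :: "real^'d"
      have "0 \<le> lam * (norm \<xi>)\<^sup>2" using elliptic(1) by simp
      also have "\<dots> \<le> (\<Lambda> x *v \<xi>) \<bullet> \<xi>" using elim by (rule spec)
      finally show "0 \<le> (\<Lambda> x *v \<xi>) \<bullet> \<xi>" .
    qed
  qed
  interpret hybrid_scheme \<Omega> \<M> \<E> \<E>K k \<omega> \<Lambda>
    using dim by (intro hybrid_scheme.intro domain(1,2) mesh omega_Linf Lambda_Linf nonneg W)
      (auto simp: omega)
  show ?thesis
  proof (intro conjI allI impI)
    show "\<exists>!\<rho>. solves_scheme \<M> \<E> \<E>K k \<omega> \<Lambda> u0 \<Delta>t \<rho>"
      by (rule scheme_well_posed[OF time_step integral_cells(1)[OF u0(1)]])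
    show "(LINT x|lebesgue_on \<Omega>. global_density \<M> \<omega> u0 \<rho> n x) = (LINT x|lebesgue_on \<Omega>. u0 x)"
      if "solves_scheme \<M> \<E> \<E>K k \<omega> \<Lambda> u0 \<Delta>t \<rho>" for \<rho> n
      by (rule integral_global_density[OF that time_step u0(1)])
    show "(LINT x|lebesgue_on \<Omega>. u0 x) = M" by (rule mass(1)[symmetric])
  qed
qed

end
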